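(* (Sobolev embedding theorem for Hermite Sobolev spaces) Let $d\in\mathbb N$. For each $k\in\mathbb N_0$ and each real $p>\frac d4+\frac k2$, the pair $(\mathcal S_p(\mathbb R^d),C_0^k(\mathbb R^d))$ consists of continuously embedded Banach spaces; that is, for each $f\in\mathcal S_p(\mathbb R^d)$ there is $g\in C_0^k(\mathbb R^d)$ with $f=g$ almost everywhere, and there is a constant $C>0$ (not depending on $f$) with $\|g\|_{C_0^k(\mathbb R^d)}\le C\|f\|_p$.
   Context: For $p\in\mathbb R$ the Hermite Sobolev space $\mathcal S_p(\mathbb R^d)$ is the completion of the (real) Schwartz space $\mathcal S(\mathbb R^d)$ with respect to the norm $\|\cdot\|_p$ induced by $\langle f,g\rangle_p=\sum_{k=0}^\infty\sum_{|n|=k}(2k+d)^{2p}\langle f,h_n\rangle_{L^2}\langle h_n,g\rangle_{L^2}$, where $(h_n)_{n\in\mathbb N_0^d}$ are the ($L^2$-normalized) Hermite functions on $\mathbb R^d$. For $p\ge0$ one has $\mathcal S_p(\mathbb R^d)=\{f\in L^2(\mathbb R^d):\|f\|_p<\infty\}$. $C_0(\mathbb R^d)$ is the space of continuous $f:\mathbb R^d\to\mathbb R$ with $\lim_{\|x\|\to\infty}f(x)=0$. $C_0^k(\mathbb R^d)$ is the space of all $f\in C^k(\mathbb R^d)$ with $D^\alpha f\in C_0(\mathbb R^d)$ for all $\alpha\in\mathbb N_0^d$, $|\alpha|\le k$, with norm $\|f\|_{C_0^k(\mathbb R^d)}=\sum_{|\alpha|\le k}\|D^\alpha f\|_\infty$.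 *)

theory Defs
  imports "HOL-Analysis.Analysis"
begin

text \<open>Multi-indices are functions \<open>'n \<Rightarrow> nat\<close> on the coordinate type \<open>'n\<close>, so the dimension is
  \<open>d = CARD('n) \<ge> 1\<close>.\<close>

definition order_of :: "('n::finite \<Rightarrow> nat) \<Rightarrow> nat" where
  "order_of \<alpha> = (\<Sum>i\<in>UNIV. \<alpha> i)"

text \<open>Physicists' Hermite polynomials, orthogonal for the weight \<open>exp (- x\<^sup>2)\<close>.\<close>

fun hermite_poly :: "nat \<Rightarrow> real \<Rightarrow> real" where
  "hermite_poly 0 x = 1"
| "hermite_poly (Suc 0) x = 2 * x"
| "hermite_poly (Suc (Suc n)) x = 2 * x * hermite_poly (Suc n) x - 2 * real (Suc n) * hermite_poly n x"

definition hermite_fun1 :: "nat \<Rightarrow> real \<Rightarrow> real" where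
  "hermite_fun1 n x = hermite_poly n x * exp (- x\<^sup>2 / 2) / sqrt (2 ^ n * fact n * sqrt pi)"

definition hermite_fun :: "('n::finite \<Rightarrow> nat) \<Rightarrow> real^'n \<Rightarrow> real" where
  "hermite_fun n x = (\<Prod>i\<in>UNIV. hermite_fun1 (n i) (x $ i))"

definition L2_space :: "(real^'n \<Rightarrow> real) set" where
  "L2_space = {f \<in> borel_measurable lebesgue. integrable lebesgue (\<lambda>x. (f x)\<^sup>2)}"

definition L2_inner :: "(real^'n \<Rightarrow> real) \<Rightarrow> (real^'n \<Rightarrow> real) \<Rightarrow> real" where
  "L2_inner f g = (LINT x|lebesgue. f x * g x)"

definition hs_term :: "real \<Rightarrow> (real^'n \<Rightarrow> real) \<Rightarrow> (real^'n \<Rightarrow> real) \<Rightarrow> nat \<Rightarrow> real" where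
  "hs_term p f g k = (\<Sum>n | order_of n = k.
     real (2 * k + CARD('n)) powr (2 * p) * L2_inner f (hermite_fun n) * L2_inner (hermite_fun n) g)"

definition hs_inner :: "real \<Rightarrow> (real^'n \<Rightarrow> real) \<Rightarrow> (real^'n \<Rightarrow> real) \<Rightarrow> real" where
  "hs_inner p f g = (\<Sum>k. hs_term p f g k)"

definition hs_norm :: "real \<Rightarrow> (real^'n \<Rightarrow> real) \<Rightarrow> real" where
  "hs_norm p f = sqrt (hs_inner p f f)"

text \<open>The space for \<open>p \<ge> 0\<close>, realised inside \<open>L\<^sup>2\<close>. The terms \<open>hs_term p f f k\<close> are nonnegative, so
  summability says exactly that the norm is finite. Elements are functions rather than classes
  modulo a.e. equality; that identification enters in \<open>banach_function_space\<close> below.\<close>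

definition hermite_sobolev :: "real \<Rightarrow> (real^'n \<Rightarrow> real) set" where
  "hermite_sobolev p = {f \<in> L2_space. summable (hs_term p f f)}"

definition partial_differentiable :: "'n \<Rightarrow> (real^'n \<Rightarrow> real) \<Rightarrow> bool" where
  "partial_differentiable i f \<longleftrightarrow> (\<forall>x. (\<lambda>t. f (x + t *\<^sub>R axis i 1)) differentiable (at 0))"

definition partial_deriv :: "'n \<Rightarrow> (real^'n \<Rightarrow> real) \<Rightarrow> real^'n \<Rightarrow> real" where
  "partial_deriv i f x = deriv (\<lambda>t. f (x + t *\<^sub>R axis i 1)) 0"

primrec Ck_fun :: "nat \<Rightarrow> (real^'n \<Rightarrow> real) \<Rightarrow> bool" where
  "Ck_fun 0 f \<longleftrightarrow> continuous_on UNIV f"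
| "Ck_fun (Suc k) f \<longleftrightarrow> continuous_on UNIV f \<and>
     (\<forall>i. partial_differentiable i f \<and> Ck_fun k (partial_deriv i f))"

text \<open>A fixed enumeration of the coordinates, used only to apply the iterated partial derivatives
  in \<open>D\<^sup>\<alpha>\<close> in a definite order; on \<open>C\<^sup>k\<close> functions with \<open>|\<alpha>| \<le> k\<close> the order is immaterial.\<close>

definition coords :: "'n::finite list" where
  "coords = (SOME is. distinct is \<and> set is = UNIV)"

definition multi_deriv :: "('n::finite \<Rightarrow> nat) \<Rightarrow> (real^'n \<Rightarrow> real) \<Rightarrow> real^'n \<Rightarrow> real" where
  "multi_deriv \<alpha> f = foldr (\<lambda>i. partial_deriv i ^^ \<alpha> i) coords f"

definition C0_space :: "(real^'n \<Rightarrow> real) set" where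
  "C0_space = {f. continuous_on UNIV f \<and> (f \<longlongrightarrow> 0) at_infinity}"

definition C0k_space :: "nat \<Rightarrow> (real^'n \<Rightarrow> real) set" where
  "C0k_space k = {f. Ck_fun k f \<and> (\<forall>\<alpha>. order_of \<alpha> \<le> k \<longrightarrow> multi_deriv \<alpha> f \<in> C0_space)}"

definition sup_norm :: "(real^'n \<Rightarrow> real) \<Rightarrow> real" where
  "sup_norm f = (SUP x. \<bar>f x\<bar>)"

definition C0k_norm :: "nat \<Rightarrow> (real^'n \<Rightarrow> real) \<Rightarrow> real" where
  "C0k_norm k f = (\<Sum>\<alpha> | order_of \<alpha> \<le> k. sup_norm (multi_deriv \<alpha> f))"

text \<open>\<open>X\<close> is a real Banach space under pointwise operations and the norm \<open>N\<close>, where functions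
  related by \<open>E\<close> (equality, or equality almost everywhere) count as the same element.\<close>

definition banach_function_space ::
  "(('a \<Rightarrow> real) \<Rightarrow> ('a \<Rightarrow> real) \<Rightarrow> bool) \<Rightarrow> ('a \<Rightarrow> real) set \<Rightarrow> (('a \<Rightarrow> real) \<Rightarrow> real) \<Rightarrow> bool" where
  "banach_function_space E X N \<longleftrightarrow>
     (\<lambda>_. 0) \<in> X \<and>
     (\<forall>f\<in>X. \<forall>g\<in>X. (\<lambda>x. f x + g x) \<in> X \<and> N (\<lambda>x. f x + g x) \<le> N f + N g) \<and>
     (\<forall>c. \<forall>f\<in>X. (\<lambda>x. c * f x) \<in> X \<and> N (\<lambda>x. c * f x) = \<bar>c\<bar> * N f) \<and>
     (\<forall>f\<in>X. 0 \<le> N f \<and> (N f = 0 \<longleftrightarrow> E f (\<lambda>_. 0))) \<and>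
     (\<forall>F :: nat \<Rightarrow> 'a \<Rightarrow> real. (\<forall>m. F m \<in> X) \<and>
        (\<forall>e>0. \<exists>M. \<forall>m\<ge>M. \<forall>n\<ge>M. N (\<lambda>x. F m x - F n x) < e) \<longrightarrow>
        (\<exists>f\<in>X. (\<lambda>n. N (\<lambda>x. F n x - f x)) \<longlonglongrightarrow> 0))"

definition ae_eq :: "(real^'n \<Rightarrow> real) \<Rightarrow> (real^'n \<Rightarrow> real) \<Rightarrow> bool" where
  "ae_eq f g \<longleftrightarrow> (AE x in lebesgue. f x = g x)"

end

theory Submission
  imports Defs "HOL-Probability.Probability"
begin

text \<open>The embedding rests on a bound for \<open>\<Sum>\<^sub>n (2|n| + d) powr (-2q) * (h\<^sub>n x)\<^sup>2\<close>, uniform in \<open>x\<close>, for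
  \<open>q > d/4\<close>. In one variable the partial sum of \<open>(h\<^sub>n x)\<^sup>2\<close> over \<open>n \<le> N\<close> has derivative
  \<open>- sqrt (2(N+1)) * h\<^sub>N * h\<^sub>N\<^sub>+\<^sub>1\<close>, so integrating from \<open>x\<close> to infinity bounds it by \<open>sqrt (2(N+1))\<close>; Abel
  summation adds weights. In \<open>d\<close> variables \<open>2|n| + d \<ge> 2 n\<^sub>i + 1\<close> for every \<open>i\<close>, so the weight is at
  most a product of one-variable weights. A derivative of \<open>h\<^sub>n\<close> is a combination of two neighbours
  with coefficients of order \<open>|n|\<^sup>1\<^sup>/\<^sup>2\<close>, which costs one half in \<open>q\<close>. By Cauchy--Schwarz the partial sums
  of a Hermite series with coefficients in the weighted \<open>\<ell>\<^sup>2\<close> space are Cauchy in \<open>C\<^sub>0\<^sup>k\<close>, and their limit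
  has the prescribed coefficients. Since only \<open>p > d/4\<close> matters, this also replaces Riesz--Fischer in
  the completeness of \<open>S\<^sub>p\<close>.

  The limit is identified with \<open>f\<close> by completeness of the Hermite functions in \<open>L\<^sup>2\<close>, proved one
  coordinate at a time: the moment problem with exponential moments is determinate (by uniqueness of
  characteristic functions), which lets one replace a factor \<open>h\<^sub>m (x\<^sub>i)\<close> by
  \<open>exp (- x\<^sub>i\<^sup>2 / 2)\<close> times the indicator of a Borel set.\<close>

subsection \<open>Iterated partial derivatives\<close>

text \<open>Why the threshold is d/4: a single \<open>hermite_fun1 n\<close> has supremum of order
  n^(-1/12), so termwise bounds in one variable would ask for weights m^(-s) with s > 5/6. The
  averaged bound acts as if (h_m x)^2 had size m^(-1/2) and leaves the sum of m^(-s-1/2), finite for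
  s > 1/2. Sharing the exponent 2q equally among d coordinates gives s = 2q/d, hence q > d/4. A
  second obstacle is the order of differentiation: \<open>Ck_fun\<close> asks for all orders,
  whereas \<open>C0k_norm\<close> sees only the one fixed by \<open>coords\<close>. Derivatives are
  therefore indexed by lists of coordinates, and symmetry of mixed derivatives is proved so that the
  norm controls every list; completeness of C_0^k depends on this. Elements of S_p are determined
  only up to null sets, so the embedding does not regularise f itself: a continuous g is built from
  the coefficients of f, and uniqueness of coefficients identifies the two.\<close>

abbreviation partial_derivs :: "'n list \<Rightarrow> (real^'n \<Rightarrow> real) \<Rightarrow> real^'n \<Rightarrow> real" where
  "partial_derivs L f \<equiv> foldr partial_deriv L f"

text \<open>The definition differentiates only at parameter 0, but from every base point. Moving the
  base point gives the derivative along the whole line, the form that the mean value theorem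
  takes.\<close>

lemma partial_differentiable_has_derivative:
  fixes f :: "real^'n::finite \<Rightarrow> real"
  assumes "partial_differentiable i f"
  shows "((\<lambda>t. f (x + t *\<^sub>R axis i 1)) has_real_derivative partial_deriv i f (x + t *\<^sub>R axis i 1)) (at t)"
proof -
  have "((\<lambda>s. f ((x + t *\<^sub>R axis i 1) + s *\<^sub>R axis i 1)) has_real_derivative
      partial_deriv i f (x + t *\<^sub>R axis i 1)) (at 0)"
    using assms unfolding partial_differentiable_def partial_deriv_def
    by (meson DERIV_deriv_iff_real_differentiable)
  then have "((\<lambda>s. (\<lambda>t. f (x + t *\<^sub>R axis i 1)) (s + t)) has_real_derivative
      partial_deriv i f (x + t *\<^sub>R axis i 1)) (at 0)"
    by (simp add: algebra_simps)
  then show ?thesis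
    using DERIV_shift[of "\<lambda>t. f (x + t *\<^sub>R axis i 1)" "partial_deriv i f (x + t *\<^sub>R axis i 1)" 0 t] by simp
qed

lemma partial_derivI:
  fixes f :: "real^'n::finite \<Rightarrow> real"
  assumes "\<And>x. ((\<lambda>t. f (x + t *\<^sub>R axis i 1)) has_real_derivative g x) (at 0)"
  shows "partial_differentiable i f" "partial_deriv i f = g"
  using assms unfolding partial_differentiable_def partial_deriv_def
  by (auto simp: real_differentiable_def DERIV_imp_deriv)

lemma partial_deriv_lincomb:
  fixes f g :: "real^'n::finite \<Rightarrow> real"
  assumes "partial_differentiable i f" "partial_differentiable i g"
  shows "partial_differentiable i (\<lambda>x. a * f x + b * g x)"
    and "partial_deriv i (\<lambda>x. a * f x + b * g x) = (\<lambda>x. a * partial_deriv i f x + b * partial_deriv i g x)"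
proof -
  have "((\<lambda>t. a * f (x + t *\<^sub>R axis i 1) + b * g (x + t *\<^sub>R axis i 1)) has_real_derivative
      (a * partial_deriv i f x + b * partial_deriv i g x)) (at 0)" for x
    using partial_differentiable_has_derivative[OF assms(1), of x 0]
      partial_differentiable_has_derivative[OF assms(2), of x 0]
    by (auto intro!: derivative_eq_intros)
  note this[THEN partial_derivI(1)] this[THEN partial_derivI(2)]
  then show "partial_differentiable i (\<lambda>x. a * f x + b * g x)"
    "partial_deriv i (\<lambda>x. a * f x + b * g x) = (\<lambda>x. a * partial_deriv i f x + b * partial_deriv i g x)" .
qed

text \<open>\<open>Ck_fun\<close> recurses on the derivative that is applied first, which is the
  last entry of a list. As a condition on all lists, closure under sums, limits and further
  derivatives becomes a matter of list lengths.\<close>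

lemma Ck_fun_iff:
  "Ck_fun k f \<longleftrightarrow> (\<forall>L. length L \<le> k \<longrightarrow> continuous_on UNIV (partial_derivs L f)) \<and>
     (\<forall>L i. length L < k \<longrightarrow> partial_differentiable i (partial_derivs L f))"
proof (induction k arbitrary: f)
  case 0
  then show ?case by simp
next
  case (Suc k)
  \<comment> \<open>Lists are split at the right end because
    \<open>partial_derivs (L @ [i]) f\<close> is
    \<open>partial_derivs L (partial_deriv i f)\<close>.\<close>
  have "(\<forall>L. length L \<le> Suc k \<longrightarrow> P L) \<longleftrightarrow> P [] \<and> (\<forall>i L. length L \<le> k \<longrightarrow> P (L @ [i]))" for P :: "'a list \<Rightarrow> bool"
    by (metis Suc_le_mono le0 length_append_singleton list.size(3) rev_exhaust)
  moreover have "(\<forall>L. length L < Suc k \<longrightarrow> P L) \<longleftrightarrow> P [] \<and> (\<forall>i L. length L < k \<longrightarrow> P (L @ [i]))" for P :: "'a list \<Rightarrow> bool"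
    by (metis Suc_less_eq length_append_singleton list.size(3) rev_exhaust zero_less_Suc)
  ultimately show ?case
    unfolding Ck_fun.simps Suc.IH
    by (subst all_comm) (simp, blast)
qed

lemma Ck_fun_continuous: "Ck_fun k f \<Longrightarrow> length L \<le> k \<Longrightarrow> continuous_on UNIV (partial_derivs L f)"
  and Ck_fun_differentiable: "Ck_fun k f \<Longrightarrow> length L < k \<Longrightarrow> partial_differentiable i (partial_derivs L f)"
  by (simp_all add: Ck_fun_iff)

lemma Ck_fun_mono: "Ck_fun k f \<Longrightarrow> j \<le> k \<Longrightarrow> Ck_fun j f"
  by (simp add: Ck_fun_iff)

lemma Ck_fun_partial_derivs: "Ck_fun (j + length L) f \<Longrightarrow> Ck_fun j (partial_derivs L f)"
  unfolding Ck_fun_iff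
proof (intro conjI allI impI)
  fix M :: "'a list" assume *: "(\<forall>L'. length L' \<le> j + length L \<longrightarrow> continuous_on UNIV (partial_derivs L' f)) \<and>
    (\<forall>L' i. length L' < j + length L \<longrightarrow> partial_differentiable i (partial_derivs L' f))"
  show "length M \<le> j \<Longrightarrow> continuous_on UNIV (partial_derivs M (partial_derivs L f))"
    using *[THEN conjunct1, rule_format, of "M @ L"] by simp
  show "length M < j \<Longrightarrow> partial_differentiable i (partial_derivs M (partial_derivs L f))" for i
    using *[THEN conjunct2, rule_format, of "M @ L"] by simp
qed

lemma partial_derivs_lincomb:
  fixes f g :: "real^'n::finite \<Rightarrow> real"
  assumes "Ck_fun k f" "Ck_fun k g" "length L \<le> k"
  shows "partial_derivs L (\<lambda>x. a * f x + b * g x) = (\<lambda>x. a * partial_derivs L f x + b * partial_derivs L g x)"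
  using assms(3)
proof (induction L)
  case (Cons i L)
  then show ?case
    using assms(1,2) by (simp add: partial_deriv_lincomb Ck_fun_differentiable)
qed simp

lemma Ck_fun_lincomb:
  fixes f g :: "real^'n::finite \<Rightarrow> real"
  assumes "Ck_fun k f" "Ck_fun k g"
  shows "Ck_fun k (\<lambda>x. a * f x + b * g x)"
  unfolding Ck_fun_iff
  using assms
  by (auto simp: partial_derivs_lincomb intro!: continuous_intros partial_deriv_lincomb
      Ck_fun_continuous Ck_fun_differentiable)

text \<open>Mean value theorem twice: in direction \<open>i\<close> for the increment of
  \<open>f\<close> in direction \<open>j\<close>, then in direction \<open>j\<close> for
  \<open>partial_deriv i f\<close>.\<close>

lemma mixed_second_difference:
  fixes f :: "real^'n::finite \<Rightarrow> real"
  assumes f: "partial_differentiable i f" and fi: "partial_differentiable j (partial_deriv i f)" and "h > 0"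
  obtains s t where "0 < s" "s < h" "0 < t" "t < h"
    "f (x + h *\<^sub>R axis i 1 + h *\<^sub>R axis j 1) - f (x + h *\<^sub>R axis i 1) - f (x + h *\<^sub>R axis j 1) + f x
      = h * (h * partial_deriv j (partial_deriv i f) (x + s *\<^sub>R axis i 1 + t *\<^sub>R axis j 1))"
proof -
  define u where "u s = f (x + h *\<^sub>R axis j 1 + s *\<^sub>R axis i 1) - f (x + s *\<^sub>R axis i 1)" for s
  have du: "(u has_real_derivative (partial_deriv i f (x + h *\<^sub>R axis j 1 + s *\<^sub>R axis i 1)
      - partial_deriv i f (x + s *\<^sub>R axis i 1))) (at s)" for s
    unfolding u_def by (intro DERIV_diff partial_differentiable_has_derivative f)
  obtain s where s: "0 < s" "s < h" and us: "u h - u 0 = (h - 0) *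
      (partial_deriv i f (x + h *\<^sub>R axis j 1 + s *\<^sub>R axis i 1) - partial_deriv i f (x + s *\<^sub>R axis i 1))"
    using MVT2[OF \<open>h > 0\<close> du] by blast
  define v where "v t = partial_deriv i f (x + s *\<^sub>R axis i 1 + t *\<^sub>R axis j 1)" for t
  have dv: "(v has_real_derivative partial_deriv j (partial_deriv i f) (x + s *\<^sub>R axis i 1 + t *\<^sub>R axis j 1)) (at t)" for t
    unfolding v_def by (intro partial_differentiable_has_derivative fi)
  obtain t where t: "0 < t" "t < h" and vt: "v h - v 0 = (h - 0) *
      partial_deriv j (partial_deriv i f) (x + s *\<^sub>R axis i 1 + t *\<^sub>R axis j 1)"
    using MVT2[OF \<open>h > 0\<close> dv] by blast
  show ?thesis
    using us vt by (intro that[OF s t]) (simp add: u_def v_def algebra_simps)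
qed

text \<open>The second difference is symmetric in \<open>i\<close> and \<open>j\<close>. Divided by
  h^2 it equals either mixed derivative at a point that tends to \<open>x\<close> with h, and
  continuity identifies the two limits.\<close>

lemma partial_deriv_commute:
  fixes f :: "real^'n::finite \<Rightarrow> real"
  assumes "Ck_fun 2 f"
  shows "partial_deriv i (partial_deriv j f) = partial_deriv j (partial_deriv i f)"
proof
  fix x :: "real^'n"
  have f: "partial_differentiable a f" for a
    using Ck_fun_differentiable[OF assms, of "[]"] by simp
  have f1: "partial_differentiable b (partial_deriv a f)" for a b
    using Ck_fun_differentiable[OF assms, of "[a]"] by simp
  have f2: "isCont (partial_deriv b (partial_deriv a f)) y" for a b :: 'n and y
    using Ck_fun_continuous[OF assms, of "[b, a]"] by (simp add: continuous_on_eq_continuous_at)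
  define h where "h n = inverse (real (Suc n))" for n
  have h: "h n > 0" for n by (simp add: h_def)
  define D where "D a b y = partial_deriv b (partial_deriv a f) y" for a b y
  have "\<exists>s t. 0 < s \<and> s < h n \<and> 0 < t \<and> t < h n \<and>
     f (x + h n *\<^sub>R axis i 1 + h n *\<^sub>R axis j 1) - f (x + h n *\<^sub>R axis i 1) - f (x + h n *\<^sub>R axis j 1) + f x
      = h n * (h n * D i j (x + s *\<^sub>R axis i 1 + t *\<^sub>R axis j 1))" for n
    unfolding D_def by (rule mixed_second_difference[OF f f1 h]) blast
  then obtain s t where st: "\<And>n. 0 < s n \<and> s n < h n \<and> 0 < t n \<and> t n < h n \<and>
     f (x + h n *\<^sub>R axis i 1 + h n *\<^sub>R axis j 1) - f (x + h n *\<^sub>R axis i 1) - f (x + h n *\<^sub>R axis j 1) + f x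
      = h n * (h n * D i j (x + s n *\<^sub>R axis i 1 + t n *\<^sub>R axis j 1))"
    by metis
  have "\<exists>s t. 0 < s \<and> s < h n \<and> 0 < t \<and> t < h n \<and>
     f (x + h n *\<^sub>R axis j 1 + h n *\<^sub>R axis i 1) - f (x + h n *\<^sub>R axis j 1) - f (x + h n *\<^sub>R axis i 1) + f x
      = h n * (h n * D j i (x + s *\<^sub>R axis j 1 + t *\<^sub>R axis i 1))" for n
    unfolding D_def by (rule mixed_second_difference[OF f f1 h]) blast
  then obtain s' t' where st': "\<And>n. 0 < s' n \<and> s' n < h n \<and> 0 < t' n \<and> t' n < h n \<and>
     f (x + h n *\<^sub>R axis j 1 + h n *\<^sub>R axis i 1) - f (x + h n *\<^sub>R axis j 1) - f (x + h n *\<^sub>R axis i 1) + f x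
      = h n * (h n * D j i (x + s' n *\<^sub>R axis j 1 + t' n *\<^sub>R axis i 1))"
    by metis
  have h0: "h \<longlonglongrightarrow> 0"
    unfolding h_def by (rule LIMSEQ_inverse_real_of_nat)
  have lim: "(\<lambda>n. D a b (x + u n *\<^sub>R axis a 1 + v n *\<^sub>R axis b 1)) \<longlonglongrightarrow> D a b x"
    if "\<And>n. 0 < u n \<and> u n < h n" "\<And>n. 0 < v n \<and> v n < h n" for a b :: 'n and u v
  proof -
    have "u \<longlonglongrightarrow> 0" "v \<longlonglongrightarrow> 0"
      using that by (auto intro!: tendsto_sandwich[OF _ _ tendsto_const h0] always_eventually less_imp_le)
    then have "(\<lambda>n. x + u n *\<^sub>R axis a 1 + v n *\<^sub>R axis b 1) \<longlonglongrightarrow> x + 0 *\<^sub>R axis a 1 + 0 *\<^sub>R axis b 1"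
      by (intro tendsto_intros)
    then have "(\<lambda>n. x + u n *\<^sub>R axis a 1 + v n *\<^sub>R axis b 1) \<longlonglongrightarrow> x" by simp
    moreover have "isCont (partial_deriv b (partial_deriv a f)) x" by (rule f2)
    ultimately show ?thesis
      unfolding D_def by (rule isCont_tendsto_compose[rotated])
  qed
  have "D i j (x + s n *\<^sub>R axis i 1 + t n *\<^sub>R axis j 1) = D j i (x + s' n *\<^sub>R axis j 1 + t' n *\<^sub>R axis i 1)" for n
  proof -
    have "f (x + h n *\<^sub>R axis i 1 + h n *\<^sub>R axis j 1) = f (x + h n *\<^sub>R axis j 1 + h n *\<^sub>R axis i 1)"
      by (simp add: algebra_simps)
    then have "h n * (h n * D i j (x + s n *\<^sub>R axis i 1 + t n *\<^sub>R axis j 1))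
        = h n * (h n * D j i (x + s' n *\<^sub>R axis j 1 + t' n *\<^sub>R axis i 1))"
      using st[of n] st'[of n] by linarith
    then show ?thesis using h[of n] by simp
  qed
  then have "D i j x = D j i x"
    using lim[of s t i j] lim[of s' t' j i] st st' by (auto intro: LIMSEQ_unique)
  then show "partial_deriv i (partial_deriv j f) x = partial_deriv j (partial_deriv i f) x"
    by (simp add: D_def)
qed

text \<open>Each swap requires the tail differentiated so far to be C^2 still, which is why the
  length is strictly below \<open>k\<close>.\<close>

lemma partial_derivs_commute1:
  fixes f :: "real^'n::finite \<Rightarrow> real"
  assumes "Ck_fun k f" "length L < k"
  shows "partial_deriv i (partial_derivs L f) = partial_derivs L (partial_deriv i f)"
  using assms(2)
proof (induction L)
  case (Cons j L)
  have "Ck_fun 2 (partial_derivs L f)"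
    using Cons.prems by (intro Ck_fun_partial_derivs Ck_fun_mono[OF assms(1)]) simp
  then show ?case
    using Cons partial_deriv_commute[of "partial_derivs L f" i j] by simp
qed simp

text \<open>The first entry of \<open>L\<close> occurs somewhere in \<open>L'\<close>; commuting it
  to the front of \<open>L'\<close> leaves two shorter lists with equal multisets.\<close>

lemma partial_derivs_mset:
  fixes f :: "real^'n::finite \<Rightarrow> real"
  assumes "Ck_fun k f" "length L \<le> k" "mset L = mset L'"
  shows "partial_derivs L f = partial_derivs L' f"
  using assms(2,3)
proof (induction L arbitrary: L')
  case (Cons i L)
  then have "i \<in> set L'"
    by (metis list.set_intros(1) set_mset_mset)
  then obtain M N where L': "L' = M @ i # N"
    by (meson split_list)
  have eq: "mset L = mset (M @ N)" using Cons.prems L' by simp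
  then have len: "length L = length M + length N"
    by (metis length_append size_mset)
  have "Ck_fun (Suc (length M)) (partial_derivs N f)"
    using Cons.prems len by (intro Ck_fun_partial_derivs Ck_fun_mono[OF assms(1)]) simp
  then have "partial_deriv i (partial_derivs M (partial_derivs N f)) = partial_derivs M (partial_deriv i (partial_derivs N f))"
    by (rule partial_derivs_commute1) simp
  then show ?case
    using Cons.IH[OF _ eq] Cons.prems L' by simp
qed simp

definition multi_index_list :: "('n::finite \<Rightarrow> nat) \<Rightarrow> 'n list" where
  "multi_index_list \<alpha> = concat (map (\<lambda>i. replicate (\<alpha> i) i) coords)"

lemma coords: "distinct (coords :: 'n::finite list)" "set (coords :: 'n list) = UNIV"
proof -
  have "\<exists>is :: 'n list. distinct is \<and> set is = UNIV"
    using finite_distinct_list[of "UNIV :: 'n set"] by auto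
  then have "distinct (coords :: 'n list) \<and> set (coords :: 'n list) = UNIV"
    unfolding coords_def by (rule someI_ex)
  then show "distinct (coords :: 'n list)" "set (coords :: 'n list) = UNIV" by auto
qed

lemma multi_deriv_eq_partial_derivs: "multi_deriv \<alpha> f = partial_derivs (multi_index_list \<alpha>) f"
proof -
  have *: "partial_derivs (replicate m i) g = (partial_deriv i ^^ m) g" for m i and g :: "real^'a \<Rightarrow> real"
    by (induction m) auto
  have "foldr (\<lambda>i. partial_deriv i ^^ \<alpha> i) cs f = partial_derivs (concat (map (\<lambda>i. replicate (\<alpha> i) i) cs)) f" for cs
    by (induction cs) (auto simp: *)
  then show ?thesis
    by (simp add: multi_deriv_def multi_index_list_def)
qed

lemma count_multi_index_list: "count (mset (multi_index_list \<alpha>)) i = \<alpha> i"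
proof -
  have "count (mset (concat (map (\<lambda>i. replicate (\<alpha> i) i) cs))) i = (if i \<in> set cs then \<alpha> i else 0)"
    if "distinct cs" for cs :: "'a list"
    using that by (induction cs) (auto simp: count_replicate_mset)
  from this[of coords] show ?thesis
    by (simp add: multi_index_list_def coords)
qed

lemma length_multi_index_list: "length (multi_index_list \<alpha>) = order_of \<alpha>"
proof -
  have "length (multi_index_list \<alpha>) = size (mset (multi_index_list \<alpha>))" by simp
  also have "\<dots> = (\<Sum>i\<in>UNIV. count (mset (multi_index_list \<alpha>)) i)"
    unfolding size_multiset_overloaded_eq
    by (rule sum.mono_neutral_left) (auto simp: count_eq_zero_iff simp del: set_mset_mset)
  finally show ?thesis by (simp add: count_multi_index_list order_of_def)
qed

text \<open>Counting the entries of \<open>L\<close> gives the multi-index. It depends on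
  \<open>L\<close> alone, so one choice serves all functions; in this way a norm that knows only
  \<alpha> controls derivatives in any order.\<close>

lemma partial_derivs_eq_multi_deriv:
  fixes L :: "'n::finite list"
  obtains \<alpha> where "order_of \<alpha> = length L"
    "\<And>k f. Ck_fun k f \<Longrightarrow> length L \<le> k \<Longrightarrow> partial_derivs L f = multi_deriv \<alpha> f"
proof
  have eq: "mset (multi_index_list (count (mset L))) = mset L"
    by (rule multiset_eqI) (simp add: count_multi_index_list)
  then show "order_of (count (mset L)) = length L"
    by (metis length_multi_index_list size_mset)
  show "partial_derivs L f = multi_deriv (count (mset L)) f" if "Ck_fun k f" "length L \<le> k" for k f
    unfolding multi_deriv_eq_partial_derivs by (rule partial_derivs_mset[OF that eq[symmetric]])
qed

section \<open>The space C_0^k and its norm\<close>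

lemma finite_order_le: "finite {\<alpha> :: 'n::finite \<Rightarrow> nat. order_of \<alpha> \<le> k}"
proof (rule finite_subset)
  show "{\<alpha> :: 'n \<Rightarrow> nat. order_of \<alpha> \<le> k} \<subseteq> PiE UNIV (\<lambda>_. {..k})"
  proof
    fix \<alpha> :: "'n \<Rightarrow> nat" assume "\<alpha> \<in> {\<alpha>. order_of \<alpha> \<le> k}"
    moreover have "\<alpha> i \<le> order_of \<alpha>" for i
      unfolding order_of_def by (rule member_le_sum) auto
    ultimately show "\<alpha> \<in> PiE UNIV (\<lambda>_. {..k})"
      by (auto intro: order_trans)
  qed
qed (auto intro: finite_PiE)

lemma C0k_space_iff:
  "f \<in> C0k_space k \<longleftrightarrow> Ck_fun k f \<and> (\<forall>L. length L \<le> k \<longrightarrow> (partial_derivs L f \<longlongrightarrow> 0) at_infinity)"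
proof (intro iffI conjI allI impI)
  show "Ck_fun k f" if "f \<in> C0k_space k"
    using that by (simp add: C0k_space_def)
  show "(partial_derivs L f \<longlongrightarrow> 0) at_infinity" if "f \<in> C0k_space k" "length L \<le> k" for L
    using that by (rule_tac partial_derivs_eq_multi_deriv[of L]) (auto simp: C0k_space_def C0_space_def)
  show "f \<in> C0k_space k" if "Ck_fun k f \<and> (\<forall>L. length L \<le> k \<longrightarrow> (partial_derivs L f \<longlongrightarrow> 0) at_infinity)"
    using that by (auto simp: C0k_space_def C0_space_def multi_deriv_eq_partial_derivs length_multi_index_list
        Ck_fun_continuous)
qed

text \<open>\<open>sup_norm\<close> is a supremum of reals and says something only for a bounded
  range. Outside a large ball the values are below 1, and on the compact ball continuity bounds
  them.\<close>

lemma C0_space_bounded: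
  fixes f :: "real^'n::finite \<Rightarrow> real"
  assumes "f \<in> C0_space"
  shows "bdd_above (range (\<lambda>x. \<bar>f x\<bar>))"
proof -
  have "eventually (\<lambda>x. dist (f x) 0 < 1) at_infinity"
    using assms tendstoD[of f 0 at_infinity 1] by (auto simp: C0_space_def)
  then obtain R where R: "\<And>x. norm x \<ge> R \<Longrightarrow> \<bar>f x\<bar> < 1"
    by (auto simp: eventually_at_infinity)
  have "compact (f ` cball 0 R)"
    using assms by (intro compact_continuous_image) (auto simp: C0_space_def intro: continuous_on_subset)
  then obtain B where "\<forall>x\<in>cball 0 R. \<bar>f x\<bar> \<le> B"
    by (auto dest!: compact_imp_bounded simp: bounded_iff)
  then have B: "\<bar>f x\<bar> \<le> B" if "norm x \<le> R" for x
    using that by simp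
  have "\<bar>f x\<bar> \<le> max B 1" for x
    using R[of x] B[of x] by (cases "norm x \<ge> R") auto
  then show ?thesis by (auto simp: bdd_above_def)
qed

lemma abs_le_sup_norm: "f \<in> C0_space \<Longrightarrow> \<bar>f x\<bar> \<le> sup_norm f"
  unfolding sup_norm_def by (rule cSUP_upper[OF _ C0_space_bounded]) auto

lemma sup_norm_le: "(\<And>x. \<bar>f x\<bar> \<le> B) \<Longrightarrow> sup_norm f \<le> B"
  unfolding sup_norm_def by (rule cSUP_least) auto

lemma sup_norm_nonneg: "f \<in> C0_space \<Longrightarrow> 0 \<le> sup_norm f"
  by (rule order_trans[OF _ abs_le_sup_norm]) auto

lemma C0_space_lincomb: "f \<in> C0_space \<Longrightarrow> g \<in> C0_space \<Longrightarrow> (\<lambda>x. a * f x + b * g x) \<in> C0_space"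
  unfolding C0_space_def by (auto intro!: continuous_intros tendsto_eq_intros)

lemma C0k_space_Ck_fun: "f \<in> C0k_space k \<Longrightarrow> Ck_fun k f"
  by (simp add: C0k_space_def)

lemma C0k_space_multi_deriv: "f \<in> C0k_space k \<Longrightarrow> order_of \<alpha> \<le> k \<Longrightarrow> multi_deriv \<alpha> f \<in> C0_space"
  by (simp add: C0k_space_def)

lemma multi_deriv_lincomb:
  "Ck_fun k f \<Longrightarrow> Ck_fun k g \<Longrightarrow> order_of \<alpha> \<le> k \<Longrightarrow>
    multi_deriv \<alpha> (\<lambda>x. a * f x + b * g x) = (\<lambda>x. a * multi_deriv \<alpha> f x + b * multi_deriv \<alpha> g x)"
  unfolding multi_deriv_eq_partial_derivs by (simp add: partial_derivs_lincomb length_multi_index_list)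

lemma C0k_space_lincomb: "f \<in> C0k_space k \<Longrightarrow> g \<in> C0k_space k \<Longrightarrow> (\<lambda>x. a * f x + b * g x) \<in> C0k_space k"
  unfolding C0k_space_def by (auto simp: multi_deriv_lincomb intro!: Ck_fun_lincomb C0_space_lincomb)

lemma C0k_space_diff: "f \<in> C0k_space k \<Longrightarrow> g \<in> C0k_space k \<Longrightarrow> (\<lambda>x. f x - g x) \<in> C0k_space k"
  using C0k_space_lincomb[of f k g 1 "-1"] by simp

lemma C0k_norm_le:
  assumes "\<And>L x. length L \<le> k \<Longrightarrow> \<bar>partial_derivs L f x\<bar> \<le> B"
  shows "C0k_norm k (f :: real^'n::finite \<Rightarrow> real) \<le> real (card {\<alpha> :: 'n \<Rightarrow> nat. order_of \<alpha> \<le> k}) * B"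
  unfolding C0k_norm_def
  by (rule sum_bounded_above) (auto intro!: sup_norm_le assms simp: multi_deriv_eq_partial_derivs length_multi_index_list)

lemma multi_deriv_le_C0k_norm:
  assumes "f \<in> C0k_space k" "order_of \<alpha> \<le> k"
  shows "\<bar>multi_deriv \<alpha> f x\<bar> \<le> C0k_norm k f"
proof -
  have "\<bar>multi_deriv \<alpha> f x\<bar> \<le> sup_norm (multi_deriv \<alpha> f)"
    using assms by (intro abs_le_sup_norm C0k_space_multi_deriv)
  also have "\<dots> \<le> C0k_norm k f"
    unfolding C0k_norm_def using assms
    by (intro member_le_sum[where f = "\<lambda>\<alpha>. sup_norm (multi_deriv \<alpha> f)"])
       (auto intro: sup_norm_nonneg C0k_space_multi_deriv finite_order_le)
  finally show ?thesis .
qed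

lemma partial_derivs_le_C0k_norm:
  assumes "f \<in> C0k_space k" "length L \<le> k"
  shows "\<bar>partial_derivs L f x\<bar> \<le> C0k_norm k f"
proof (rule partial_derivs_eq_multi_deriv[of L])
  fix \<alpha> assume \<alpha>: "order_of \<alpha> = length L"
    "\<And>k f. Ck_fun k f \<Longrightarrow> length L \<le> k \<Longrightarrow> partial_derivs L f = multi_deriv \<alpha> f"
  show ?thesis
    using multi_deriv_le_C0k_norm[OF assms(1), of \<alpha> x] \<alpha>(1) \<alpha>(2)[OF C0k_space_Ck_fun[OF assms(1)] assms(2)] assms(2)
    by simp
qed

lemma abs_le_C0k_norm: "f \<in> C0k_space k \<Longrightarrow> \<bar>f x\<bar> \<le> C0k_norm k f"
  using partial_derivs_le_C0k_norm[of f k "[]"] by simp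

section \<open>Uniform limits and completeness of C_0^k\<close>

lemma partial_deriv_uniform_limit:
  fixes F :: "nat \<Rightarrow> real^'n::finite \<Rightarrow> real"
  assumes diff: "\<And>m. partial_differentiable i (F m)"
    and lim: "\<And>x. (\<lambda>m. F m x) \<longlonglongrightarrow> g x"
    and unif: "uniform_limit UNIV (\<lambda>m. partial_deriv i (F m)) g' sequentially"
  shows "partial_differentiable i g" "partial_deriv i g = g'"
proof -
  have "((\<lambda>t. g (x + t *\<^sub>R axis i 1)) has_real_derivative g' x) (at 0)" for x
  proof -
    let ?y = "\<lambda>t. x + t *\<^sub>R axis i 1"
    \<comment> \<open>On a line in direction \<open>i\<close> this is the one-variable theorem on
      differentiating a sequence; uniformity on the whole space is inherited by the line. The
      theorem yields some limit \<open>G\<close>, which pointwise convergence then identifies with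
      \<open>g\<close> along the line.\<close>
    have "\<exists>G. \<forall>t\<in>UNIV. (\<lambda>m. F m (?y t)) \<longlonglongrightarrow> G t \<and> (G has_derivative (\<lambda>h. g' (?y t) * h)) (at t within UNIV)"
    proof (rule has_derivative_sequence)
      show "((\<lambda>t. F m (?y t)) has_derivative (\<lambda>h. partial_deriv i (F m) (?y t) * h)) (at t within UNIV)" for m t
        unfolding has_field_derivative_def[symmetric]
        using partial_differentiable_has_derivative[OF diff] by simp
      show "\<forall>\<^sub>F m in sequentially. \<forall>t\<in>UNIV. \<forall>h. norm (partial_deriv i (F m) (?y t) * h - g' (?y t) * h) \<le> e * norm h"
        if "e > 0" for e
      proof -
        have "\<forall>\<^sub>F m in sequentially. \<forall>x\<in>UNIV. dist (partial_deriv i (F m) x) (g' x) < e"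
          using unif that by (rule uniform_limitD)
        then show ?thesis
          by eventually_elim
            (auto simp: dist_real_def abs_mult left_diff_distrib[symmetric] less_imp_le intro!: mult_right_mono)
      qed
      show "(\<lambda>m. F m (?y 0)) \<longlonglongrightarrow> g (?y 0)" by (rule lim)
    qed auto
    then obtain G where G: "\<And>t. (\<lambda>m. F m (?y t)) \<longlonglongrightarrow> G t" "\<And>t. (G has_derivative (\<lambda>h. g' (?y t) * h)) (at t)"
      by auto
    have "G = (\<lambda>t. g (?y t))"
      using LIMSEQ_unique[OF G(1) lim] by auto
    then show ?thesis
      using G(2)[of 0] by (simp add: has_field_derivative_def)
  qed
  then show "partial_differentiable i g" "partial_deriv i g = g'"
    using partial_derivI by blast+
qed

lemma C0_uniform_limit:
  fixes F :: "nat \<Rightarrow> real^'n::finite \<Rightarrow> real"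
  assumes F: "\<And>m. (F m \<longlongrightarrow> 0) at_infinity" and unif: "uniform_limit UNIV F g sequentially"
  shows "(g \<longlongrightarrow> 0) at_infinity"
proof (rule tendstoI)
  fix e :: real assume "e > 0"
  then have "\<forall>\<^sub>F m in sequentially. \<forall>x\<in>UNIV. dist (F m x) (g x) < e / 2"
    by (intro uniform_limitD[OF unif]) simp
  then obtain m where m: "\<And>x. dist (F m x) (g x) < e / 2"
    by (auto simp: eventually_sequentially)
  have "\<forall>\<^sub>F x in at_infinity. dist (F m x) 0 < e / 2"
    using \<open>e > 0\<close> by (intro tendstoD[OF F]) simp
  then show "\<forall>\<^sub>F x in at_infinity. dist (g x) 0 < e"
    by eventually_elim (metis dist_commute dist_triangle_half_l m)
qed

text \<open>For every list the derivatives converge uniformly to some \<open>G L\<close>, and these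
  limits are linked by \<open>partial_deriv i (G L) = G (i # L)\<close>; so they are the derivatives
  of \<open>G []\<close>. Uniform convergence is returned as well, since the Hermite series later
  takes pointwise limits.\<close>

lemma C0k_complete:
  fixes F :: "nat \<Rightarrow> real^'n::finite \<Rightarrow> real"
  assumes F: "\<And>m. F m \<in> C0k_space k"
    and Cauchy: "\<And>e. e > 0 \<Longrightarrow> \<exists>M. \<forall>m\<ge>M. \<forall>n\<ge>M. C0k_norm k (\<lambda>x. F m x - F n x) < e"
  obtains f where "f \<in> C0k_space k" "(\<lambda>n. C0k_norm k (\<lambda>x. F n x - f x)) \<longlonglongrightarrow> 0"
    "uniform_limit UNIV F f sequentially"
proof -
  have Ck: "Ck_fun k (F m)" for m using F by (simp add: C0k_space_def)
  have diff: "partial_derivs L (\<lambda>x. F m x - F n x) y = partial_derivs L (F m) y - partial_derivs L (F n) y"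
    if "length L \<le> k" for L m n y
    using partial_derivs_lincomb[OF Ck[of m] Ck[of n] that, of 1 "-1"] by simp
  have "\<exists>g. uniform_limit UNIV (\<lambda>m. partial_derivs L (F m)) g sequentially" if L: "length L \<le> k" for L
  proof -
    have "uniformly_Cauchy_on UNIV (\<lambda>m. partial_derivs L (F m))"
    proof (rule uniformly_Cauchy_onI)
      fix e :: real assume "e > 0"
      then obtain M where M: "\<And>m n. m \<ge> M \<Longrightarrow> n \<ge> M \<Longrightarrow> C0k_norm k (\<lambda>x. F m x - F n x) < e"
        using Cauchy by metis
      have "dist (partial_derivs L (F m) x) (partial_derivs L (F n) x) < e" if "m \<ge> M" "n \<ge> M" for m n x
      proof -
        have "\<bar>partial_derivs L (\<lambda>y. F m y - F n y) x\<bar> \<le> C0k_norm k (\<lambda>y. F m y - F n y)"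
          by (rule partial_derivs_le_C0k_norm[OF C0k_space_diff[OF F F] L])
        then show ?thesis
          using M[OF that] by (simp add: diff[OF L] dist_real_def)
      qed
      then show "\<exists>M. \<forall>x\<in>UNIV. \<forall>m\<ge>M. \<forall>n\<ge>M. dist (partial_derivs L (F m) x) (partial_derivs L (F n) x) < e"
        by blast
    qed
    then show ?thesis
      using Cauchy_uniformly_convergent uniformly_convergent_on_def by blast
  qed
  then obtain G where G: "\<And>L. length L \<le> k \<Longrightarrow> uniform_limit UNIV (\<lambda>m. partial_derivs L (F m)) (G L) sequentially"
    by metis
  have step: "partial_differentiable i (G L)" "partial_deriv i (G L) = G (i # L)" if "length L < k" for i L
  proof -
    note * = partial_deriv_uniform_limit[of i "\<lambda>m. partial_derivs L (F m)" "G L" "G (i # L)"]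
    have "(\<lambda>m. partial_derivs L (F m) x) \<longlonglongrightarrow> G L x" for x
      using G[of L] that by (auto intro: tendsto_uniform_limitI)
    then show "partial_differentiable i (G L)" "partial_deriv i (G L) = G (i # L)"
      using * G[of "i # L"] that Ck by (auto intro: Ck_fun_differentiable)
  qed
  define f where "f = G []"
  have fG: "partial_derivs L f = G L" if "length L \<le> k" for L
    using that by (induction L) (auto simp: f_def step)
  have "continuous_on UNIV (G L)" if "length L \<le> k" for L
    using Ck that by (intro uniform_limit_theorem[OF _ G[OF that]]) (auto intro: Ck_fun_continuous always_eventually)
  then have Ckf: "Ck_fun k f"
    by (auto simp: Ck_fun_iff fG step)
  have "(partial_derivs L f \<longlongrightarrow> 0) at_infinity" if "length L \<le> k" for L
    using F that unfolding fG[OF that] C0k_space_iff by (intro C0_uniform_limit[OF _ G[OF that]]) auto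
  then have f: "f \<in> C0k_space k"
    using Ckf by (simp add: C0k_space_iff)
  moreover have "(\<lambda>n. C0k_norm k (\<lambda>x. F n x - f x)) \<longlonglongrightarrow> 0"
    unfolding C0k_norm_def
  proof (rule tendsto_null_sum)
    fix \<alpha> :: "'n \<Rightarrow> nat" assume "\<alpha> \<in> {\<alpha>. order_of \<alpha> \<le> k}"
    then have L: "length (multi_index_list \<alpha>) \<le> k" by (simp add: length_multi_index_list)
    have d: "multi_deriv \<alpha> (\<lambda>x. F n x - f x) x = partial_derivs (multi_index_list \<alpha>) (F n) x - G (multi_index_list \<alpha>) x" for n x
      using partial_derivs_lincomb[OF Ck[of n] Ckf L, of 1 "-1"] by (simp add: multi_deriv_eq_partial_derivs fG[OF L])
    have nn: "0 \<le> sup_norm (multi_deriv \<alpha> (\<lambda>x. F n x - f x))" for n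
      using C0k_space_diff[OF F f] L by (intro sup_norm_nonneg C0k_space_multi_deriv) (auto simp: length_multi_index_list)
    show "(\<lambda>n. sup_norm (multi_deriv \<alpha> (\<lambda>x. F n x - f x))) \<longlonglongrightarrow> 0"
    proof (rule tendstoI)
      fix e :: real assume "e > 0"
      then have "\<forall>\<^sub>F n in sequentially. \<forall>x\<in>UNIV. dist (partial_derivs (multi_index_list \<alpha>) (F n) x) (G (multi_index_list \<alpha>) x) < e / 2"
        by (intro uniform_limitD[OF G[OF L]]) simp
      then show "\<forall>\<^sub>F n in sequentially. dist (sup_norm (multi_deriv \<alpha> (\<lambda>x. F n x - f x))) 0 < e"
      proof eventually_elim
        case (elim n)
        then have "sup_norm (multi_deriv \<alpha> (\<lambda>x. F n x - f x)) \<le> e / 2"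
          by (intro sup_norm_le) (auto simp: d dist_real_def intro: less_imp_le)
        then show ?case using nn[of n] \<open>e > 0\<close> by simp
      qed
    qed
  qed
  moreover have "uniform_limit UNIV F f sequentially"
    using G[of "[]"] by (simp add: f_def)
  ultimately show ?thesis using that by blast
qed

section \<open>Banach space axioms for C_0^k\<close>

lemma C0k_norm_triangle:
  assumes f: "f \<in> C0k_space k" and g: "g \<in> C0k_space k"
  shows "C0k_norm k (\<lambda>x. f x + g x) \<le> C0k_norm k f + C0k_norm k g"
  unfolding C0k_norm_def sum.distrib[symmetric]
proof (rule sum_mono)
  fix \<alpha> :: "'a \<Rightarrow> nat" assume "\<alpha> \<in> {\<alpha>. order_of \<alpha> \<le> k}"
  then have \<alpha>: "order_of \<alpha> \<le> k" by simp
  have "multi_deriv \<alpha> (\<lambda>x. f x + g x) = (\<lambda>x. multi_deriv \<alpha> f x + multi_deriv \<alpha> g x)"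
    using multi_deriv_lincomb[of k f g \<alpha> 1 1] f g \<alpha> by (simp add: C0k_space_def)
  then show "sup_norm (multi_deriv \<alpha> (\<lambda>x. f x + g x)) \<le> sup_norm (multi_deriv \<alpha> f) + sup_norm (multi_deriv \<alpha> g)"
    using C0k_space_multi_deriv[OF f \<alpha>] C0k_space_multi_deriv[OF g \<alpha>]
    by (auto intro!: sup_norm_le abs_triangle_ineq[THEN order_trans] add_mono abs_le_sup_norm)
qed

lemma sup_norm_scale:
  assumes "f \<in> C0_space"
  shows "sup_norm (\<lambda>x. c * f x) = \<bar>c\<bar> * sup_norm f"
proof (rule antisym)
  show "sup_norm (\<lambda>x. c * f x) \<le> \<bar>c\<bar> * sup_norm f"
    by (auto intro!: sup_norm_le mult_left_mono abs_le_sup_norm assms simp: abs_mult)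
  show "\<bar>c\<bar> * sup_norm f \<le> sup_norm (\<lambda>x. c * f x)"
  proof (cases "c = 0")
    case True
    then show ?thesis by (simp add: sup_norm_def)
  next
    case False
    have "(\<lambda>x. c * f x) \<in> C0_space"
      using C0_space_lincomb[OF assms assms, of c 0] by simp
    then have "\<bar>c * f x\<bar> \<le> sup_norm (\<lambda>x. c * f x)" for x by (rule abs_le_sup_norm)
    then have "\<bar>f x\<bar> \<le> sup_norm (\<lambda>x. c * f x) / \<bar>c\<bar>" for x
      using False by (simp add: abs_mult field_simps)
    then have "sup_norm f \<le> sup_norm (\<lambda>x. c * f x) / \<bar>c\<bar>" by (rule sup_norm_le)
    then show ?thesis using False by (simp add: field_simps)
  qed
qed

lemma C0k_norm_scale:
  assumes f: "f \<in> C0k_space k"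
  shows "C0k_norm k (\<lambda>x. c * f x) = \<bar>c\<bar> * C0k_norm k f"
  unfolding C0k_norm_def sum_distrib_left
proof (rule sum.cong)
  fix \<alpha> :: "'a \<Rightarrow> nat" assume "\<alpha> \<in> {\<alpha>. order_of \<alpha> \<le> k}"
  then have \<alpha>: "order_of \<alpha> \<le> k" by simp
  have "multi_deriv \<alpha> (\<lambda>x. c * f x) = (\<lambda>x. c * multi_deriv \<alpha> f x)"
    using multi_deriv_lincomb[of k f f \<alpha> c 0] f \<alpha> by (simp add: C0k_space_def)
  then show "sup_norm (multi_deriv \<alpha> (\<lambda>x. c * f x)) = \<bar>c\<bar> * sup_norm (multi_deriv \<alpha> f)"
    using C0k_space_multi_deriv[OF f \<alpha>] by (simp add: sup_norm_scale)
qed auto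

lemma partial_derivs_zero: "partial_derivs L (\<lambda>_. 0) = (\<lambda>_. 0)"
  by (induction L) (simp_all add: partial_derivI(2)[where g = "\<lambda>_. 0"])

lemma C0k_space_zero: "(\<lambda>_. 0) \<in> C0k_space k"
proof -
  have "partial_differentiable i (\<lambda>_ :: real^'a. 0 :: real)" for i
    by (rule partial_derivI(1)[where g = "\<lambda>_. 0"]) auto
  then show ?thesis
    unfolding C0k_space_iff Ck_fun_iff by (simp add: partial_derivs_zero)
qed

lemma C0k_norm_nonneg: "f \<in> C0k_space k \<Longrightarrow> 0 \<le> C0k_norm k f"
  by (rule order_trans[OF _ abs_le_C0k_norm]) auto

lemma C0k_banach: "banach_function_space (=) (C0k_space k :: (real^'n::finite \<Rightarrow> real) set) (C0k_norm k)"
  unfolding banach_function_space_def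
proof (intro conjI ballI allI impI)
  show "(\<lambda>_. 0) \<in> C0k_space k" by (rule C0k_space_zero)
next
  fix f g :: "real^'n \<Rightarrow> real" assume fg: "f \<in> C0k_space k" "g \<in> C0k_space k"
  then show "(\<lambda>x. f x + g x) \<in> C0k_space k"
    using C0k_space_lincomb[of f k g 1 1] by simp
  show "C0k_norm k (\<lambda>x. f x + g x) \<le> C0k_norm k f + C0k_norm k g"
    using fg by (rule C0k_norm_triangle)
next
  fix f :: "real^'n \<Rightarrow> real" and c assume f: "f \<in> C0k_space k"
  show "(\<lambda>x. c * f x) \<in> C0k_space k"
    using C0k_space_lincomb[OF f f, of c 0] by simp
  show "C0k_norm k (\<lambda>x. c * f x) = \<bar>c\<bar> * C0k_norm k f"
    using f by (rule C0k_norm_scale)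
next
  fix f :: "real^'n \<Rightarrow> real" assume f: "f \<in> C0k_space k"
  then show "0 \<le> C0k_norm k f" by (rule C0k_norm_nonneg)
  show "(C0k_norm k f = 0) = (f = (\<lambda>_. 0))"
  proof
    assume "C0k_norm k f = 0"
    then show "f = (\<lambda>_. 0)" using abs_le_C0k_norm[OF f] by auto
  next
    assume "f = (\<lambda>_. 0)"
    then show "C0k_norm k f = 0"
      using C0k_norm_scale[OF f, of 0] by simp
  qed
next
  fix F :: "nat \<Rightarrow> real^'n \<Rightarrow> real"
  assume "(\<forall>m. F m \<in> C0k_space k) \<and> (\<forall>e>0. \<exists>M. \<forall>m\<ge>M. \<forall>n\<ge>M. C0k_norm k (\<lambda>x. F m x - F n x) < e)"
  then show "\<exists>f\<in>C0k_space k. (\<lambda>n. C0k_norm k (\<lambda>x. F n x - f x)) \<longlonglongrightarrow> 0"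
    by (elim conjE) (rule C0k_complete[of F k], blast+)
qed

subsection \<open>Hermite functions of one variable\<close>

text \<open>At n = 0 the index \<open>n - 1\<close> is again 0, but its coefficient is 0; so
  recurrence, derivative and ladder formulas hold for all n without a special case.\<close>

lemma hermite_poly_rec: "2 * x * hermite_poly n x = hermite_poly (Suc n) x + 2 * real n * hermite_poly (n - 1) x"
  by (cases n) auto

lemma hermite_poly_deriv:
  "(hermite_poly n has_real_derivative 2 * real n * hermite_poly (n - 1) x) (at x)"
proof (induction n arbitrary: x rule: less_induct)
  case (less n)
  consider "n = 0" | "n = 1" | m where "n = Suc (Suc m)" by (metis One_nat_def not0_implies_Suc)
  then show ?case
  proof cases
    case 1
    then have "hermite_poly n = (\<lambda>_. 1)" by (simp add: fun_eq_iff)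
    then show ?thesis using 1 by simp
  next
    case 2
    then have "hermite_poly n = (\<lambda>x. 2 * x)" by (simp add: fun_eq_iff)
    then show ?thesis using 2 by (auto intro!: derivative_eq_intros)
  next
    case (3 m)
    have eq: "hermite_poly n = (\<lambda>x. 2 * x * hermite_poly (Suc m) x - 2 * real (Suc m) * hermite_poly m x)"
      using 3 by (simp add: fun_eq_iff)
    have IH: "(hermite_poly (Suc m) has_real_derivative 2 * real (Suc m) * hermite_poly m x) (at x)"
      "(hermite_poly m has_real_derivative 2 * real m * hermite_poly (m - 1) x) (at x)"
      using less[of "Suc m" x] less[of m x] 3 by auto
    have "(hermite_poly n has_real_derivative 2 * hermite_poly (Suc m) x + 2 * x * (2 * real (Suc m) * hermite_poly m x)
       - 2 * real (Suc m) * (2 * real m * hermite_poly (m - 1) x)) (at x)"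
      unfolding eq by (rule derivative_eq_intros IH refl | simp)+
    also have "2 * hermite_poly (Suc m) x + 2 * x * (2 * real (Suc m) * hermite_poly m x)
       - 2 * real (Suc m) * (2 * real m * hermite_poly (m - 1) x)
       = 2 * hermite_poly (Suc m) x + 2 * real (Suc m) * (2 * x * hermite_poly m x - 2 * real m * hermite_poly (m - 1) x)"
      by (simp add: algebra_simps)
    also have "\<dots> = 2 * real n * hermite_poly (n - 1) x"
      unfolding hermite_poly_rec[of x m] by (simp add: 3 algebra_simps)
    finally show ?thesis .
  qed
qed

lemma hermite_const_Suc: "sqrt (2 ^ Suc n * fact (Suc n) * sqrt pi) = sqrt (2 * real (Suc n)) * sqrt (2 ^ n * fact n * sqrt pi)"
  unfolding real_sqrt_mult[symmetric] by (rule arg_cong[of _ _ sqrt]) (simp add: algebra_simps)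

text \<open>The normalising constants at n and n - 1 differ by the factor sqrt (2 n), and n / sqrt
  (2 n) = sqrt (n / 2). \<open>hermite_fun1_upper\<close> raises the index by the analogous quotient
  1/2.\<close>

lemma hermite_fun1_lower:
  "real n * hermite_poly (n - 1) x * exp (- x\<^sup>2 / 2) / sqrt (2 ^ n * fact n * sqrt pi)
    = sqrt (real n / 2) * hermite_fun1 (n - 1) x"
proof (cases n)
  case (Suc m)
  have "sqrt (real n / 2) * sqrt (2 * real n) = sqrt ((real n)\<^sup>2)"
    unfolding real_sqrt_mult[symmetric] by (rule arg_cong[of _ _ sqrt]) (simp add: power2_eq_square)
  then have "real n / sqrt (2 * real n) = (sqrt (real n / 2) * sqrt (2 * real n)) / sqrt (2 * real n)"
    by (simp only: real_sqrt_abs abs_of_nat)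
  also have "\<dots> = sqrt (real n / 2)"
    by (rule nonzero_mult_div_cancel_right) (simp add: Suc)
  finally have "real n / sqrt (2 * real n) = sqrt (real n / 2)" .
  moreover have "real n * hermite_poly (n - 1) x * exp (- x\<^sup>2 / 2) / sqrt (2 ^ n * fact n * sqrt pi)
      = (real n / sqrt (2 * real n)) * hermite_fun1 (n - 1) x"
    unfolding hermite_fun1_def Suc hermite_const_Suc by simp
  ultimately show ?thesis by simp
qed simp

lemma hermite_fun1_upper:
  "hermite_poly (Suc n) x * exp (- x\<^sup>2 / 2) / (2 * sqrt (2 ^ n * fact n * sqrt pi))
    = sqrt (real (Suc n) / 2) * hermite_fun1 (Suc n) x"
proof -
  have "sqrt (real (Suc n) / 2) / sqrt (2 * real (Suc n)) = sqrt ((real (Suc n) / 2) / (2 * real (Suc n)))"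
    by (simp only: real_sqrt_divide)
  also have "(real (Suc n) / 2) / (2 * real (Suc n)) = (1/2)\<^sup>2"
    by (simp add: power2_eq_square)
  finally have *: "sqrt (real (Suc n) / 2) / sqrt (2 * real (Suc n)) = 1 / 2" by simp
  have "sqrt (real (Suc n) / 2) * hermite_fun1 (Suc n) x
      = (sqrt (real (Suc n) / 2) / sqrt (2 * real (Suc n))) * (hermite_poly (Suc n) x * exp (- x\<^sup>2 / 2) / sqrt (2 ^ n * fact n * sqrt pi))"
    unfolding hermite_fun1_def hermite_const_Suc by (simp only: times_divide_eq_right times_divide_eq_left divide_divide_eq_left ac_simps)
  then show ?thesis unfolding * by simp
qed

text \<open>With annihilation A h_n = sqrt n h_(n-1) and creation B h_n = sqrt (n+1) h_(n+1), this
  is x = (A + B) / sqrt 2, and \<open>hermite_fun1_deriv\<close> is d/dx = (A - B) / sqrt 2.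
  Orthogonality, the telescoping sum and the derivative bounds all come from this pair.\<close>

lemma hermite_fun1_mult:
  "x * hermite_fun1 n x = sqrt (real n / 2) * hermite_fun1 (n - 1) x + sqrt (real (Suc n) / 2) * hermite_fun1 (Suc n) x"
proof -
  have "x * hermite_poly n x = real n * hermite_poly (n - 1) x + hermite_poly (Suc n) x / 2"
    using hermite_poly_rec[of x n] by simp
  then have "x * hermite_fun1 n x = (real n * hermite_poly (n - 1) x + hermite_poly (Suc n) x / 2) * exp (- x\<^sup>2 / 2)
      / sqrt (2 ^ n * fact n * sqrt pi)"
    unfolding hermite_fun1_def by (metis mult.assoc times_divide_eq_right)
  also have "\<dots> = real n * hermite_poly (n - 1) x * exp (- x\<^sup>2 / 2) / sqrt (2 ^ n * fact n * sqrt pi)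
      + hermite_poly (Suc n) x * exp (- x\<^sup>2 / 2) / (2 * sqrt (2 ^ n * fact n * sqrt pi))"
    by (simp add: distrib_right add_divide_distrib)
  finally show ?thesis unfolding hermite_fun1_lower hermite_fun1_upper .
qed

lemma hermite_fun1_deriv:
  "(hermite_fun1 n has_real_derivative
     (sqrt (real n / 2) * hermite_fun1 (n - 1) x - sqrt (real (Suc n) / 2) * hermite_fun1 (Suc n) x)) (at x)"
proof -
  have "((\<lambda>x. hermite_poly n x * exp (- x\<^sup>2 / 2)) has_real_derivative
     (2 * real n * hermite_poly (n - 1) x * exp (- x\<^sup>2 / 2) + hermite_poly n x * (exp (- x\<^sup>2 / 2) * (- x)))) (at x)"
    by (rule derivative_eq_intros hermite_poly_deriv refl | simp)+
  then have "((\<lambda>x. hermite_poly n x * exp (- x\<^sup>2 / 2) / sqrt (2 ^ n * fact n * sqrt pi)) has_real_derivative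
     (2 * real n * hermite_poly (n - 1) x * exp (- x\<^sup>2 / 2) + hermite_poly n x * (exp (- x\<^sup>2 / 2) * (- x)))
       / sqrt (2 ^ n * fact n * sqrt pi)) (at x)"
    by (rule DERIV_cdivide)
  also have "(2 * real n * hermite_poly (n - 1) x * exp (- x\<^sup>2 / 2) + hermite_poly n x * (exp (- x\<^sup>2 / 2) * (- x)))
       / sqrt (2 ^ n * fact n * sqrt pi)
     = 2 * (real n * hermite_poly (n - 1) x * exp (- x\<^sup>2 / 2) / sqrt (2 ^ n * fact n * sqrt pi)) - x * hermite_fun1 n x"
    by (simp add: hermite_fun1_def add_divide_distrib diff_divide_distrib mult.assoc mult.left_commute mult.commute)
  also have "\<dots> = sqrt (real n / 2) * hermite_fun1 (n - 1) x - sqrt (real (Suc n) / 2) * hermite_fun1 (Suc n) x"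
    unfolding hermite_fun1_lower hermite_fun1_mult by simp
  finally show ?thesis by (simp add: hermite_fun1_def[abs_def])
qed

lemma hermite_fun1_isCont: "isCont (hermite_fun1 n) x"
  by (rule DERIV_isCont[OF hermite_fun1_deriv])

lemma continuous_hermite_fun1 [continuous_intros]: "continuous_on S (hermite_fun1 n)"
  by (simp add: continuous_at_imp_continuous_on hermite_fun1_isCont)

lemma measurable_hermite_fun1 [measurable]: "hermite_fun1 n \<in> borel_measurable borel"
  by (rule borel_measurable_continuous_onI[OF continuous_hermite_fun1])

section \<open>Gaussian decay and integrability\<close>

lemma hermite_poly_growth: "\<exists>C\<ge>0. \<forall>x. \<bar>hermite_poly n x\<bar> \<le> C * (1 + \<bar>x\<bar>) ^ n"
proof (induction n rule: less_induct)
  case (less n)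
  consider "n = 0" | "n = 1" | m where "n = Suc (Suc m)" by (metis One_nat_def not0_implies_Suc)
  then show ?case
  proof cases
    case 1 then show ?thesis by (intro exI[of _ 1]) simp
  next
    case 2 then show ?thesis by (intro exI[of _ 2]) (simp add: abs_mult)
  next
    case (3 m)
    obtain A where A: "A \<ge> 0" "\<And>x. \<bar>hermite_poly (Suc m) x\<bar> \<le> A * (1 + \<bar>x\<bar>) ^ Suc m"
      using less[of "Suc m"] 3 by auto
    obtain B where B: "B \<ge> 0" "\<And>x. \<bar>hermite_poly m x\<bar> \<le> B * (1 + \<bar>x\<bar>) ^ m"
      using less[of m] 3 by auto
    have "\<bar>hermite_poly n x\<bar> \<le> (2 * A + 2 * real (Suc m) * B) * (1 + \<bar>x\<bar>) ^ n" for x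
    proof -
      have "\<bar>hermite_poly n x\<bar> \<le> \<bar>2 * x * hermite_poly (Suc m) x\<bar> + \<bar>2 * real (Suc m) * hermite_poly m x\<bar>"
        unfolding 3 hermite_poly.simps(3) by (rule abs_triangle_ineq4)
      also have "\<dots> = 2 * \<bar>x\<bar> * \<bar>hermite_poly (Suc m) x\<bar> + 2 * real (Suc m) * \<bar>hermite_poly m x\<bar>"
        by (simp add: abs_mult)
      also have "\<dots> \<le> 2 * (1 + \<bar>x\<bar>) * (A * (1 + \<bar>x\<bar>) ^ Suc m) + 2 * real (Suc m) * (B * (1 + \<bar>x\<bar>) ^ m)"
        by (intro add_mono mult_mono A B) auto
      also have "\<dots> \<le> 2 * (1 + \<bar>x\<bar>) * (A * (1 + \<bar>x\<bar>) ^ Suc m) + 2 * real (Suc m) * (B * (1 + \<bar>x\<bar>) ^ n)"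
        using B by (intro add_left_mono mult_left_mono power_increasing) (auto simp: 3)
      finally show ?thesis by (simp add: 3 algebra_simps)
    qed
    then show ?thesis using A B by (intro exI[of _ "2 * A + 2 * real (Suc m) * B"]) auto
  qed
qed

text \<open>The exponent is distributed over the factors: 1 + |x| is at most a constant times exp
  (x^2 / (4 (m+1))), and m such factors give at most exp (x^2 / 4). Dividing by m + 1 covers m = 0.
  Half of the decay exp (- x^2 / 2) is left over for integrability.\<close>

lemma power_le_gauss: "(1 + \<bar>x\<bar>) ^ m \<le> (8 * real (Suc m)) ^ m * exp (x\<^sup>2 / 4)" for x :: real
proof -
  have x: "\<bar>x\<bar> \<le> 1 + x\<^sup>2"
    using abs_le_square_iff[of 1 x] sum_squares_ge_zero[of "\<bar>x\<bar> - 1" 0] power2_abs[of x]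
    by (simp add: power2_eq_square algebra_simps)
  have "1 + \<bar>x\<bar> \<le> 8 * real (Suc m) * (1 + x\<^sup>2 / (4 * real (Suc m)))"
  proof -
    have "8 * real (Suc m) * (1 + x\<^sup>2 / (4 * real (Suc m))) = 8 * real (Suc m) + 2 * x\<^sup>2"
      by (simp add: field_simps)
    moreover have "8 \<le> 8 * real (Suc m)" by simp
    ultimately show ?thesis using x by (smt (verit) zero_le_power2)
  qed
  also have "\<dots> \<le> 8 * real (Suc m) * exp (x\<^sup>2 / (4 * real (Suc m)))"
    by (intro mult_left_mono) auto
  finally have "(1 + \<bar>x\<bar>) ^ m \<le> (8 * real (Suc m) * exp (x\<^sup>2 / (4 * real (Suc m)))) ^ m"
    by (intro power_mono) auto
  also have "\<dots> = (8 * real (Suc m)) ^ m * exp (real m * (x\<^sup>2 / (4 * real (Suc m))))"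
    by (simp only: power_mult_distrib exp_of_nat_mult)
  also have "\<dots> \<le> (8 * real (Suc m)) ^ m * exp (x\<^sup>2 / 4)"
    by (intro mult_left_mono) (auto simp: field_simps)
  finally show ?thesis .
qed

lemma hermite_fun1_decay: "\<exists>C\<ge>0. \<forall>x. \<bar>hermite_fun1 n x\<bar> \<le> C * exp (- x\<^sup>2 / 4)"
proof -
  obtain C where C: "C \<ge> 0" "\<And>x. \<bar>hermite_poly n x\<bar> \<le> C * (1 + \<bar>x\<bar>) ^ n"
    using hermite_poly_growth[of n] by auto
  define c where "c = sqrt (2 ^ n * fact n * sqrt pi)"
  have c: "c > 0" by (simp add: c_def)
  define D where "D = C * (8 * real (Suc n)) ^ n / c"
  have "\<bar>hermite_fun1 n x\<bar> \<le> D * exp (- x\<^sup>2 / 4)" for x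
  proof -
    have "\<bar>hermite_fun1 n x\<bar> = \<bar>hermite_poly n x\<bar> * exp (- x\<^sup>2 / 2) / c"
      using c by (simp add: hermite_fun1_def c_def abs_mult)
    also have "\<dots> \<le> (C * ((8 * real (Suc n)) ^ n * exp (x\<^sup>2 / 4))) * exp (- x\<^sup>2 / 2) / c"
      using C c power_le_gauss[of x n]
      by (intro divide_right_mono mult_right_mono order_trans[OF C(2)] mult_left_mono) auto
    also have "\<dots> = D * (exp (x\<^sup>2 / 4) * exp (- x\<^sup>2 / 2))"
      by (simp add: D_def)
    also have "exp (x\<^sup>2 / 4) * exp (- x\<^sup>2 / 2) = exp (- x\<^sup>2 / 4)"
      by (simp add: exp_add[symmetric])
    finally show ?thesis .
  qed
  moreover have "D \<ge> 0" using C c by (simp add: D_def)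
  ultimately show ?thesis by blast
qed

lemma gauss_integrable: "integrable lborel (\<lambda>x::real. exp (- x\<^sup>2 / 4))"
proof -
  have "integrable lborel (\<lambda>x. sqrt (4 * pi) * normal_density 0 (sqrt 2) x)"
    by (intro integrable_mult_right integrable_normal_density) auto
  moreover have "sqrt (4 * pi) * normal_density 0 (sqrt 2) x = exp (- x\<^sup>2 / 4)" for x
    by (simp add: normal_density_def)
  ultimately show ?thesis by simp
qed

lemma gauss_integral: "(LINT x|lborel. exp (- (x::real)\<^sup>2)) = sqrt pi"
proof -
  have "sqrt pi * normal_density 0 (sqrt (1/2)) x = exp (- x\<^sup>2)" for x :: real
    by (simp add: normal_density_def power_divide real_sqrt_divide)
  then have "(LINT x|lborel. exp (- (x::real)\<^sup>2)) = (LINT x|lborel. sqrt pi * normal_density 0 (sqrt (1/2)) x)"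
    by simp
  also have "\<dots> = sqrt pi"
    by (subst integral_mult_right_zero) (simp add: integral_normal_density)
  finally show ?thesis .
qed

lemma gauss_dominated_integrable:
  fixes f :: "real \<Rightarrow> real"
  assumes [measurable]: "f \<in> borel_measurable borel" and "\<And>x. \<bar>f x\<bar> \<le> C * exp (- x\<^sup>2 / 4)"
  shows "integrable lborel f"
proof (rule Bochner_Integration.integrable_bound)
  show "integrable lborel (\<lambda>x::real. C * exp (- x\<^sup>2 / 4))"
    by (intro integrable_mult_right gauss_integrable)
  show "AE x in lborel. norm (f x) \<le> norm (C * exp (- x\<^sup>2 / 4))"
    using assms(2) by (auto intro!: AE_I2 order_trans[OF assms(2)])
qed simp

lemma hermite_fun1_prod_decay: "\<exists>C\<ge>0. \<forall>x. \<bar>hermite_fun1 m x * hermite_fun1 n x\<bar> \<le> C * exp (- x\<^sup>2 / 4)"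
proof -
  obtain C where C: "C \<ge> 0" "\<And>x. \<bar>hermite_fun1 m x\<bar> \<le> C * exp (- x\<^sup>2 / 4)" using hermite_fun1_decay by blast
  obtain D where D: "D \<ge> 0" "\<And>x. \<bar>hermite_fun1 n x\<bar> \<le> D * exp (- x\<^sup>2 / 4)" using hermite_fun1_decay by blast
  have "\<bar>hermite_fun1 m x * hermite_fun1 n x\<bar> \<le> (C * D) * exp (- x\<^sup>2 / 4)" for x
  proof -
    have "\<bar>hermite_fun1 n x\<bar> \<le> D * 1"
      using D by (rule_tac order_trans[OF D(2)]) (intro mult_left_mono, auto)
    then have "\<bar>hermite_fun1 m x\<bar> * \<bar>hermite_fun1 n x\<bar> \<le> (C * exp (- x\<^sup>2 / 4)) * D"
      using C D by (intro mult_mono) auto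
    then show ?thesis by (simp add: abs_mult algebra_simps)
  qed
  then show ?thesis using C D by (intro exI[of _ "C * D"]) auto
qed

lemma hermite_fun1_prod_integrable: "integrable lborel (\<lambda>x. hermite_fun1 m x * hermite_fun1 n x)"
proof -
  obtain C where "\<And>x. \<bar>hermite_fun1 m x * hermite_fun1 n x\<bar> \<le> C * exp (- x\<^sup>2 / 4)"
    using hermite_fun1_prod_decay[of m n] by blast
  then show ?thesis by (intro gauss_dominated_integrable[where C = C]) auto
qed

lemma hermite_fun1_prod_tendsto:
  "((\<lambda>x. hermite_fun1 m x * hermite_fun1 n x) \<longlongrightarrow> 0) at_top" (is ?top)
  "((\<lambda>x. hermite_fun1 m x * hermite_fun1 n x) \<longlongrightarrow> 0) at_bot" (is ?bot)
proof -
  obtain C where C: "\<And>x. \<bar>hermite_fun1 m x * hermite_fun1 n x\<bar> \<le> C * exp (- x\<^sup>2 / 4)"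
    using hermite_fun1_prod_decay[of m n] by auto
  have *: "((\<lambda>x. hermite_fun1 m x * hermite_fun1 n x) \<longlongrightarrow> 0) F"
    if "((\<lambda>x::real. C * exp (- x\<^sup>2 / 4)) \<longlongrightarrow> 0) F" for F
    using C by (intro Lim_null_comparison[OF _ that] always_eventually) simp
  show ?top by (rule *) real_asymp
  show ?bot by (rule *) real_asymp
qed

section \<open>Orthonormality and the sum of squares in one variable\<close>

lemma integral_derivative_real_line:
  fixes F f :: "real \<Rightarrow> real"
  assumes "\<And>x. (F has_real_derivative f x) (at x)" "\<And>x. isCont f x" "integrable lborel f"
    and "(F \<longlongrightarrow> 0) at_top" "(F \<longlongrightarrow> 0) at_bot"
  shows "integral\<^sup>L lborel f = 0"
proof -
  have "(LBINT x=-\<infinity>..\<infinity>. f x) = 0 - 0"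
    using assms
    by (intro interval_integral_FTC_integrable[where F = F])
       (simp_all add: set_integrable_def ereal_tendsto_simps has_real_derivative_iff_has_vector_derivative)
  then show ?thesis by (simp add: interval_lebesgue_integral_def set_lebesgue_integral_def)
qed

text \<open>Integrating over the whole line on the right, not only beyond \<open>x\<close>, makes
  the bound uniform in \<open>x\<close>.\<close>

lemma integral_derivative_half_line:
  fixes F f :: "real \<Rightarrow> real"
  assumes "\<And>x. (F has_real_derivative f x) (at x)" "\<And>x. isCont f x" "integrable lborel f"
    and "(F \<longlongrightarrow> 0) at_top"
  shows "\<bar>F x\<bar> \<le> (LINT y|lborel. \<bar>f y\<bar>)"
proof -
  have "(F \<longlongrightarrow> F x) (at_right x)"
    using assms(1) by (meson DERIV_isCont continuous_at_imp_continuous_at_within continuous_within)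
  moreover have "integrable lborel (\<lambda>y. indicator {x<..} y * f y)"
    using integrable_mult_indicator[of "{x<..}" lborel f] assms(3) by simp
  ultimately have "(LBINT y=ereal x..\<infinity>. f y) = 0 - F x"
    using assms
    by (intro interval_integral_FTC_integrable[where F = F])
       (auto simp: set_integrable_def ereal_tendsto_simps has_real_derivative_iff_has_vector_derivative)
  then have "F x = - (LINT y|lborel. indicator {x<..} y * f y)"
    by (simp add: interval_lebesgue_integral_def set_lebesgue_integral_def)
  then have "\<bar>F x\<bar> \<le> (LINT y|lborel. \<bar>indicator {x<..} y * f y\<bar>)"
    using integral_abs_bound[of lborel "\<lambda>y. indicator {x<..} y * f y"] by simp
  also have "\<dots> \<le> (LINT y|lborel. \<bar>f y\<bar>)"
    using assms(3) integrable_mult_indicator[of "{x<..}" lborel f]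
    by (intro integral_mono integrable_abs) (auto simp: indicator_def)
  finally show ?thesis .
qed

text \<open>Creation and annihilation are adjoint: sqrt 2 B = x - d/dx and sqrt 2 A = x + d/dx, so
  the two integrands differ by the derivative of h_m h_n, which integrates to 0.\<close>

lemma hermite_fun1_adjoint:
  "sqrt (2 * real (Suc n)) * (LINT x|lborel. hermite_fun1 m x * hermite_fun1 (Suc n) x)
    = sqrt (2 * real m) * (LINT x|lborel. hermite_fun1 (m - 1) x * hermite_fun1 n x)"
proof -
  define dh where "dh n x = sqrt (real n / 2) * hermite_fun1 (n - 1) x - sqrt (real (Suc n) / 2) * hermite_fun1 (Suc n) x" for n x
  have sq: "sqrt (2 * real n) = 2 * sqrt (real n / 2)" for n
    by (rule real_sqrt_unique) (auto simp: power2_eq_square algebra_simps real_sqrt_mult_self)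
  have up: "sqrt (2 * real (Suc n)) * hermite_fun1 (Suc n) x = x * hermite_fun1 n x - dh n x" for n x
    unfolding hermite_fun1_mult dh_def sq by simp
  have low: "sqrt (2 * real m) * hermite_fun1 (m - 1) x = x * hermite_fun1 m x + dh m x" for m x
    unfolding hermite_fun1_mult dh_def sq by simp
  have int: "integrable lborel (\<lambda>x. dh m x * hermite_fun1 n x + dh n x * hermite_fun1 m x)"
    unfolding dh_def left_diff_distrib mult.assoc
    by (intro Bochner_Integration.integrable_add Bochner_Integration.integrable_diff integrable_mult_right hermite_fun1_prod_integrable)
  have "(LINT x|lborel. dh m x * hermite_fun1 n x + dh n x * hermite_fun1 m x) = 0"
  proof (rule integral_derivative_real_line[OF _ _ int])
    show "((\<lambda>x. hermite_fun1 m x * hermite_fun1 n x) has_real_derivative (dh m x * hermite_fun1 n x + dh n x * hermite_fun1 m x)) (at x)" for x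
      using DERIV_mult[OF hermite_fun1_deriv[of m x] hermite_fun1_deriv[of n x]] by (simp add: dh_def)
    show "isCont (\<lambda>x. dh m x * hermite_fun1 n x + dh n x * hermite_fun1 m x) x" for x
      unfolding dh_def by (intro continuous_intros hermite_fun1_isCont)
  qed (rule hermite_fun1_prod_tendsto)+
  also have "(\<lambda>x. dh m x * hermite_fun1 n x + dh n x * hermite_fun1 m x)
      = (\<lambda>x. sqrt (2 * real m) * (hermite_fun1 (m - 1) x * hermite_fun1 n x) - sqrt (2 * real (Suc n)) * (hermite_fun1 m x * hermite_fun1 (Suc n) x))"
  proof
    fix x
    have "dh m x = sqrt (2 * real m) * hermite_fun1 (m - 1) x - x * hermite_fun1 m x"
      "dh n x = x * hermite_fun1 n x - sqrt (2 * real (Suc n)) * hermite_fun1 (Suc n) x"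
      using up[of n x] low[of m x] by auto
    then show "dh m x * hermite_fun1 n x + dh n x * hermite_fun1 m x
        = sqrt (2 * real m) * (hermite_fun1 (m - 1) x * hermite_fun1 n x) - sqrt (2 * real (Suc n)) * (hermite_fun1 m x * hermite_fun1 (Suc n) x)"
      by (simp only: left_diff_distrib ac_simps) (simp add: algebra_simps)
  qed
  finally show ?thesis
    by (simp add: hermite_fun1_prod_integrable)
qed

text \<open>Adjointness lowers both indices at once until one of them is 0. There annihilation kills
  h_0, and the norm of h_0 is the Gaussian integral.\<close>

lemma hermite_fun1_orthonormal:
  "(LINT x|lborel. hermite_fun1 m x * hermite_fun1 n x) = (if m = n then 1 else 0)"
proof -
  have zero: "(LINT x|lborel. hermite_fun1 0 x * hermite_fun1 (Suc n) x) = 0" for n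
    using hermite_fun1_adjoint[of n 0] by simp
  have "hermite_fun1 0 x * hermite_fun1 0 x = exp (- x\<^sup>2) / sqrt pi" for x
    by (simp add: hermite_fun1_def exp_add[symmetric])
  then have one: "(LINT x|lborel. hermite_fun1 0 x * hermite_fun1 0 x) = 1"
    by (simp add: gauss_integral)
  show ?thesis
  proof (induction n arbitrary: m)
    case 0
    then show ?case using one zero[of "m - 1"] by (cases m) (auto simp: mult.commute)
  next
    case (Suc n)
    show ?case
    proof (cases m)
      case 0
      then show ?thesis by (simp add: zero)
    next
      case (Suc l)
      have "sqrt (2 * real (Suc n)) * (LINT x|lborel. hermite_fun1 m x * hermite_fun1 (Suc n) x)
        = sqrt (2 * real m) * (if l = n then 1 else 0)"
        using hermite_fun1_adjoint[of n m] Suc.IH[of l] by (simp add: Suc)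
      then show ?thesis by (cases "l = n") (auto simp: Suc)
    qed
  qed
qed

text \<open>The derivative of the partial sum telescopes to a single product, whose \<open>L\<^sup>1\<close> norm is at most one.\<close>

lemma sum_hermite_fun1_square_le: "(\<Sum>n\<le>N. (hermite_fun1 n x)\<^sup>2) \<le> sqrt (2 * real (Suc N))"
proof -
  define K where "K x = (\<Sum>n\<le>N. hermite_fun1 n x * hermite_fun1 n x)" for x
  define k where "k x = - sqrt (2 * real (Suc N)) * (hermite_fun1 N x * hermite_fun1 (Suc N) x)" for x
  have sq: "sqrt (2 * real n) = 2 * sqrt (real n / 2)" for n
    by (rule real_sqrt_unique) (auto simp: power2_eq_square algebra_simps real_sqrt_mult_self)
  have dK: "(K has_real_derivative k x) (at x)" for x
    unfolding K_def k_def
  proof (induction N)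
    case 0
    show ?case
      using DERIV_mult[OF hermite_fun1_deriv[of 0 x] hermite_fun1_deriv[of 0 x]]
      unfolding sq by (simp add: algebra_simps)
  next
    case (Suc N)
    from DERIV_add[OF Suc DERIV_mult[OF hermite_fun1_deriv[of "Suc N" x] hermite_fun1_deriv[of "Suc N" x]]]
    show ?case unfolding sq by (simp add: algebra_simps)
  qed
  have int: "integrable lborel k"
    unfolding k_def by (intro integrable_mult_right hermite_fun1_prod_integrable)
  have "\<bar>K x\<bar> \<le> (LINT y|lborel. \<bar>k y\<bar>)"
  proof (rule integral_derivative_half_line[OF dK _ int])
    show "isCont k x" for x
      unfolding k_def by (intro continuous_intros hermite_fun1_isCont)
    show "(K \<longlongrightarrow> 0) at_top"
      unfolding K_def by (intro tendsto_null_sum hermite_fun1_prod_tendsto)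
  qed
  \<comment> \<open>The arithmetic-geometric mean inequality trades |h_N h_(N+1)| for half the sum
    of two squares, each of integral 1.\<close>
  also have "\<dots> \<le> (LINT y|lborel. sqrt (2 * real (Suc N)) *
      ((hermite_fun1 N y * hermite_fun1 N y + hermite_fun1 (Suc N) y * hermite_fun1 (Suc N) y) / 2))"
  proof (intro integral_mono integrable_abs int)
    show "\<bar>k y\<bar> \<le> sqrt (2 * real (Suc N)) *
      ((hermite_fun1 N y * hermite_fun1 N y + hermite_fun1 (Suc N) y * hermite_fun1 (Suc N) y) / 2)" for y
    proof -
      have "\<bar>a * b\<bar> \<le> (a * a + b * b) / 2" for a b :: real
        using sum_squares_bound[of "\<bar>a\<bar>" "\<bar>b\<bar>"] by (simp add: abs_mult power2_eq_square)
      then show ?thesis unfolding k_def abs_mult[of "- sqrt _"] by (intro mult_mono) auto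
    qed
  qed (intro integrable_mult_right Bochner_Integration.integrable_add integrable_divide hermite_fun1_prod_integrable)
  also have "\<dots> = sqrt (2 * real (Suc N))"
    by (simp add: hermite_fun1_prod_integrable hermite_fun1_orthonormal)
  finally show ?thesis
    by (simp add: K_def power2_eq_square)
qed

text \<open>Since the partial sums are nonnegative, lowering the weight in front of them can only
  decrease the left side. Applied to the difference of two sequences, this carries domination of
  partial sums over to decreasing weights.\<close>

lemma abel_weighted_sum_ge:
  fixes c w :: "nat \<Rightarrow> real"
  assumes "\<And>n. 0 \<le> (\<Sum>m\<le>n. c m)" "\<And>n. w (Suc n) \<le> w n"
  shows "w N * (\<Sum>m\<le>N. c m) \<le> (\<Sum>m\<le>N. w m * c m)"
proof (induction N)
  case (Suc N)
  have "w (Suc N) * (\<Sum>m\<le>N. c m) \<le> w N * (\<Sum>m\<le>N. c m)"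
    by (intro mult_right_mono assms)
  then show ?case using Suc by (simp add: algebra_simps)
qed simp

text \<open>The squares are compared with \<open>b\<close> through partial sums only, which is all
  that \<open>abel_weighted_sum_ge\<close> asks for. The terms \<open>w m * b m\<close> are then of
  order m^(-s-1/2), summable because s > 1/2.\<close>

lemma weighted_hermite_fun1_bound:
  assumes "s > 1 / 2"
  shows "\<exists>B. \<forall>x N. (\<Sum>m\<le>N. real (2 * m + 1) powr (- s) * (hermite_fun1 m x)\<^sup>2) \<le> B"
proof -
  define w where "w m = real (2 * m + 1) powr (- s)" for m :: nat
  \<comment> \<open>Decreasing, so its sum over m <= n is at least n + 1 times the last term, which
    is exactly the bound sqrt (2 (n+1)).\<close>
  define b where "b m = sqrt 2 / sqrt (real (Suc m))" for m
  have w: "w (Suc m) \<le> w m" "0 \<le> w m" for m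
    using assms by (auto simp: w_def intro!: powr_mono2')
  have B1: "(\<Sum>m\<le>n. (hermite_fun1 m x)\<^sup>2) \<le> (\<Sum>m\<le>n. b m)" for n x
  proof -
    have "(\<Sum>m\<le>n. (hermite_fun1 m x)\<^sup>2) \<le> sqrt (2 * real (Suc n))"
      by (rule sum_hermite_fun1_square_le)
    also have "\<dots> = (\<Sum>m\<le>n. sqrt 2 / sqrt (real (Suc n)))"
    proof -
      have "real (Suc n) / sqrt (real (Suc n)) = sqrt (real (Suc n))"
        by (rule real_div_sqrt) simp
      then have "sqrt 2 * sqrt (real (Suc n)) = real (Suc n) * (sqrt 2 / sqrt (real (Suc n)))"
        by (metis mult.commute times_divide_eq_left times_divide_eq_right)
      then show ?thesis by (simp only: real_sqrt_mult sum_constant card_atMost)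
    qed
    also have "\<dots> \<le> (\<Sum>m\<le>n. b m)"
      unfolding b_def by (intro sum_mono divide_left_mono) auto
    finally show ?thesis .
  qed
  have le: "w m * b m \<le> sqrt 2 * real (Suc m) powr (- (s + 1/2))" for m
  proof -
    have "w m \<le> real (Suc m) powr (- s)"
      unfolding w_def using assms by (intro powr_mono2') auto
    moreover have "b m = sqrt 2 * real (Suc m) powr (- (1/2))"
      unfolding b_def powr_minus powr_half_sqrt[OF of_nat_0_le_iff] divide_inverse[of "sqrt 2"] ..
    ultimately have "w m * b m \<le> real (Suc m) powr (- s) * (sqrt 2 * real (Suc m) powr (- (1/2)))"
      by (metis mult_right_mono real_sqrt_ge_zero zero_le_numeral mult_nonneg_nonneg powr_ge_zero)
    also have "\<dots> = sqrt 2 * (real (Suc m) powr (- s) * real (Suc m) powr (- (1/2)))"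
      by simp
    also have "real (Suc m) powr (- s) * real (Suc m) powr (- (1/2)) = real (Suc m) powr (- (s + 1/2))"
      by (subst powr_add[symmetric]) simp
    finally show ?thesis .
  qed
  have "summable (\<lambda>m. real m powr (- (s + 1/2)))"
    using assms by (subst summable_real_powr_iff) auto
  then have sum: "summable (\<lambda>m. sqrt 2 * real (Suc m) powr (- (s + 1/2)))"
    by (intro summable_mult) (subst summable_Suc_iff)
  have "(\<Sum>m\<le>N. w m * (hermite_fun1 m x)\<^sup>2) \<le> (\<Sum>m. sqrt 2 * real (Suc m) powr (- (s + 1/2)))" for x N
  proof -
    have "0 \<le> w N * (\<Sum>m\<le>N. b m - (hermite_fun1 m x)\<^sup>2)"
      using B1[where x = x and n = N] w by (simp add: sum_subtractf)
    also have "\<dots> \<le> (\<Sum>m\<le>N. w m * (b m - (hermite_fun1 m x)\<^sup>2))"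
      using B1[where x = x] w by (intro abel_weighted_sum_ge) (auto simp: sum_subtractf)
    finally have "(\<Sum>m\<le>N. w m * (hermite_fun1 m x)\<^sup>2) \<le> (\<Sum>m\<le>N. w m * b m)"
      by (simp add: right_diff_distrib sum_subtractf)
    also have "\<dots> \<le> (\<Sum>m\<le>N. sqrt 2 * real (Suc m) powr (- (s + 1/2)))"
      by (intro sum_mono le)
    also have "\<dots> \<le> (\<Sum>m. sqrt 2 * real (Suc m) powr (- (s + 1/2)))"
      by (intro sum_le_suminf sum) auto
    finally show ?thesis .
  qed
  then show ?thesis unfolding w_def by blast
qed

subsection \<open>Vanishing moments\<close>

lemma sum_power_fact_le_exp:
  fixes y :: real
  assumes "0 \<le> y"
  shows "(\<Sum>m<N. y ^ m / fact m) \<le> exp y"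
proof -
  have "(\<Sum>m<N. y ^ m /\<^sub>R fact m) \<le> (\<Sum>m. y ^ m /\<^sub>R fact m)"
    using assms by (intro sum_le_suminf summable_exp_generic) auto
  then show ?thesis by (simp add: exp_def divide_inverse mult.commute)
qed

lemma power_le_fact_exp:
  fixes y :: real
  assumes "0 \<le> y"
  shows "y ^ m \<le> fact m * exp y"
proof -
  have "y ^ m / fact m \<le> (\<Sum>k<Suc m. y ^ k / fact k)"
    using assms by (simp add: sum_nonneg)
  also have "\<dots> \<le> exp y" by (rule sum_power_fact_le_exp[OF assms])
  finally show ?thesis by (simp add: field_simps)
qed

lemma real_distribution_distr_density:
  fixes G X :: "'a \<Rightarrow> real"
  assumes [measurable]: "X \<in> borel_measurable M" and G: "integrable M G" "\<And>x. 0 \<le> G x" "integral\<^sup>L M G = 1"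
  shows "real_distribution (distr (density M G) borel X)"
proof -
  have [measurable]: "G \<in> borel_measurable M" using G by auto
  have "emeasure (density M G) (space M) = (\<integral>\<^sup>+x. ennreal (G x) \<partial>M)"
    by (subst emeasure_density) (auto intro!: nn_integral_cong)
  also have "\<dots> = 1" using G by (subst nn_integral_eq_integral) auto
  finally interpret prob_space "density M G"
    by (intro prob_spaceI) simp
  show ?thesis by (intro real_distribution_distr) simp
qed

lemma integral_distr_density:
  fixes h :: "real \<Rightarrow> 'b :: {banach, second_countable_topology}"
  assumes [measurable]: "X \<in> borel_measurable M" "h \<in> borel_measurable borel" "G \<in> borel_measurable M"
    and "\<And>x. 0 \<le> G x"
  shows "integral\<^sup>L (distr (density M G) borel X) h = (\<integral>x. G x *\<^sub>R h (X x) \<partial>M)"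
  using assms(4) by (subst integral_distr) (auto simp: integral_density)

text \<open>\<open>F\<close> is treated as a signed density that \<open>X\<close> pushes forward to
  the real line. Exponential moments permit integrating the power series of exp (i t X) term by
  term, so the image has zero Fourier transform. Uniqueness of characteristic functions speaks of
  probability measures, hence the split into positive and negative parts.\<close>

lemma vanishing_moments:
  fixes F X :: "'a \<Rightarrow> real"
  assumes [measurable]: "F \<in> borel_measurable M" "X \<in> borel_measurable M"
    and exp_int: "\<And>c. integrable M (\<lambda>x. F x * exp (c * \<bar>X x\<bar>))"
    and moments: "\<And>m. (LINT x|M. F x * X x ^ m) = 0"
    and [measurable]: "B \<in> sets borel"
  shows "(LINT x|M. F x * indicator B (X x)) = 0"
proof -
  have F_int: "integrable M F" using exp_int[of 0] by simp
  have mom_int: "integrable M (\<lambda>x. F x * X x ^ m)" for m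
  proof (rule Bochner_Integration.integrable_bound[OF integrable_mult_right[OF exp_int[of 1], of "fact m"]])
    show "AE x in M. norm (F x * X x ^ m) \<le> norm (fact m * (F x * exp (1 * \<bar>X x\<bar>)))"
      using power_le_fact_exp[of "\<bar>X _\<bar>" m]
      by (auto simp: abs_mult power_abs mult.left_commute[of "fact m"] intro!: mult_left_mono)
  qed simp
  have char0: "(CLINT x|M. F x *\<^sub>R iexp (t * X x)) = 0" for t
  proof -
    \<comment> \<open>Partial sums of the exponential series integrate to 0 by
      \<open>moments\<close>; |F| exp (|t| |X|) dominates them for every \<open>N\<close>.\<close>
    define s where "s N x = F x *\<^sub>R (\<Sum>m<N. (\<i> * complex_of_real (t * X x)) ^ m /\<^sub>R fact m)" for N x
    have [measurable]: "s N \<in> borel_measurable M" for N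
      unfolding s_def by measurable
    have "(\<lambda>N. CLINT x|M. s N x) \<longlonglongrightarrow> (CLINT x|M. F x *\<^sub>R iexp (t * X x))"
    proof (rule integral_dominated_convergence)
      show "integrable M (\<lambda>x. \<bar>F x * exp (\<bar>t\<bar> * \<bar>X x\<bar>)\<bar>)"
        by (intro integrable_abs exp_int)
      show "AE x in M. (\<lambda>N. s N x) \<longlonglongrightarrow> F x *\<^sub>R iexp (t * X x)"
        unfolding s_def
        using exp_converges by (intro AE_I2 tendsto_scaleR tendsto_const) (simp add: sums_def)
      show "AE x in M. norm (s N x) \<le> \<bar>F x * exp (\<bar>t\<bar> * \<bar>X x\<bar>)\<bar>" for N
      proof (rule AE_I2)
        fix x
        have "norm (\<Sum>m<N. (\<i> * complex_of_real (t * X x)) ^ m /\<^sub>R fact m) \<le> (\<Sum>m<N. (\<bar>t\<bar> * \<bar>X x\<bar>) ^ m / fact m)"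
          by (rule order_trans[OF norm_sum]) (simp add: norm_power norm_mult abs_mult divide_inverse mult.commute)
        also have "\<dots> \<le> exp (\<bar>t\<bar> * \<bar>X x\<bar>)"
          by (intro sum_power_fact_le_exp) simp
        finally show "norm (s N x) \<le> \<bar>F x * exp (\<bar>t\<bar> * \<bar>X x\<bar>)\<bar>"
          by (simp add: s_def abs_mult mult_left_mono)
      qed
    qed simp_all
    moreover have "(CLINT x|M. s N x) = 0" for N
    proof -
      have eq: "s N x = (\<Sum>m<N. ((\<i> * complex_of_real t) ^ m /\<^sub>R fact m) * complex_of_real (F x * X x ^ m))" for x
        unfolding s_def scaleR_sum_right
        by (intro sum.cong refl) (simp add: power_mult_distrib scaleR_conv_of_real)
      show ?thesis unfolding eq
        by (subst Bochner_Integration.integral_sum)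
           (auto simp: moments intro!: integrable_mult_right integrable_of_real mom_int simp del: of_real_mult of_real_power)
    qed
    ultimately show ?thesis by (simp add: LIMSEQ_const_iff)
  qed
  define P where "P x = max 0 (F x)" for x
  define Q where "Q x = max 0 (- F x)" for x
  have [measurable]: "P \<in> borel_measurable M" "Q \<in> borel_measurable M"
    unfolding P_def Q_def by measurable
  have PQ: "F x = P x - Q x" "0 \<le> P x" "0 \<le> Q x" for x by (auto simp: P_def Q_def)
  have int: "integrable M P" "integrable M Q"
    by (auto intro!: Bochner_Integration.integrable_bound[OF F_int] simp: P_def Q_def)
  \<comment> \<open>The moment with m = 0 gives both parts of \<open>F\<close> the same mass
    \<open>T\<close>, so dividing by it yields two probability densities; \<open>T = 0\<close> is
    treated separately.\<close>
  define T where "T = integral\<^sup>L M P"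
  have "integral\<^sup>L M F = 0" using moments[of 0] by simp
  then have TQ: "integral\<^sup>L M Q = T"
    using Bochner_Integration.integral_diff[OF int] by (simp add: PQ(1)[symmetric] T_def)
  have T0: "T \<ge> 0" using PQ by (simp add: T_def)
  show ?thesis
  proof (cases "T = 0")
    case True
    then have "AE x in M. P x = 0" "AE x in M. Q x = 0"
      using int PQ TQ integral_nonneg_eq_0_iff_AE[of M P] integral_nonneg_eq_0_iff_AE[of M Q] by (auto simp: T_def)
    then have "AE x in M. F x * indicator B (X x) = 0"
      by eventually_elim (simp add: PQ(1))
    then show ?thesis by (rule integral_eq_zero_AE)
  next
    case False
    with T0 have T: "T > 0" by simp
    define p where "p x = P x / T" for x
    define q where "q x = Q x / T" for x
    have pq_m [measurable]: "p \<in> borel_measurable M" "q \<in> borel_measurable M"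
      unfolding p_def q_def by measurable
    have pq: "integrable M p" "integrable M q" "0 \<le> p x" "0 \<le> q x" "integral\<^sup>L M p = 1" "integral\<^sup>L M q = 1"
      "F x = T * (p x - q x)" for x
      using T int PQ TQ by (auto simp: p_def[abs_def] q_def[abs_def] T_def diff_divide_distrib[symmetric])
    let ?P = "distr (density M p) borel X" and ?Q = "distr (density M q) borel X"
    \<comment> \<open>Kept general in the target space, as it serves both the complex exponential
      and the real indicator.\<close>
    have int_b: "integrable M (\<lambda>x. r x *\<^sub>R h (X x))" if "integrable M r" "h \<in> borel_measurable borel" "\<And>x. norm (h x) \<le> 1"
      for r and h :: "real \<Rightarrow> 'c :: {banach, second_countable_topology}"
      using that(1,2)
      by (intro Bochner_Integration.integrable_bound[OF that(1)])
         (auto intro!: mult_left_le that(3) measurable_compose[OF _ that(2)] borel_measurable_scaleR)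
    have "char ?P t = char ?Q t" for t
    proof -
      have "char ?P t - char ?Q t = (CLINT x|M. p x *\<^sub>R iexp (t * X x)) - (CLINT x|M. q x *\<^sub>R iexp (t * X x))"
        unfolding char_def using pq(3,4) by (simp add: integral_distr_density)
      also have "\<dots> = (CLINT x|M. p x *\<^sub>R iexp (t * X x) - q x *\<^sub>R iexp (t * X x))"
        using pq int_b[of _ "\<lambda>y. iexp (t * y)"] by (intro Bochner_Integration.integral_diff[symmetric]) auto
      also have "\<dots> = (CLINT x|M. (1 / T) *\<^sub>R (F x *\<^sub>R iexp (t * X x)))"
        using T by (simp add: pq(7) scaleR_diff_left)
      also have "\<dots> = (1 / T) *\<^sub>R (CLINT x|M. F x *\<^sub>R iexp (t * X x))"
        by (rule integral_scaleR_right)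
      also have "\<dots> = 0" unfolding char0 by simp
      finally show ?thesis by (simp only: right_minus_eq)
    qed
    then have "?P = ?Q"
      using pq by (intro Levy_uniqueness real_distribution_distr_density) auto
    moreover have "(LINT y|?P. indicator B y :: real) = (LINT x|M. p x *\<^sub>R indicator B (X x))"
      by (rule integral_distr_density) (use pq(3) in measurable)
    moreover have "(LINT y|?Q. indicator B y :: real) = (LINT x|M. q x *\<^sub>R indicator B (X x))"
      by (rule integral_distr_density) (use pq(4) in measurable)
    ultimately have "(LINT x|M. p x *\<^sub>R (indicator B (X x) :: real)) = (LINT x|M. q x *\<^sub>R indicator B (X x))"
      by simp
    then have "(LINT x|M. p x *\<^sub>R (indicator B (X x) :: real) - q x *\<^sub>R indicator B (X x)) = 0"
      using pq int_b[of _ "indicator B :: real \<Rightarrow> real"] by (subst Bochner_Integration.integral_diff) auto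
    then have "(LINT x|M. T * (p x *\<^sub>R (indicator B (X x) :: real) - q x *\<^sub>R indicator B (X x))) = 0"
      by simp
    then show ?thesis
      by (simp add: pq(7) algebra_simps)
  qed
qed

text \<open>Open boxes are stable under intersection and generate the Borel sets, so Dynkin's
  argument gives zero integral over every Borel set, in particular over the sets where
  \<open>g\<close> is positive or negative.\<close>

lemma integral_boxes_zero_imp_AE_zero:
  fixes g :: "real^'n::finite \<Rightarrow> real"
  assumes g: "integrable lborel g"
    and zero: "\<And>B. (\<And>i. B i \<in> sets borel) \<Longrightarrow> (LINT x|lborel. g x * (\<Prod>i\<in>UNIV. indicator (B i) (x $ i))) = 0"
  shows "AE x in lborel. g x = 0"
proof -
  let ?P = "\<lambda>A. (LINT x:A|lborel. g x) = 0"
  have set_int: "set_integrable lborel A g" if "A \<in> sets borel" for A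
    unfolding set_integrable_def using that g by (intro integrable_mult_indicator) auto
  have total: "integral\<^sup>L lborel g = 0" using zero[of "\<lambda>_. UNIV"] by simp
  have all: "?P A" if "A \<in> sets borel" for A
  proof -
    have "Int_stable (range (\<lambda>(a, b). box a b :: (real^'n) set))"
      by (auto simp: Int_stable_def box_Int_box)
    moreover have "range (\<lambda>(a, b). box a b :: (real^'n) set) \<subseteq> Pow UNIV" by simp
    moreover have "A \<in> sigma_sets UNIV (range (\<lambda>(a, b). box a b))"
      using that unfolding borel_eq_box by simp
    ultimately show ?thesis
    proof (induction rule: sigma_sets_induct_disjoint)
      case (basic A)
      then obtain a b where A: "A = box a b" by auto
      have "indicator A x = (\<Prod>i\<in>UNIV. indicator {a $ i <..< b $ i} (x $ i) :: real)" for x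
        by (auto simp: A mem_box_cart indicator_def prod_zero_iff)
      then show ?case
        using zero[of "\<lambda>i. {a $ i <..< b $ i}"] by (simp add: set_lebesgue_integral_def mult.commute)
    next
      case empty
      then show ?case by (simp add: set_lebesgue_integral_def)
    next
      case (compl A)
      then have A: "A \<in> sets borel" unfolding borel_eq_box by simp
      have "(LINT x:UNIV|lborel. g x) = (LINT x:A|lborel. g x) + (LINT x:UNIV - A|lborel. g x)"
        using set_integral_Un[of A "UNIV - A" lborel g] set_int A by (simp add: Un_absorb1)
      then show ?case using compl total by (simp add: set_lebesgue_integral_def)
    next
      case (union A)
      then have A: "A i \<in> sets borel" for i unfolding borel_eq_box by auto
      have "(LINT x:(\<Union>i. A i)|lborel. g x) = (\<Sum>i. LINT x:A i|lborel. g x)"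
        using A union(1) by (intro lebesgue_integral_countable_add set_int)
          (auto simp: disjoint_family_on_def)
      then show ?case using union by simp
    qed
  qed
  have [measurable]: "g \<in> borel_measurable borel" using g by auto
  \<comment> \<open>Taking c = 1 excludes positive values and c = -1 negative ones.\<close>
  have half: "AE x in lborel. \<not> 0 < c * g x" for c :: real
  proof -
    have S: "{x. 0 < c * g x} \<in> sets borel" by measurable
    have "(LINT x|lborel. c * (indicator {x. 0 < c * g x} x * g x)) = 0"
      using all[OF S] by (simp add: set_lebesgue_integral_def)
    moreover have "integrable lborel (\<lambda>x. c * (indicator {x. 0 < c * g x} x * g x))"
      using set_int[OF S] by (simp add: set_integrable_def)
    ultimately have "AE x in lborel. c * (indicator {x. 0 < c * g x} x * g x) = 0"
      by (subst (asm) integral_nonneg_eq_0_iff_AE) (auto simp: indicator_def)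
    then show ?thesis by eventually_elim (auto simp: indicator_def split: if_splits)
  qed
  show ?thesis using half[of 1] half[of "-1"] by eventually_elim auto
qed

subsection \<open>Products over the coordinates\<close>

text \<open>\<open>lborel\<close> on \<open>real^'n\<close> is the image of a product measure
  indexed by basis vectors. The map from i to \<open>axis i 1\<close> is a bijection onto
  \<open>Basis\<close>, and reindexing along it turns Fubini for that product into a statement about
  coordinates.\<close>

lemma
  fixes f :: "'n::finite \<Rightarrow> real \<Rightarrow> real"
  assumes f: "\<And>i. integrable lborel (f i)"
  shows integrable_lborel_prod_coords: "integrable lborel (\<lambda>x::real^'n. \<Prod>i\<in>UNIV. f i (x $ i))"
    and integral_lborel_prod_coords: "(LINT x|lborel. (\<Prod>i\<in>UNIV. f i ((x::real^'n) $ i))) = (\<Prod>i\<in>UNIV. integral\<^sup>L lborel (f i))"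
proof -
  interpret product_sigma_finite "\<lambda>_ :: real^'n. lborel :: real measure" ..
  define e :: "'n \<Rightarrow> real^'n" where "e i = axis i 1" for i
  have e: "inj e" "Basis = range e"
    by (auto simp: e_def Basis_vec_def inj_on_def axis_eq_axis)
  define g where "g b = f (inv e b)" for b
  have [measurable]: "f i \<in> borel_measurable borel" for i using f[of i] by auto
  have reidx: "(\<Prod>b\<in>Basis. h (inv e b) (\<phi> b)) = (\<Prod>i\<in>UNIV. h i (\<phi> (e i)))"
    for h :: "'n \<Rightarrow> 'c \<Rightarrow> real" and \<phi>
    unfolding e(2) by (simp add: prod.reindex[OF e(1)] inv_f_f[OF e(1)])
  have comp: "(\<Sum>b\<in>Basis. \<phi> b *\<^sub>R b :: real^'n) $ i = \<phi> (e i)" for \<phi> :: "real^'n \<Rightarrow> real" and i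
    using inner_sum_left_Basis[of "e i" \<phi>] e by (simp add: e_def inner_axis)
  have eq: "(\<Prod>i\<in>UNIV. f i ((\<Sum>b\<in>Basis. \<phi> b *\<^sub>R b :: real^'n) $ i)) = (\<Prod>b\<in>Basis. g b (\<phi> b))" for \<phi>
    unfolding g_def reidx comp ..
  have int: "integrable (\<Pi>\<^sub>M b\<in>(Basis :: (real^'n) set). lborel) (\<lambda>\<phi>. \<Prod>b\<in>Basis. g b (\<phi> b))"
    using f by (intro product_integrable_prod) (auto simp: g_def)
  have m1: "(\<lambda>\<phi>. \<Sum>b\<in>Basis. \<phi> b *\<^sub>R b :: real^'n) \<in> (\<Pi>\<^sub>M b\<in>Basis. lborel) \<rightarrow>\<^sub>M borel"
    by measurable
  have m2: "(\<lambda>x::real^'n. \<Prod>i\<in>UNIV. f i (x $ i)) \<in> borel_measurable borel"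
    by measurable
  show "integrable lborel (\<lambda>x::real^'n. \<Prod>i\<in>UNIV. f i (x $ i))"
    unfolding lborel_eq[where 'a = "real^'n"] integrable_distr_eq[OF m1 m2] eq by (rule int)
  have "(LINT x|lborel. (\<Prod>i\<in>UNIV. f i ((x::real^'n) $ i))) = (\<integral>\<phi>. (\<Prod>b\<in>Basis. g b (\<phi> b)) \<partial>(\<Pi>\<^sub>M b\<in>(Basis :: (real^'n) set). lborel))"
    unfolding lborel_eq[where 'a = "real^'n"] integral_distr[OF m1 m2] eq ..
  also have "\<dots> = (\<Prod>b\<in>Basis. integral\<^sup>L lborel (g b))"
    using f by (intro product_integral_prod) (auto simp: g_def)
  also have "\<dots> = (\<Prod>i\<in>UNIV. integral\<^sup>L lborel (f i))"
    using reidx[of "\<lambda>i _. integral\<^sup>L lborel (f i)"] by (simp add: g_def)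
  finally show "(LINT x|lborel. (\<Prod>i\<in>UNIV. f i ((x::real^'n) $ i))) = (\<Prod>i\<in>UNIV. integral\<^sup>L lborel (f i))" .
qed

text \<open>A class that contains every factor of the completeness proof: Hermite functions, also
  times a power, and exp (- t^2 / 2) times an indicator or exp (c |t|). The rate 1/8 is what is left
  of 1/4 once a power is absorbed; squaring restores 1/4.\<close>

definition gauss_bounded :: "(real \<Rightarrow> real) \<Rightarrow> bool" where
  "gauss_bounded u \<longleftrightarrow> u \<in> borel_measurable borel \<and> (\<exists>C\<ge>0. \<forall>t. \<bar>u t\<bar> \<le> C * exp (- t\<^sup>2 / 8))"

lemma gauss_boundedI:
  "u \<in> borel_measurable borel \<Longrightarrow> (\<And>t. \<bar>u t\<bar> \<le> C * exp (- t\<^sup>2 / 8)) \<Longrightarrow> gauss_bounded u"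
  unfolding gauss_bounded_def
proof (intro conjI exI[of _ C] allI)
  assume "\<And>t. \<bar>u t\<bar> \<le> C * exp (- t\<^sup>2 / 8)"
  from this[of 0] show "0 \<le> C" by simp
qed

lemma gauss_bounded_measurable: "gauss_bounded u \<Longrightarrow> u \<in> borel_measurable borel"
  by (simp add: gauss_bounded_def)

lemma gauss_bounded_square_integrable:
  assumes "gauss_bounded u"
  shows "integrable lborel (\<lambda>t. (u t)\<^sup>2)"
proof -
  obtain C where C: "C \<ge> 0" "\<And>t. \<bar>u t\<bar> \<le> C * exp (- t\<^sup>2 / 8)" using assms by (auto simp: gauss_bounded_def)
  have "\<bar>(u t)\<^sup>2\<bar> \<le> C\<^sup>2 * exp (- t\<^sup>2 / 4)" for t
  proof -
    have "\<bar>u t\<bar>\<^sup>2 \<le> (C * exp (- t\<^sup>2 / 8))\<^sup>2" by (intro power_mono C) auto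
    then show ?thesis by (simp add: power_mult_distrib exp_double[symmetric])
  qed
  then show ?thesis
    using gauss_bounded_measurable[OF assms] by (intro gauss_dominated_integrable[of _ "C\<^sup>2"]) auto
qed

lemma gauss_bounded_hermite_fun1: "gauss_bounded (hermite_fun1 n)"
proof -
  obtain C where C: "C \<ge> 0" "\<And>t. \<bar>hermite_fun1 n t\<bar> \<le> C * exp (- t\<^sup>2 / 4)" using hermite_fun1_decay by blast
  show ?thesis
  proof (rule gauss_boundedI[of _ C])
    show "\<bar>hermite_fun1 n t\<bar> \<le> C * exp (- t\<^sup>2 / 8)" for t
      using C(1) by (intro order_trans[OF C(2)] mult_left_mono) auto
  qed simp
qed

lemma gauss_bounded_exp: "gauss_bounded (\<lambda>t. exp (- t\<^sup>2 / 2) * exp (c * \<bar>t\<bar>))"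
proof (rule gauss_boundedI)
  fix t :: real
  have "c * \<bar>t\<bar> \<le> c\<^sup>2 + t\<^sup>2 / 4"
    using sum_squares_bound[of c "\<bar>t\<bar> / 2"] by (simp add: power_divide)
  then have "- t\<^sup>2 / 2 + c * \<bar>t\<bar> \<le> c\<^sup>2 + - t\<^sup>2 / 8"
    using zero_le_power2[of t] by linarith
  then show "\<bar>exp (- t\<^sup>2 / 2) * exp (c * \<bar>t\<bar>)\<bar> \<le> exp (c\<^sup>2) * exp (- t\<^sup>2 / 8)"
    by (simp add: exp_add[symmetric])
qed simp

lemma gauss_bounded_indicator: "B \<in> sets borel \<Longrightarrow> gauss_bounded (\<lambda>t. exp (- t\<^sup>2 / 2) * indicator B t)"
  by (rule gauss_boundedI[of _ 1]) (auto simp: indicator_def)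

lemma gauss_bounded_power_mult:
  "gauss_bounded (\<lambda>t. t ^ m * hermite_fun1 n t)"
proof -
  obtain C where C: "C \<ge> 0" "\<And>t. \<bar>hermite_fun1 n t\<bar> \<le> C * exp (- t\<^sup>2 / 4)" using hermite_fun1_decay by blast
  show ?thesis
  proof (rule gauss_boundedI)
    fix t :: real
    have "\<bar>t\<bar> \<le> 2 + t\<^sup>2 / 8"
      using sum_squares_bound[of 1 "\<bar>t\<bar> / 4"] by (simp add: power_divide)
    have "\<bar>t ^ m\<bar> \<le> fact m * exp \<bar>t\<bar>"
      using power_le_fact_exp[of "\<bar>t\<bar>" m] by (simp add: power_abs)
    also have "\<dots> \<le> fact m * exp (2 + t\<^sup>2 / 8)"
      using \<open>\<bar>t\<bar> \<le> 2 + t\<^sup>2 / 8\<close> by (intro mult_left_mono) auto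
    finally have "\<bar>t ^ m * hermite_fun1 n t\<bar> \<le> (fact m * exp (2 + t\<^sup>2 / 8)) * (C * exp (- t\<^sup>2 / 4))"
      unfolding abs_mult by (intro mult_mono C) auto
    also have "\<dots> = (fact m * C * exp 2) * (exp (t\<^sup>2 / 8) * exp (- t\<^sup>2 / 4))"
      by (simp add: exp_add)
    also have "exp (t\<^sup>2 / 8) * exp (- t\<^sup>2 / 4) = exp (- t\<^sup>2 / 8)"
      by (simp add: exp_add[symmetric])
    finally show "\<bar>t ^ m * hermite_fun1 n t\<bar> \<le> (fact m * C * exp 2) * exp (- t\<^sup>2 / 8)" .
  qed simp
qed

lemma gauss_bounded_prod_measurable:
  assumes "\<And>i. gauss_bounded (u i)"
  shows "(\<lambda>x::real^'n::finite. \<Prod>i\<in>UNIV. u i (x $ i)) \<in> borel_measurable borel"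
proof -
  have [measurable]: "u i \<in> borel_measurable borel" for i using assms by (rule gauss_bounded_measurable)
  show ?thesis by measurable
qed

lemma product_integrable_of_square:
  fixes f g :: "'a \<Rightarrow> real"
  assumes [measurable]: "f \<in> borel_measurable M" "g \<in> borel_measurable M"
    and "integrable M (\<lambda>x. (f x)\<^sup>2)" "integrable M (\<lambda>x. (g x)\<^sup>2)"
  shows "integrable M (\<lambda>x. f x * g x)"
proof (rule Bochner_Integration.integrable_bound[OF Bochner_Integration.integrable_add[OF assms(3,4)]])
  have "\<bar>a * b\<bar> \<le> a\<^sup>2 + b\<^sup>2" for a b :: real
  proof -
    have "2 * (\<bar>a\<bar> * \<bar>b\<bar>) \<le> a\<^sup>2 + b\<^sup>2" "0 \<le> \<bar>a\<bar> * \<bar>b\<bar>"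
      using sum_squares_bound[of "\<bar>a\<bar>" "\<bar>b\<bar>"] by simp_all
    then show ?thesis unfolding abs_mult by linarith
  qed
  then show "AE x in M. norm (f x * g x) \<le> norm ((f x)\<^sup>2 + (g x)\<^sup>2)" by simp
qed simp

lemma gauss_bounded_prod_square_integrable:
  assumes "\<And>i. gauss_bounded (u i)"
  shows "integrable lborel (\<lambda>x::real^'n::finite. (\<Prod>i\<in>UNIV. u i (x $ i))\<^sup>2)"
  unfolding prod_power_distrib
  by (rule integrable_lborel_prod_coords[of "\<lambda>i t. (u i t)\<^sup>2"]) (rule gauss_bounded_square_integrable[OF assms])

subsection \<open>Completeness of the Hermite functions\<close>

text \<open>Induction over the set of coordinates whose Hermite factor has already been exchanged.
  All factors but the current one go into \<open>R\<close>, so each exchange is a one-variable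
  moment problem for the map from x to \<open>x $ i\<close>.\<close>

lemma hermite_complete_lborel:
  fixes f :: "real^'n::finite \<Rightarrow> real"
  assumes f [measurable]: "f \<in> borel_measurable borel" and sq: "integrable lborel (\<lambda>x. (f x)\<^sup>2)"
    and zero: "\<And>n. (LINT x|lborel. f x * hermite_fun n x) = 0"
  shows "AE x in lborel. f x = 0"
proof -
  have int: "integrable lborel (\<lambda>x. f x * (\<Prod>i\<in>UNIV. u i (x $ i)))" if "\<And>i. gauss_bounded (u i)" for u
    using gauss_bounded_prod_measurable[OF that] gauss_bounded_prod_square_integrable[OF that] sq
    by (intro product_integrable_of_square) auto
  let ?ind = "\<lambda>u i. \<exists>B\<in>sets borel. u i = (\<lambda>t. exp (- t\<^sup>2 / 2) * indicator B t)"
  let ?her = "\<lambda>u i. \<exists>n. u i = hermite_fun1 n"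
  have claim: "(LINT x|lborel. f x * (\<Prod>i\<in>UNIV. u i (x $ i))) = 0"
    if "\<And>i. i \<in> S \<Longrightarrow> ?ind u i" "\<And>i. i \<notin> S \<Longrightarrow> ?her u i" for S :: "'n set" and u
    using finite[of S] that
  proof (induction S arbitrary: u rule: finite_induct)
    case empty
    then obtain n where "\<And>i. u i = hermite_fun1 (n i)" by (metis empty_iff)
    then show ?case using zero[of n] by (simp add: hermite_fun_def)
  next
    case (insert i S)
    have gb: "gauss_bounded (u j)" for j
    proof (cases "j \<in> insert i S")
      case True
      then obtain B where "B \<in> sets borel" "u j = (\<lambda>t. exp (- t\<^sup>2 / 2) * indicator B t)"
        using insert.prems(1) by blast
      then show ?thesis by (simp only: gauss_bounded_indicator)
    next
      case False
      then obtain n where "u j = hermite_fun1 n"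
        using insert.prems(2) by blast
      then show ?thesis by (simp only: gauss_bounded_hermite_fun1)
    qed
    define R where "R x = f x * (\<Prod>j\<in>UNIV - {i}. u j (x $ j))" for x
    have [measurable]: "u j \<in> borel_measurable borel" for j using gb by (rule gauss_bounded_measurable)
    have [measurable]: "R \<in> borel_measurable borel" unfolding R_def by measurable
    have R: "f x * (\<Prod>j\<in>UNIV. (u(i := v)) j (x $ j)) = R x * v (x $ i)" for v x
      unfolding R_def by (subst prod.remove[of UNIV i]) (auto intro!: prod.cong)
    have Rint: "integrable lborel (\<lambda>x. R x * v (x $ i))" if "gauss_bounded v" for v
      using int[of "u(i := v)"] gb that unfolding R by simp
    have R_her: "(LINT x|lborel. R x * hermite_fun1 n (x $ i)) = 0" for n
      unfolding R[symmetric]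
      using insert.prems insert.hyps by (intro insert.IH) auto
    \<comment> \<open>Multiplication by \<open>x $ i\<close> only combines neighbouring Hermite
      functions, so induction on m with n free gives all moments without expanding
      monomials.\<close>
    have R_pow: "(LINT x|lborel. R x * ((x $ i) ^ m * hermite_fun1 n (x $ i))) = 0" for m n
    proof (induction m arbitrary: n)
      case (Suc m)
      have "R x * ((x $ i) ^ Suc m * hermite_fun1 n (x $ i))
        = sqrt (real n / 2) * (R x * ((x $ i) ^ m * hermite_fun1 (n - 1) (x $ i)))
          + sqrt (real (Suc n) / 2) * (R x * ((x $ i) ^ m * hermite_fun1 (Suc n) (x $ i)))" for x
      proof -
        have "R x * ((x $ i) ^ Suc m * hermite_fun1 n (x $ i)) = R x * (x $ i) ^ m * (x $ i * hermite_fun1 n (x $ i))"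
          by simp
        then show ?thesis unfolding hermite_fun1_mult by (simp add: algebra_simps)
      qed
      then show ?case
        using Suc Rint[OF gauss_bounded_power_mult] by simp
    qed (simp add: R_her)
    obtain B where B: "B \<in> sets borel" "u i = (\<lambda>t. exp (- t\<^sup>2 / 2) * indicator B t)"
      using insert.prems(1)[of i] by auto
    have "(LINT x|lborel. (R x * exp (- (x $ i)\<^sup>2 / 2)) * indicator B (x $ i)) = 0"
    proof (rule vanishing_moments)
      show "integrable lborel (\<lambda>x. R x * exp (- (x $ i)\<^sup>2 / 2) * exp (c * \<bar>x $ i\<bar>))" for c
        using Rint[OF gauss_bounded_exp[of c]] by (simp add: mult.assoc)
      show "(LINT x|lborel. R x * exp (- (x $ i)\<^sup>2 / 2) * (x $ i) ^ m) = 0" for m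
      proof -
        \<comment> \<open>The Gaussian is h_0 up to its normalising constant, so the moments of
          \<open>R\<close> times the Gaussian are the case n = 0 of \<open>R_pow\<close>.\<close>
        have "exp (- t\<^sup>2 / 2) = sqrt (sqrt pi) * hermite_fun1 0 t" for t
          by (simp add: hermite_fun1_def)
        then have "R x * exp (- (x $ i)\<^sup>2 / 2) * (x $ i) ^ m = sqrt (sqrt pi) * (R x * ((x $ i) ^ m * hermite_fun1 0 (x $ i)))" for x
          by (simp only: ac_simps)
        then have "(LINT x|lborel. R x * exp (- (x $ i)\<^sup>2 / 2) * (x $ i) ^ m)
            = (LINT x|lborel. sqrt (sqrt pi) * (R x * ((x $ i) ^ m * hermite_fun1 0 (x $ i))))"
          by (simp only:)
        also have "\<dots> = 0" using R_pow[of m 0] by simp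
        finally show ?thesis .
      qed
    qed (use B in measurable)
    moreover have "f x * (\<Prod>j\<in>UNIV. u j (x $ j)) = R x * u i (x $ i)" for x
      unfolding R_def by (subst prod.remove[of UNIV i]) auto
    ultimately show ?case
      using B(2) by (simp add: mult.assoc)
  qed
  \<comment> \<open>The Gaussian makes the square integrable \<open>f\<close> integrable and
    vanishes nowhere, so \<open>g\<close> and \<open>f\<close> have the same zeros.\<close>
  define g where "g x = f x * (\<Prod>i\<in>UNIV. exp (- (x $ i)\<^sup>2 / 2))" for x
  have "AE x in lborel. g x = 0"
  proof (rule integral_boxes_zero_imp_AE_zero)
    show "integrable lborel g"
      unfolding g_def using int[of "\<lambda>_ t. exp (- t\<^sup>2 / 2)"] gauss_bounded_exp[of 0] by simp
    show "(LINT x|lborel. g x * (\<Prod>i\<in>UNIV. indicator (B i) (x $ i))) = 0"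
      if "\<And>i. B i \<in> sets borel" for B
      using claim[of UNIV "\<lambda>i t. exp (- t\<^sup>2 / 2) * indicator (B i) t"] that
      by (simp add: g_def prod.distrib mult.assoc) blast
  qed
  then show ?thesis
    by eventually_elim (simp add: g_def prod_zero_iff)
qed

text \<open>Elements of \<open>L2_space\<close> are Lebesgue measurable, while the argument above
  runs on \<open>lborel\<close>. Passing to a Borel representative changes neither square
  integrability nor the coefficients.\<close>

lemma hermite_complete:
  fixes f :: "real^'n::finite \<Rightarrow> real"
  assumes f: "f \<in> L2_space" and zero: "\<And>n. L2_inner f (hermite_fun n) = 0"
  shows "ae_eq f (\<lambda>_. 0)"
proof -
  have fm: "f \<in> borel_measurable lebesgue" using f by (simp add: L2_space_def)
  obtain f' where f' [measurable]: "f' \<in> borel_measurable borel" and "AE x in lborel. f x = f' x"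
    using completion_ex_borel_measurable_real[OF fm] by auto
  then have ae: "AE x in lebesgue. f x = f' x" by (intro AE_completion)
  have f'l: "f' \<in> borel_measurable lebesgue" by (simp add: measurable_completion)
  have "AE x in lborel. f' x = 0"
  proof (rule hermite_complete_lborel)
    have "integrable lebesgue (\<lambda>x. (f' x)\<^sup>2)"
      using f ae f'l by (subst integrable_cong_AE[of _ _ "\<lambda>x. (f x)\<^sup>2"]) (auto simp: L2_space_def)
    then show "integrable lborel (\<lambda>x. (f' x)\<^sup>2)" by (subst (asm) integrable_completion) auto
    fix n :: "'n \<Rightarrow> nat"
    have h [measurable]: "hermite_fun n \<in> borel_measurable borel"
      unfolding hermite_fun_def by measurable
    have "(LINT x|lborel. f' x * hermite_fun n x) = (LINT x|lebesgue. f' x * hermite_fun n x)"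
      by (rule integral_completion[symmetric]) simp
    also have "\<dots> = L2_inner f (hermite_fun n)"
      unfolding L2_inner_def using ae fm f'l measurable_completion[of "hermite_fun n" lborel borel]
      by (intro integral_cong_AE) auto
    finally show "(LINT x|lborel. f' x * hermite_fun n x) = 0" using zero by simp
  qed simp
  then have "AE x in lebesgue. f' x = 0" by (rule AE_completion)
  with ae show ?thesis unfolding ae_eq_def by eventually_elim simp
qed

section \<open>Orthonormality and integrability in several variables\<close>

lemma measurable_hermite_fun [measurable]: "hermite_fun n \<in> borel_measurable borel"
  unfolding hermite_fun_def by measurable

lemma hermite_fun_in_L2: "hermite_fun n \<in> L2_space"
proof -
  have "integrable lborel (\<lambda>x::real^'a. (hermite_fun n x)\<^sup>2)"
    unfolding hermite_fun_def by (intro gauss_bounded_prod_square_integrable gauss_bounded_hermite_fun1)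
  then show ?thesis
    by (simp add: L2_space_def measurable_completion integrable_completion)
qed

lemma hermite_fun_orthonormal: "L2_inner (hermite_fun m) (hermite_fun n) = (if m = n then 1 else 0)"
proof -
  have "L2_inner (hermite_fun m) (hermite_fun n) = (LINT x|lborel. hermite_fun m x * hermite_fun n x)"
    unfolding L2_inner_def by (rule integral_completion) simp
  also have "\<dots> = (\<Prod>i\<in>UNIV. (LINT t|lborel. hermite_fun1 (m i) t * hermite_fun1 (n i) t))"
    unfolding hermite_fun_def prod.distrib[symmetric]
    by (intro integral_lborel_prod_coords[of "\<lambda>i t. hermite_fun1 (m i) t * hermite_fun1 (n i) t"] hermite_fun1_prod_integrable)
  also have "\<dots> = (if m = n then 1 else 0)"
    by (auto simp: hermite_fun1_orthonormal fun_eq_iff)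
  finally show ?thesis .
qed

lemma hermite_fun_integrable: "integrable lebesgue (hermite_fun n)"
proof -
  have "integrable lborel (hermite_fun1 m)" for m
  proof -
    obtain C where "\<And>t. \<bar>hermite_fun1 m t\<bar> \<le> C * exp (- t\<^sup>2 / 4)" using hermite_fun1_decay by blast
    then show ?thesis by (intro gauss_dominated_integrable[of _ C]) auto
  qed
  then have "integrable lborel (hermite_fun n)"
    unfolding hermite_fun_def by (intro integrable_lborel_prod_coords)
  then show ?thesis by (simp add: integrable_completion)
qed

subsection \<open>Pointwise bounds for Hermite functions and their derivatives\<close>

text \<open>The eigenvalue of the harmonic oscillator - Laplacian + |x|^2 on h_n; the S_p norm is
  the L^2 norm after applying the p-th power of this operator.\<close>

definition hermite_weight :: "('n::finite \<Rightarrow> nat) \<Rightarrow> real" where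
  "hermite_weight n = real (2 * order_of n + CARD('n))"

lemma coord_le_order_of: "n i \<le> order_of n"
  unfolding order_of_def by (rule member_le_sum) auto

lemma hermite_weight_ge: "real (2 * n i + 1) \<le> hermite_weight (n :: 'n::finite \<Rightarrow> nat)"
proof -
  have "1 \<le> CARD('n)" using zero_less_card_finite[where 'a = 'n] by linarith
  then show ?thesis
    using coord_le_order_of[of n i] unfolding hermite_weight_def of_nat_le_iff by linarith
qed

lemma hermite_weight_ge1: "1 \<le> hermite_weight n"
  by (rule order_trans[OF _ hermite_weight_ge]) simp

lemma hermite_weight_pos: "0 < hermite_weight n"
  using hermite_weight_ge1[of n] by linarith

lemma hermite_fun_square_sum_bound:
  assumes q: "q > real CARD('n::finite) / 4"
  shows "\<exists>B. \<forall>(x::real^'n) A. finite A \<longrightarrow> (\<Sum>n\<in>A. hermite_weight n powr (- 2 * q) * (hermite_fun n x)\<^sup>2) \<le> B"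
proof -
  define d where "d = real CARD('n)"
  have d: "d > 0" by (simp add: d_def)
  \<comment> \<open>The exponent 2 q is shared equally by the d coordinates; s > 1/2 says exactly q
    > d/4.\<close>
  define s where "s = 2 * q / d"
  have s: "s > 1 / 2" using q d by (simp add: s_def d_def field_simps)
  obtain B where B: "\<And>x N. (\<Sum>m\<le>N. real (2 * m + 1) powr (- s) * (hermite_fun1 m x)\<^sup>2) \<le> B"
    using weighted_hermite_fun1_bound[OF s] by blast
  have w: "hermite_weight n powr (- 2 * q) \<le> (\<Prod>i\<in>UNIV. real (2 * n i + 1) powr (- s))" for n :: "'n \<Rightarrow> nat"
  proof -
    have "hermite_weight n powr (- 2 * q) = hermite_weight n powr (- s * d)"
      using d by (simp add: s_def)
    also have "\<dots> = (hermite_weight n powr (- s)) ^ CARD('n)"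
      using hermite_weight_pos[of n] by (simp add: powr_power d_def mult.commute)
    also have "\<dots> = (\<Prod>i\<in>(UNIV :: 'n set). hermite_weight n powr (- s))" by simp
    also have "\<dots> \<le> (\<Prod>i\<in>UNIV. real (2 * n i + 1) powr (- s))"
      using s by (intro prod_mono conjI powr_mono2' hermite_weight_ge) auto
    finally show ?thesis .
  qed
  have "(\<Sum>n\<in>A. hermite_weight n powr (- 2 * q) * (hermite_fun n x)\<^sup>2) \<le> B ^ CARD('n)"
    if A: "finite A" for x :: "real^'n" and A
  proof -
    define N where "N = (\<Sum>n\<in>A. order_of n)"
    have sub: "A \<subseteq> PiE UNIV (\<lambda>_. {..N})"
    proof
      fix n assume "n \<in> A"
      then have "order_of n \<le> N" unfolding N_def using A by (intro member_le_sum) auto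
      then show "n \<in> PiE UNIV (\<lambda>_. {..N})" using coord_le_order_of[of n] by (auto intro: order_trans)
    qed
    have "(\<Sum>n\<in>A. hermite_weight n powr (- 2 * q) * (hermite_fun n x)\<^sup>2)
        \<le> (\<Sum>n\<in>A. \<Prod>i\<in>UNIV. real (2 * n i + 1) powr (- s) * (hermite_fun1 (n i) (x $ i))\<^sup>2)"
      unfolding prod.distrib hermite_fun_def prod_power_distrib
      by (intro sum_mono mult_right_mono w prod_nonneg) auto
    also have "\<dots> \<le> (\<Sum>n\<in>PiE UNIV (\<lambda>_. {..N}). \<Prod>i\<in>UNIV. real (2 * n i + 1) powr (- s) * (hermite_fun1 (n i) (x $ i))\<^sup>2)"
      using sub by (intro sum_mono2 finite_PiE prod_nonneg) auto
    also have "\<dots> = (\<Prod>i\<in>UNIV. \<Sum>m\<le>N. real (2 * m + 1) powr (- s) * (hermite_fun1 m (x $ i))\<^sup>2)"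
      by (rule prod_sum_PiE[symmetric]) auto
    also have "\<dots> \<le> (\<Prod>i\<in>(UNIV :: 'n set). B)"
      by (intro prod_mono conjI B sum_nonneg) auto
    finally show ?thesis by simp
  qed
  then show ?thesis by blast
qed

text \<open>Written as a sum with a negated coefficient, to match the shape in
  \<open>partial_derivs_lincomb\<close>.\<close>

lemma partial_deriv_hermite_fun:
  fixes n :: "'n::finite \<Rightarrow> nat"
  shows "partial_differentiable i (hermite_fun n)"
    and "partial_deriv i (hermite_fun n) = (\<lambda>x. sqrt (real (n i) / 2) * hermite_fun (n(i := n i - 1)) x
       + (- sqrt (real (Suc (n i)) / 2)) * hermite_fun (n(i := Suc (n i))) x)"
proof -
  define R where "R x = (\<Prod>j\<in>UNIV - {i}. hermite_fun1 (n j) (x $ j))" for x :: "real^'n"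
  have split: "hermite_fun (n(i := m)) x = hermite_fun1 m (x $ i) * R x" for m x
    unfolding hermite_fun_def R_def by (subst prod.remove[of UNIV i]) (auto intro!: prod.cong)
  have R: "R (x + t *\<^sub>R axis i 1) = R x" for x t
    unfolding R_def by (intro prod.cong) (auto simp: axis_def)
  have n: "hermite_fun n x = hermite_fun1 (n i) (x $ i) * R x" for x
    using split[of "n i" x] by simp
  have "((\<lambda>t. hermite_fun n (x + t *\<^sub>R axis i 1)) has_real_derivative
     (sqrt (real (n i) / 2) * hermite_fun (n(i := n i - 1)) x
       + (- sqrt (real (Suc (n i)) / 2)) * hermite_fun (n(i := Suc (n i))) x)) (at 0)" for x
  proof -
    have "(hermite_fun1 (n i) has_real_derivative
     (sqrt (real (n i) / 2) * hermite_fun1 (n i - 1) (x $ i) - sqrt (real (Suc (n i)) / 2) * hermite_fun1 (Suc (n i)) (x $ i))) (at (0 + x $ i))"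
      using hermite_fun1_deriv[of "n i" "x $ i"] by simp
    then have "((\<lambda>t. hermite_fun1 (n i) (t + x $ i)) has_real_derivative
     (sqrt (real (n i) / 2) * hermite_fun1 (n i - 1) (x $ i) - sqrt (real (Suc (n i)) / 2) * hermite_fun1 (Suc (n i)) (x $ i))) (at 0)"
      unfolding DERIV_shift .
    from DERIV_cmult_right[OF this, of "R x"] show ?thesis
      unfolding n R split by (simp add: axis_def algebra_simps)
  qed
  note this[THEN partial_derivI(1)] this[THEN partial_derivI(2)]
  then show "partial_differentiable i (hermite_fun n)"
    "partial_deriv i (hermite_fun n) = (\<lambda>x. sqrt (real (n i) / 2) * hermite_fun (n(i := n i - 1)) x
       + (- sqrt (real (Suc (n i)) / 2)) * hermite_fun (n(i := Suc (n i))) x)" .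
qed

lemma continuous_hermite_fun: "continuous_on UNIV (hermite_fun n)"
  unfolding hermite_fun_def
  by (intro continuous_on_prod continuous_on_compose2[OF continuous_hermite_fun1[of UNIV]] continuous_intros) auto

lemma Ck_fun_hermite_fun: "Ck_fun k (hermite_fun n)"
proof (induction k arbitrary: n)
  case (Suc k)
  then show ?case
    using continuous_hermite_fun[of n] partial_deriv_hermite_fun(1)[of _ n]
    unfolding Ck_fun.simps partial_deriv_hermite_fun(2)[of _ n]
    by (intro conjI allI Ck_fun_lincomb) auto
qed (simp add: continuous_hermite_fun)

text \<open>Taking out the derivative that is applied first leaves the others acting on Hermite
  functions again; inductions over lists therefore run from the right end.\<close>

lemma partial_derivs_hermite_fun_snoc:
  "partial_derivs (L @ [i]) (hermite_fun n) = (\<lambda>x. sqrt (real (n i) / 2) * partial_derivs L (hermite_fun (n(i := n i - 1))) x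
       + (- sqrt (real (Suc (n i)) / 2)) * partial_derivs L (hermite_fun (n(i := Suc (n i)))) x)"
  by (simp only: foldr_append foldr.simps o_apply id_apply partial_deriv_hermite_fun(2)
      partial_derivs_lincomb[OF Ck_fun_hermite_fun Ck_fun_hermite_fun order_refl])

lemma hermite_fun_tendsto_0: "(hermite_fun n \<longlongrightarrow> 0) (at_infinity :: (real^'n::finite) filter)"
proof -
  obtain C where C: "\<And>i. C i \<ge> 0" "\<And>i t. \<bar>hermite_fun1 (n i) t\<bar> \<le> C i * exp (- t\<^sup>2 / 4)"
    using hermite_fun1_decay[of "n _"] by metis
  have "\<bar>hermite_fun n x\<bar> \<le> (\<Prod>i\<in>UNIV. C i) * exp (- (norm x)\<^sup>2 / 4)" for x
  proof -
    have "\<bar>hermite_fun n x\<bar> \<le> (\<Prod>i\<in>UNIV. C i * exp (- (x $ i)\<^sup>2 / 4))"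
      unfolding hermite_fun_def abs_prod by (intro prod_mono conjI C) auto
    also have "\<dots> = (\<Prod>i\<in>UNIV. C i) * exp (\<Sum>i\<in>UNIV. - (x $ i)\<^sup>2 / 4)"
      by (simp only: prod.distrib exp_sum finite)
    also have "(\<Sum>i\<in>UNIV. - (x $ i)\<^sup>2 / 4) = - (\<Sum>i\<in>UNIV. (x $ i)\<^sup>2) / 4"
      by (simp add: sum_negf sum_divide_distrib)
    also have "(\<Sum>i\<in>UNIV. (x $ i)\<^sup>2) = (norm x)\<^sup>2"
      by (simp add: norm_vec_def L2_set_def sum_nonneg)
    finally show ?thesis .
  qed
  moreover have "((\<lambda>x::real^'n. (\<Prod>i\<in>UNIV. C i) * exp (- (norm x)\<^sup>2 / 4)) \<longlongrightarrow> 0) at_infinity"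
  proof (rule filterlim_compose[OF _ filterlim_norm_at_top])
    have "((\<lambda>r::real. K * exp (- r\<^sup>2 / 4)) \<longlongrightarrow> 0) at_top" for K :: real by real_asymp
    then show "((\<lambda>r::real. (\<Prod>i\<in>UNIV. C i) * exp (- r\<^sup>2 / 4)) \<longlongrightarrow> 0) at_top" .
  qed
  ultimately show ?thesis
    by (intro Lim_null_comparison[of "hermite_fun n" "\<lambda>x. (\<Prod>i\<in>UNIV. C i) * exp (- (norm x)\<^sup>2 / 4)"] always_eventually) auto
qed

lemma hermite_fun_in_C0k: "hermite_fun n \<in> C0k_space k"
proof -
  have "(partial_derivs L (hermite_fun n) \<longlongrightarrow> 0) at_infinity" for L
  proof (induction L arbitrary: n rule: rev_induct)
    case (snoc i L)
    show ?case
      unfolding partial_derivs_hermite_fun_snoc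
      by (rule tendsto_eq_rhs[OF tendsto_add[OF tendsto_mult_left[OF snoc] tendsto_mult_left[OF snoc]]]) simp
  qed (simp add: hermite_fun_tendsto_0)
  then show ?thesis by (simp add: C0k_space_iff Ck_fun_hermite_fun)
qed

lemma order_of_fun_upd: "order_of (n(i := m)) + n i = order_of n + m"
  unfolding order_of_def by (subst (1 2) sum.remove[of UNIV i]) (auto intro!: sum.cong)

lemma powr_weight_shift:
  fixes w a q :: real
  assumes "0 < w" "0 \<le> a" "a \<le> w"
  shows "w powr (- 2 * q) * a \<le> w powr (- 2 * (q - 1 / 2))"
proof -
  have "w powr (- 2 * q) * a \<le> w powr (- 2 * q) * w powr 1"
    using assms by (intro mult_left_mono) auto
  also have "\<dots> = w powr (- 2 * (q - 1 / 2))"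
    by (subst powr_add[symmetric]) (simp add: algebra_simps)
  finally show ?thesis .
qed

text \<open>\<open>q\<close> is generalised because every derivative taken out lowers it by 1/2: the
  squared coefficients have the size of n_i, which the weight absorbs. Shifting n_i is injective
  where it counts, so sums over neighbours are sums over other finite sets and the bound for the
  shorter list applies.\<close>

lemma hermite_derivs_square_sum_bound:
  fixes L :: "'n::finite list"
  assumes "q > real CARD('n) / 4 + real (length L) / 2"
  shows "\<exists>B. \<forall>(x::real^'n) A. finite A \<longrightarrow>
    (\<Sum>n\<in>A. hermite_weight n powr (- 2 * q) * (partial_derivs L (hermite_fun n) x)\<^sup>2) \<le> B"
  using assms
proof (induction L arbitrary: q rule: rev_induct)
  case Nil
  then show ?case using hermite_fun_square_sum_bound[of q] by simp
next
  case (snoc i L)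
  define r where "r = q - 1 / 2"
  have r: "r > real CARD('n) / 4 + real (length L) / 2" using snoc.prems by (simp add: r_def field_simps)
  then have r0: "r > 0" by (smt (verit) divide_nonneg_nonneg of_nat_0_le_iff)
  let ?G = "\<lambda>n x. partial_derivs L (hermite_fun n) x"
  let ?\<Phi> = "\<lambda>x n. hermite_weight n powr (- 2 * r) * (?G n x)\<^sup>2"
  obtain B where B: "\<And>x A. finite A \<Longrightarrow> (\<Sum>n\<in>A. ?\<Phi> x n) \<le> B"
    using snoc.IH[OF r] by blast
  define dn where "dn n = n(i := n i - 1)" for n :: "'n \<Rightarrow> nat"
  define up where "up n = n(i := Suc (n i))" for n :: "'n \<Rightarrow> nat"
  \<comment> \<open>The weight of \<open>up n\<close> is that of \<open>n\<close> plus 2, at most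
    three times it since weights are at least 1; hence the factor 3. At n_i = 0 the lower neighbour
    has coefficient 0 and is dropped, because \<open>dn\<close> is not injective there.\<close>
  have term_le: "hermite_weight n powr (- 2 * q) * (partial_derivs (L @ [i]) (hermite_fun n) x)\<^sup>2
      \<le> (if n i \<noteq> 0 then ?\<Phi> x (dn n) else 0) + 3 powr (2 * r) * ?\<Phi> x (up n)" for n x
  proof -
    let ?w = "hermite_weight n"
    have sq: "(a + b)\<^sup>2 \<le> 2 * a\<^sup>2 + 2 * b\<^sup>2" for a b :: real
      using sum_squares_bound[of a b] by (simp add: power2_sum)
    have "(partial_derivs (L @ [i]) (hermite_fun n) x)\<^sup>2
        \<le> 2 * (sqrt (real (n i) / 2) * ?G (dn n) x)\<^sup>2 + 2 * (- sqrt (real (Suc (n i)) / 2) * ?G (up n) x)\<^sup>2"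
      unfolding partial_derivs_hermite_fun_snoc dn_def up_def by (rule sq)
    also have "\<dots> = real (n i) * (?G (dn n) x)\<^sup>2 + real (Suc (n i)) * (?G (up n) x)\<^sup>2"
      by (simp add: power_mult_distrib)
    finally have "?w powr (- 2 * q) * (partial_derivs (L @ [i]) (hermite_fun n) x)\<^sup>2
        \<le> ?w powr (- 2 * q) * (real (n i) * (?G (dn n) x)\<^sup>2 + real (Suc (n i)) * (?G (up n) x)\<^sup>2)"
      by (intro mult_left_mono) auto
    also have "\<dots> = (?w powr (- 2 * q) * real (n i)) * (?G (dn n) x)\<^sup>2 + (?w powr (- 2 * q) * real (Suc (n i))) * (?G (up n) x)\<^sup>2"
      by (simp add: algebra_simps)
    also have "\<dots> \<le> (if n i \<noteq> 0 then ?\<Phi> x (dn n) else 0) + (3 powr (2 * r) * hermite_weight (up n) powr (- 2 * r)) * (?G (up n) x)\<^sup>2"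
    proof (intro add_mono mult_right_mono)
      show "(?w powr (- 2 * q) * real (n i)) * (?G (dn n) x)\<^sup>2 \<le> (if n i \<noteq> 0 then ?\<Phi> x (dn n) else 0)"
      proof (cases "n i = 0")
        case False
        have "?w powr (- 2 * q) * real (n i) \<le> ?w powr (- 2 * r)"
          unfolding r_def using hermite_weight_pos hermite_weight_ge[of n i] by (intro powr_weight_shift) auto
        also have "\<dots> \<le> hermite_weight (dn n) powr (- 2 * r)"
          using r0 hermite_weight_pos order_of_fun_upd[of n i "n i - 1"]
          by (intro powr_mono2') (auto simp: dn_def hermite_weight_def)
        finally show ?thesis using False by (auto intro: mult_right_mono)
      qed simp
      have "?w powr (- 2 * q) * real (Suc (n i)) \<le> ?w powr (- 2 * r)"
        unfolding r_def using hermite_weight_pos hermite_weight_ge[of n i] by (intro powr_weight_shift) auto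
      also have "\<dots> \<le> (hermite_weight (up n) / 3) powr (- 2 * r)"
      proof (rule powr_mono2')
        have "hermite_weight (up n) = ?w + 2"
          using order_of_fun_upd[of n i "Suc (n i)"] by (simp add: up_def hermite_weight_def)
        then show "hermite_weight (up n) / 3 \<le> ?w" using hermite_weight_ge1[of n] by simp
      qed (use r0 hermite_weight_pos in auto)
      also have "\<dots> = 3 powr (2 * r) * hermite_weight (up n) powr (- 2 * r)"
      proof -
        have "(hermite_weight (up n) / 3) powr (- 2 * r) = hermite_weight (up n) powr (- 2 * r) / 3 powr (- 2 * r)"
          by (rule powr_divide)
        also have "3 powr (- 2 * r) = 1 / 3 powr (2 * r)"
          using powr_minus_divide[of 3 "2 * r"] by (simp only: mult_minus_left)
        finally show ?thesis by (simp only: divide_divide_eq_right div_by_1 mult.commute)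
      qed
      finally show "?w powr (- 2 * q) * real (Suc (n i)) \<le> 3 powr (2 * r) * hermite_weight (up n) powr (- 2 * r)" .
    qed auto
    finally show ?thesis by (simp add: mult.assoc)
  qed
  have "(\<Sum>n\<in>A. hermite_weight n powr (- 2 * q) * (partial_derivs (L @ [i]) (hermite_fun n) x)\<^sup>2) \<le> B + 3 powr (2 * r) * B"
    if A: "finite A" for x A
  proof -
    have "(\<Sum>n\<in>A. hermite_weight n powr (- 2 * q) * (partial_derivs (L @ [i]) (hermite_fun n) x)\<^sup>2)
        \<le> (\<Sum>n\<in>A. if n i \<noteq> 0 then ?\<Phi> x (dn n) else 0) + 3 powr (2 * r) * (\<Sum>n\<in>A. ?\<Phi> x (up n))"
      unfolding sum_distrib_left sum.distrib[symmetric] by (rule sum_mono) (rule term_le)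
    also have "(\<Sum>n\<in>A. if n i \<noteq> 0 then ?\<Phi> x (dn n) else 0) = (\<Sum>n\<in>{n\<in>A. n i \<noteq> 0}. ?\<Phi> x (dn n))"
      using A by (rule sum.inter_filter[symmetric])
    also have "\<dots> = (\<Sum>m\<in>dn ` {n\<in>A. n i \<noteq> 0}. ?\<Phi> x m)"
    proof (subst sum.reindex)
      have "up (dn n) = n" if "n i \<noteq> 0" for n using that by (simp add: up_def dn_def)
      then show "inj_on dn {n \<in> A. n i \<noteq> 0}" by (intro inj_on_inverseI[where g = up]) auto
    qed simp
    also have "\<dots> \<le> B" using A by (intro B) auto
    also have "(\<Sum>n\<in>A. ?\<Phi> x (up n)) = (\<Sum>m\<in>up ` A. ?\<Phi> x m)"
    proof (subst sum.reindex)
      have "dn (up n) = n" for n by (simp add: up_def dn_def)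
      then show "inj_on up A" by (intro inj_on_inverseI[where g = dn]) auto
    qed simp
    also have "\<dots> \<le> B" using A by (intro B) auto
    finally show ?thesis by simp
  qed
  then show ?case by blast
qed

subsection \<open>Hermite series\<close>

abbreviation hermite_sum :: "(('n::finite \<Rightarrow> nat) \<Rightarrow> real) \<Rightarrow> ('n \<Rightarrow> nat) set \<Rightarrow> real^'n \<Rightarrow> real" where
  "hermite_sum a A \<equiv> (\<lambda>x. \<Sum>n\<in>A. a n * hermite_fun n x)"

lemma hermite_sum_C0k:
  assumes "finite A"
  shows "hermite_sum a A \<in> C0k_space k"
    and "length L \<le> k \<Longrightarrow> partial_derivs L (hermite_sum a A) = (\<lambda>x. \<Sum>n\<in>A. a n * partial_derivs L (hermite_fun n) x)"
  using assms
proof (induction A rule: finite_induct)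
  case empty
  case 1 show ?case using C0k_space_zero by simp
  case 2 show ?case by (simp add: partial_derivs_zero)
next
  case (insert m A)
  case 1 show ?case
    using C0k_space_lincomb[OF hermite_fun_in_C0k[of m k] insert.IH(1), of "a m" 1] insert.hyps by simp
  case 2 then show ?case
    using partial_derivs_lincomb[OF Ck_fun_hermite_fun[of k m] C0k_space_Ck_fun[OF insert.IH(1)], of L "a m" 1]
      insert.IH(2) insert.hyps by simp
qed

text \<open>Cauchy-Schwarz pairs the coefficients weighted by power p with the derivatives weighted
  by power -p. \<open>C\<close> is fixed before \<open>a\<close> and \<open>A\<close>, so the
  estimate applies to the tails of a series.\<close>

lemma hermite_sum_C0k_norm_bound:
  assumes p: "p > real CARD('n::finite) / 4 + real k / 2"
  shows "\<exists>C>0. \<forall>a (A :: ('n \<Rightarrow> nat) set). finite A \<longrightarrow>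
    C0k_norm k (hermite_sum a A) \<le> C * L2_set (\<lambda>n. hermite_weight n powr p * a n) A"
proof -
  let ?bd = "\<lambda>L b. \<forall>(x::real^'n) A. finite A \<longrightarrow>
    (\<Sum>n\<in>A. hermite_weight n powr (- 2 * p) * (partial_derivs L (hermite_fun n) x)\<^sup>2) \<le> b"
  have "\<forall>L\<in>{L. length L \<le> k}. \<exists>b. ?bd L b"
    using p by (intro ballI hermite_derivs_square_sum_bound) (auto simp: field_simps)
  then obtain B where B': "\<forall>L\<in>{L. length L \<le> k}. ?bd L (B L)"
    by (rule bchoice[THEN exE])
  have B: "(\<Sum>n\<in>A. hermite_weight n powr (- 2 * p) * (partial_derivs L (hermite_fun n) x)\<^sup>2) \<le> B L"
    if "length L \<le> k" "finite A" for L A and x :: "real^'n"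
    using B' that by blast
  have B0: "0 \<le> B L" if "length L \<le> k" for L :: "'n list"
    using B[OF that, of "{}"] by simp
  \<comment> \<open>Over a finite alphabet there are finitely many lists of length at most
    \<open>k\<close>, so a sum serves as a common bound.\<close>
  define M where "M = (\<Sum>L | set L \<subseteq> (UNIV :: 'n set) \<and> length L \<le> k. sqrt (B L))"
  have BM: "sqrt (B L) \<le> M" if "length L \<le> k" for L
    unfolding M_def using that B0 by (intro member_le_sum finite_lists_length_le) auto
  have M0: "M \<ge> 0" by (rule order_trans[OF real_sqrt_ge_zero[OF B0[of "[]"]] BM[of "[]"]]) simp_all
  define c where "c = real (card {\<alpha> :: 'n \<Rightarrow> nat. order_of \<alpha> \<le> k})"
  \<comment> \<open>The added 1 keeps the constant positive even if \<open>M\<close> is 0.\<close>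
  have "C0k_norm k (hermite_sum a A) \<le> (c * M + 1) * L2_set (\<lambda>n. hermite_weight n powr p * a n) A"
    if A: "finite A" for a and A :: "('n \<Rightarrow> nat) set"
  proof -
    let ?v = "\<lambda>n. hermite_weight n powr p * a n"
    have "\<bar>partial_derivs L (hermite_sum a A) x\<bar> \<le> M * L2_set ?v A" if L: "length L \<le> k" for L x
    proof -
      let ?g = "\<lambda>n. hermite_weight n powr (- p) * partial_derivs L (hermite_fun n) x"
      have "?v n * ?g n = a n * partial_derivs L (hermite_fun n) x" for n
      proof -
        have "hermite_weight n powr p * hermite_weight n powr (- p) = 1"
          using hermite_weight_pos[of n] by (simp add: powr_add[symmetric])
        moreover have "?v n * ?g n = (hermite_weight n powr p * hermite_weight n powr (- p)) * (a n * partial_derivs L (hermite_fun n) x)"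
          by (simp only: ac_simps)
        ultimately show ?thesis by simp
      qed
      then have "\<bar>partial_derivs L (hermite_sum a A) x\<bar> = \<bar>\<Sum>n\<in>A. ?v n * ?g n\<bar>"
        unfolding hermite_sum_C0k(2)[OF A L] by (simp only:)
      also have "\<dots> \<le> (\<Sum>n\<in>A. \<bar>?v n\<bar> * \<bar>?g n\<bar>)"
        using sum_abs[of "\<lambda>n. ?v n * ?g n" A] by (simp only: abs_mult)
      also have "\<dots> \<le> L2_set ?v A * L2_set ?g A" by (rule L2_set_mult_ineq)
      also have "\<dots> \<le> L2_set ?v A * M"
      proof (rule mult_left_mono[OF _ L2_set_nonneg])
        have "(\<Sum>n\<in>A. (?g n)\<^sup>2) \<le> B L"
        proof -
          have "(hermite_weight n powr (- p))\<^sup>2 = hermite_weight n powr (- 2 * p)" for n :: "'n \<Rightarrow> nat"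
            by (simp add: power2_eq_square powr_add[symmetric])
          then show ?thesis using B[OF L A, of x] by (simp only: power_mult_distrib)
        qed
        then show "L2_set ?g A \<le> M"
          unfolding L2_set_def by (intro order_trans[OF _ BM[OF L]]) simp
      qed
      finally show ?thesis by (simp only: mult.commute)
    qed
    then have "C0k_norm k (hermite_sum a A) \<le> c * (M * L2_set ?v A)"
      unfolding c_def by (rule C0k_norm_le)
    also have "\<dots> \<le> (c * M + 1) * L2_set ?v A"
      by (simp add: algebra_simps L2_set_nonneg)
    finally show ?thesis .
  qed
  moreover have "c * M + 1 > 0" using M0 by (simp add: c_def add_nonneg_pos)
  ultimately show ?thesis by blast
qed

subsection \<open>Square integrable functions\<close>

lemma measurable_lebesgue_of_borel: "f \<in> borel_measurable borel \<Longrightarrow> f \<in> borel_measurable lebesgue"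
  by (simp add: measurable_completion)

lemma L2_mult_integrable: "f \<in> L2_space \<Longrightarrow> g \<in> L2_space \<Longrightarrow> integrable lebesgue (\<lambda>x. f x * g x)"
  unfolding L2_space_def by (auto intro: product_integrable_of_square)

lemma L2_space_lincomb:
  assumes f: "f \<in> L2_space" and g: "g \<in> L2_space"
  shows "(\<lambda>x. a * f x + b * g x) \<in> L2_space"
proof -
  have [measurable]: "f \<in> borel_measurable lebesgue" "g \<in> borel_measurable lebesgue"
    using f g by (auto simp: L2_space_def)
  have "integrable lebesgue (\<lambda>x. a\<^sup>2 * (f x)\<^sup>2 + 2 * a * b * (f x * g x) + b\<^sup>2 * (g x)\<^sup>2)"
    using f g by (intro Bochner_Integration.integrable_add integrable_mult_right L2_mult_integrable) (auto simp: L2_space_def)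
  moreover have "(a * u + b * v)\<^sup>2 = a\<^sup>2 * u\<^sup>2 + 2 * a * b * (u * v) + b\<^sup>2 * v\<^sup>2" for u v
    by (simp add: power2_eq_square algebra_simps)
  ultimately show ?thesis by (simp add: L2_space_def)
qed

lemma L2_inner_lincomb:
  "f \<in> L2_space \<Longrightarrow> g \<in> L2_space \<Longrightarrow> h \<in> L2_space \<Longrightarrow>
    L2_inner (\<lambda>x. a * f x + b * g x) h = a * L2_inner f h + b * L2_inner g h"
  unfolding L2_inner_def by (simp add: distrib_right mult.assoc L2_mult_integrable)

lemma L2_inner_commute: "L2_inner f g = L2_inner g f"
  by (simp add: L2_inner_def mult.commute)

lemma L2_space_zero: "(\<lambda>_. 0) \<in> L2_space"
  by (simp add: L2_space_def)

lemma hermite_sum_L2: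
  assumes "finite A"
  shows "hermite_sum a A \<in> L2_space"
    and "h \<in> L2_space \<Longrightarrow> L2_inner (hermite_sum a A) h = (\<Sum>n\<in>A. a n * L2_inner (hermite_fun n) h)"
  using assms
proof (induction A rule: finite_induct)
  case empty
  case 1 show ?case by (simp add: L2_space_zero)
  case 2 show ?case by (simp add: L2_inner_def)
next
  case (insert m A)
  case 1 show ?case
    using L2_space_lincomb[OF hermite_fun_in_L2[of m] insert.IH(1), of "a m" 1] insert.hyps by simp
  case 2 then show ?case
    using L2_inner_lincomb[OF hermite_fun_in_L2[of m] insert.IH(1), of h "a m" 1] insert by simp
qed

definition hermite_coeff :: "(real^'n::finite \<Rightarrow> real) \<Rightarrow> ('n \<Rightarrow> nat) \<Rightarrow> real" where
  "hermite_coeff f n = L2_inner f (hermite_fun n)"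

lemma hermite_coeff_lincomb:
  "f \<in> L2_space \<Longrightarrow> g \<in> L2_space \<Longrightarrow> hermite_coeff (\<lambda>x. a * f x + b * g x) n = a * hermite_coeff f n + b * hermite_coeff g n"
  unfolding hermite_coeff_def by (rule L2_inner_lincomb[OF _ _ hermite_fun_in_L2])

lemma hermite_coeff_sum: "finite A \<Longrightarrow> hermite_coeff (hermite_sum a A) n = (if n \<in> A then a n else 0)"
  unfolding hermite_coeff_def
  by (simp add: hermite_sum_L2 hermite_fun_in_L2 hermite_fun_orthonormal if_distrib[of "\<lambda>x. a _ * x"] sum.delta' cong: if_cong)

lemma L2_inner_hermite_sum_self:
  assumes "finite A"
  shows "L2_inner (hermite_sum a A) (hermite_sum a A) = (\<Sum>n\<in>A. (a n)\<^sup>2)"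
proof -
  have "L2_inner (hermite_sum a A) (hermite_sum a A) = (\<Sum>n\<in>A. a n * hermite_coeff (hermite_sum a A) n)"
    using hermite_sum_L2(2)[OF assms hermite_sum_L2(1)[OF assms]] by (simp add: hermite_coeff_def L2_inner_commute)
  then show ?thesis using assms by (simp add: hermite_coeff_sum power2_eq_square)
qed

subsection \<open>The Hermite Sobolev norm as a weighted norm of the coefficients\<close>

text \<open>These finite sets match the grouping by degree in \<open>hs_inner\<close>: the first N
  terms of that series form one finite sum over \<open>order_less N\<close>.\<close>

definition order_less :: "nat \<Rightarrow> ('n::finite \<Rightarrow> nat) set" where
  "order_less N = {n. order_of n < N}"

lemma finite_order_less: "finite (order_less N)"
  unfolding order_less_def by (rule finite_subset[OF _ finite_order_le[of N]]) auto

lemma order_less_mono: "M \<le> N \<Longrightarrow> order_less M \<subseteq> order_less N"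
  by (auto simp: order_less_def)

lemma sum_hs_term:
  "(\<Sum>k<N. hs_term p f f k) = (L2_set (\<lambda>n. hermite_weight n powr p * hermite_coeff f n) (order_less N))\<^sup>2"
    for f :: "real^'n::finite \<Rightarrow> real"
proof -
  have "hs_term p f f k = (\<Sum>n | order_of n = k. (hermite_weight n powr p * hermite_coeff f n)\<^sup>2)" for k
    unfolding hs_term_def
  proof (intro sum.cong refl)
    fix n :: "'n \<Rightarrow> nat" assume "n \<in> {n. order_of n = k}"
    then have "real (2 * k + CARD('n)) powr (2 * p) = (hermite_weight n powr p)\<^sup>2"
      by (simp add: hermite_weight_def power2_eq_square powr_add[symmetric])
    then show "real (2 * k + CARD('n)) powr (2 * p) * L2_inner f (hermite_fun n) * L2_inner (hermite_fun n) f
        = (hermite_weight n powr p * hermite_coeff f n)\<^sup>2"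
      by (simp only: L2_inner_commute[of "hermite_fun n" f] hermite_coeff_def) (simp add: power2_eq_square)
  qed
  then have "(\<Sum>k<N. hs_term p f f k) = (\<Sum>k<N. \<Sum>n | order_of n = k. (hermite_weight n powr p * hermite_coeff f n)\<^sup>2)"
    by simp
  also have "\<dots> = (\<Sum>k<N. \<Sum>n | n \<in> order_less N \<and> order_of n = k. (hermite_weight n powr p * hermite_coeff f n)\<^sup>2)"
    by (intro sum.cong refl) (auto simp: order_less_def)
  also have "\<dots> = (\<Sum>n\<in>order_less N. (hermite_weight n powr p * hermite_coeff f n)\<^sup>2)"
    by (rule sum.group) (auto simp: finite_order_less, auto simp: order_less_def)
  finally show ?thesis by (simp add: L2_set_def sum_nonneg)
qed

lemma hs_term_nonneg: "0 \<le> hs_term p f f k"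
  unfolding hs_term_def L2_inner_commute[of _ f] by (intro sum_nonneg) (simp add: mult.assoc)

lemma coeff_le_hs_norm:
  assumes "f \<in> hermite_sobolev p"
  shows "L2_set (\<lambda>n. hermite_weight n powr p * hermite_coeff f n) (order_less N) \<le> hs_norm p f"
proof -
  have "(\<Sum>k<N. hs_term p f f k) \<le> hs_inner p f f"
    unfolding hs_inner_def using assms hs_term_nonneg
    by (intro sum_le_suminf) (auto simp: hermite_sobolev_def)
  then show ?thesis
    unfolding sum_hs_term hs_norm_def by (rule real_le_rsqrt)
qed

text \<open>Converse of \<open>coeff_le_hs_norm\<close>. Together they reduce membership and norm to
  uniform bounds on finite blocks of coefficients, where \<open>L2_set_triangle_ineq\<close> and
  limits are available.\<close>

lemma hermite_sobolevI:
  assumes f: "f \<in> L2_space"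
    and le: "\<And>N. L2_set (\<lambda>n. hermite_weight n powr p * hermite_coeff f n) (order_less N) \<le> c"
  shows "f \<in> hermite_sobolev p" and "hs_norm p f \<le> c"
proof -
  have c: "0 \<le> c" using le[of 0] L2_set_nonneg by (rule order_trans[rotated])
  have s: "(\<Sum>k<N. hs_term p f f k) \<le> c\<^sup>2" for N
    unfolding sum_hs_term by (intro power_mono le L2_set_nonneg)
  then have sm: "summable (hs_term p f f)"
    by (intro bounded_imp_summable[of _ "c\<^sup>2"]) (auto simp: hs_term_nonneg lessThan_Suc_atMost[symmetric] simp del: sum.lessThan_Suc)
  then show "f \<in> hermite_sobolev p" using f by (simp add: hermite_sobolev_def)
  have "hs_inner p f f \<le> c\<^sup>2"
    unfolding hs_inner_def by (rule suminf_le_const[OF sm s])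
  then show "hs_norm p f \<le> c"
    unfolding hs_norm_def by (rule real_le_lsqrt[OF c])
qed

lemma hermite_sobolev_L2: "f \<in> hermite_sobolev p \<Longrightarrow> f \<in> L2_space"
  by (simp add: hermite_sobolev_def)

lemma hs_norm_nonneg: "f \<in> hermite_sobolev p \<Longrightarrow> 0 \<le> hs_norm p f"
  using coeff_le_hs_norm[of f p 0] L2_set_nonneg by (rule order_trans[rotated])

lemma hermite_sobolev_add:
  assumes f: "f \<in> hermite_sobolev p" and g: "g \<in> hermite_sobolev p"
  shows "(\<lambda>x. f x + g x) \<in> hermite_sobolev p" "hs_norm p (\<lambda>x. f x + g x) \<le> hs_norm p f + hs_norm p g"
proof -
  have L2: "f \<in> L2_space" "g \<in> L2_space" using f g by (auto dest: hermite_sobolev_L2)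
  have le: "L2_set (\<lambda>n. hermite_weight n powr p * hermite_coeff (\<lambda>x. f x + g x) n) (order_less N) \<le> hs_norm p f + hs_norm p g" for N
  proof -
    have "L2_set (\<lambda>n. hermite_weight n powr p * hermite_coeff (\<lambda>x. f x + g x) n) (order_less N)
      = L2_set (\<lambda>n. hermite_weight n powr p * hermite_coeff f n + hermite_weight n powr p * hermite_coeff g n) (order_less N)"
      using hermite_coeff_lincomb[OF L2, of 1 1] by (simp add: distrib_left)
    also have "\<dots> \<le> L2_set (\<lambda>n. hermite_weight n powr p * hermite_coeff f n) (order_less N)
        + L2_set (\<lambda>n. hermite_weight n powr p * hermite_coeff g n) (order_less N)"
      by (rule L2_set_triangle_ineq)
    also have "\<dots> \<le> hs_norm p f + hs_norm p g"
      by (intro add_mono coeff_le_hs_norm f g)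
    finally show ?thesis .
  qed
  have "(\<lambda>x. f x + g x) \<in> L2_space" using L2_space_lincomb[OF L2, of 1 1] by simp
  from hermite_sobolevI[OF this le]
  show "(\<lambda>x. f x + g x) \<in> hermite_sobolev p" "hs_norm p (\<lambda>x. f x + g x) \<le> hs_norm p f + hs_norm p g" .
qed

lemma hermite_sobolev_scale:
  assumes f: "f \<in> hermite_sobolev p"
  shows "(\<lambda>x. c * f x) \<in> hermite_sobolev p" "hs_norm p (\<lambda>x. c * f x) = \<bar>c\<bar> * hs_norm p f"
proof -
  have L2: "f \<in> L2_space" using f by (rule hermite_sobolev_L2)
  have co: "L2_inner (\<lambda>x. c * f x) (hermite_fun n) = c * L2_inner f (hermite_fun n)" for n
    using L2_inner_lincomb[OF L2 L2 hermite_fun_in_L2[of n], of c 0] by simp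
  have t: "hs_term p (\<lambda>x. c * f x) (\<lambda>x. c * f x) k = c\<^sup>2 * hs_term p f f k" for k
    unfolding hs_term_def L2_inner_commute[of "hermite_fun _"] co sum_distrib_left
    by (intro sum.cong refl) (simp add: power2_eq_square)
  have sm: "summable (hs_term p f f)" using f by (simp add: hermite_sobolev_def)
  have "(\<lambda>x. c * f x) \<in> L2_space" using L2_space_lincomb[OF L2 L2, of c 0] by simp
  then show "(\<lambda>x. c * f x) \<in> hermite_sobolev p"
    using sm by (simp add: hermite_sobolev_def t[abs_def] summable_mult)
  show "hs_norm p (\<lambda>x. c * f x) = \<bar>c\<bar> * hs_norm p f"
    unfolding hs_norm_def hs_inner_def t suminf_mult[OF sm] by (simp add: real_sqrt_mult)
qed

lemma hermite_sobolev_diff: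
  assumes f: "f \<in> hermite_sobolev p" and g: "g \<in> hermite_sobolev p"
  shows "(\<lambda>x. f x - g x) \<in> hermite_sobolev p"
  using hermite_sobolev_add(1)[OF f hermite_sobolev_scale(1)[OF g, of "-1"]] by simp

text \<open>Norm zero makes every coefficient vanish because the weights are positive; the rest is
  completeness of the Hermite functions.\<close>

lemma hs_norm_eq_0_iff:
  assumes f: "f \<in> hermite_sobolev p"
  shows "hs_norm p f = 0 \<longleftrightarrow> ae_eq f (\<lambda>_. 0)"
proof
  assume 0: "hs_norm p f = 0"
  have "L2_inner f (hermite_fun n) = 0" for n
  proof -
    have "n \<in> order_less (Suc (order_of n))" by (simp add: order_less_def)
    then have "\<bar>hermite_weight n powr p * hermite_coeff f n\<bar>
        \<le> L2_set (\<lambda>n. hermite_weight n powr p * hermite_coeff f n) (order_less (Suc (order_of n)))"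
      unfolding L2_set_def
      by (intro real_le_rsqrt) (simp, rule member_le_sum[where f = "\<lambda>n. (hermite_weight n powr p * hermite_coeff f n)\<^sup>2"],
          auto simp: finite_order_less)
    also have "\<dots> \<le> 0" using coeff_le_hs_norm[OF f] 0 by simp
    finally show ?thesis using hermite_weight_pos[of n] by (simp add: hermite_coeff_def)
  qed
  then show "ae_eq f (\<lambda>_. 0)"
    using hermite_complete[OF hermite_sobolev_L2[OF f]] by simp
next
  assume ae: "ae_eq f (\<lambda>_. 0)"
  have "L2_inner f (hermite_fun n) = 0" for n
    unfolding L2_inner_def using ae by (intro integral_eq_zero_AE) (auto simp: ae_eq_def)
  then show "hs_norm p f = 0"
    by (simp add: hs_norm_def hs_inner_def hs_term_def)
qed

subsection \<open>Convergence of Hermite series\<close>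

text \<open>It serves twice: for the coefficients of a given f, and for limits of coefficients,
  where no function is at hand yet. Hence it starts from a mere bound on finite blocks, and
  \<open>C\<close> comes before \<open>a\<close> and \<open>c\<close>.\<close>

lemma hermite_synthesis:
  assumes p: "p > real CARD('n::finite) / 4 + real k / 2"
  shows "\<exists>C>0. \<forall>(a :: ('n \<Rightarrow> nat) \<Rightarrow> real) c.
    (\<forall>N. L2_set (\<lambda>n. hermite_weight n powr p * a n) (order_less N) \<le> c) \<longrightarrow>
    (\<exists>g \<in> C0k_space k. g \<in> L2_space \<and> (\<forall>n. hermite_coeff g n = a n) \<and> C0k_norm k g \<le> C * c)"
proof -
  obtain C where C: "C > 0" and bound: "\<And>a (A :: ('n \<Rightarrow> nat) set). finite A \<Longrightarrow>
    C0k_norm k (hermite_sum a A) \<le> C * L2_set (\<lambda>n. hermite_weight n powr p * a n) A"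
    using hermite_sum_C0k_norm_bound[OF p] by blast
  have p0: "p > 0"
    by (rule le_less_trans[OF _ p]) simp
  have "\<exists>g \<in> C0k_space k. g \<in> L2_space \<and> (\<forall>n. hermite_coeff g n = a n) \<and> C0k_norm k g \<le> C * c"
    if le: "\<And>N. L2_set (\<lambda>n. hermite_weight n powr p * a n) (order_less N) \<le> c" for a :: "('n \<Rightarrow> nat) \<Rightarrow> real" and c
  proof -
    define v where "v n = hermite_weight n powr p * a n" for n
    define s where "s N = (\<Sum>n\<in>order_less N. (v n)\<^sup>2)" for N
    define F where "F N = hermite_sum a (order_less N)" for N
    have c: "0 \<le> c" using le[of 0] L2_set_nonneg by (rule order_trans[rotated])
    have F: "F N \<in> C0k_space k" for N
      unfolding F_def by (rule hermite_sum_C0k[OF finite_order_less])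
    have FL2: "F N \<in> L2_space" for N
      unfolding F_def by (rule hermite_sum_L2[OF finite_order_less])
    have Fnorm: "C0k_norm k (F N) \<le> C * c" for N
      using order_trans[OF bound[OF finite_order_less, of a N] mult_left_mono[OF le[of N], of C]] C by (simp add: F_def)
    have s_le: "s N \<le> c\<^sup>2" for N
    proof -
      have "s N = (L2_set v (order_less N))\<^sup>2" by (simp add: s_def L2_set_def sum_nonneg)
      also have "\<dots> \<le> c\<^sup>2" using le[of N] by (intro power_mono) (auto simp: v_def[abs_def] L2_set_nonneg)
      finally show ?thesis .
    qed
    have s_diff: "s N - s M = (\<Sum>n\<in>order_less N - order_less M. (v n)\<^sup>2)" if "M \<le> N" for M N
      unfolding s_def by (rule sum_diff[OF finite_order_less order_less_mono[OF that], symmetric])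
    \<comment> \<open>Increasing and bounded, hence Cauchy; differences of \<open>s\<close> are the
      squared tails that control differences of \<open>F\<close>.\<close>
    have "incseq s"
      unfolding s_def by (intro incseq_SucI sum_mono2 finite_order_less order_less_mono) auto
    then obtain l where "s \<longlonglongrightarrow> l"
      using s_le by (blast elim: incseq_convergent)
    then have "Cauchy s" by (rule LIMSEQ_imp_Cauchy)
    have tail: "C0k_norm k (\<lambda>x. F N x - F M x) \<le> C * sqrt (s N - s M)" if "M \<le> N" for M N
    proof -
      have "(\<lambda>x. F N x - F M x) = hermite_sum a (order_less N - order_less M)"
        unfolding F_def by (simp only: sum_diff[OF finite_order_less order_less_mono[OF that]])
      then show ?thesis
        using bound[OF finite_Diff[OF finite_order_less], of a N "order_less M"] s_diff[OF that]
        by (simp add: L2_set_def v_def)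
    qed
    have flip: "C0k_norm k (\<lambda>x. F N x - F M x) = C0k_norm k (\<lambda>x. F M x - F N x)" for M N
      using C0k_norm_scale[OF C0k_space_diff[OF F[of M] F[of N]], of "-1"] by simp
    have cauchy: "\<exists>M. \<forall>m\<ge>M. \<forall>n\<ge>M. C0k_norm k (\<lambda>x. F m x - F n x) < e" if "e > 0" for e
    proof -
      have "(e / C)\<^sup>2 > 0" using that C by simp
      then obtain M where M: "\<And>m n. m \<ge> M \<Longrightarrow> n \<ge> M \<Longrightarrow> dist (s m) (s n) < (e / C)\<^sup>2"
        using \<open>Cauchy s\<close> unfolding Cauchy_def by metis
      have one: "C0k_norm k (\<lambda>x. F n x - F m x) < e" if "m \<ge> M" "n \<ge> M" "m \<le> n" for m n
      proof -
        have "s n - s m < (e / C)\<^sup>2" using M[OF that(1,2)] by (simp add: dist_real_def abs_if split: if_splits)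
        then have "sqrt (s n - s m) < sqrt ((e / C)\<^sup>2)" by (rule real_sqrt_less_mono)
        also have "sqrt ((e / C)\<^sup>2) = e / C" using C \<open>e > 0\<close> by simp
        finally have "C * sqrt (s n - s m) < e" by (simp only: pos_less_divide_eq[OF C] mult.commute)
        then show ?thesis using tail[OF that(3)] by linarith
      qed
      have "C0k_norm k (\<lambda>x. F m x - F n x) < e" if "m \<ge> M" "n \<ge> M" for m n
        using one[of m n] one[of n m] flip[of m n] that by (cases "m \<le> n") auto
      then show ?thesis by blast
    qed
    obtain g where g: "g \<in> C0k_space k" and lim: "(\<lambda>n. C0k_norm k (\<lambda>x. F n x - g x)) \<longlonglongrightarrow> 0"
      and unif: "uniform_limit UNIV F g sequentially"
      by (rule C0k_complete[OF F cauchy])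
    have "C0k_norm k g \<le> C * c + C0k_norm k (\<lambda>x. F N x - g x)" for N
    proof -
      have d: "(\<lambda>x. g x - F N x) \<in> C0k_space k" by (rule C0k_space_diff[OF g F])
      have "C0k_norm k g \<le> C0k_norm k (F N) + C0k_norm k (\<lambda>x. g x - F N x)"
        using C0k_norm_triangle[OF F[of N] d] by simp
      also have "C0k_norm k (\<lambda>x. g x - F N x) = C0k_norm k (\<lambda>x. F N x - g x)"
        using C0k_norm_scale[OF d, of "-1"] by simp
      finally show ?thesis using Fnorm[of N] by linarith
    qed
    moreover have "(\<lambda>N. C * c + C0k_norm k (\<lambda>x. F N x - g x)) \<longlonglongrightarrow> C * c + 0"
      by (intro tendsto_intros lim)
    ultimately have gnorm: "C0k_norm k g \<le> C * c"
      using LIMSEQ_le_const[of _ "C * c + 0" "C0k_norm k g"] by auto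
    have ptw: "(\<lambda>N. F N x) \<longlonglongrightarrow> g x" for x
      using unif by (rule tendsto_uniform_limitI) simp
    have "continuous_on UNIV g" using C0k_space_Ck_fun[OF g] by (cases k) auto
    then have gm [measurable]: "g \<in> borel_measurable lebesgue"
      by (intro measurable_lebesgue_of_borel borel_measurable_continuous_onI)
    have [measurable]: "F N \<in> borel_measurable lebesgue" for N
      using FL2[of N] by (simp add: L2_space_def)
    \<comment> \<open>On a space of infinite measure uniform convergence does not give square
      integrability, so Fatou is used. The L^2 norms of \<open>F N\<close> stay below
      \<open>c\<close> because \<open>hermite_weight n powr p\<close> is at least 1.\<close>
    have "(\<integral>\<^sup>+x. ennreal ((g x)\<^sup>2) \<partial>lebesgue) \<le> liminf (\<lambda>N. \<integral>\<^sup>+x. ennreal ((F N x)\<^sup>2) \<partial>lebesgue)"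
    proof -
      have "ennreal ((g x)\<^sup>2) = liminf (\<lambda>N. ennreal ((F N x)\<^sup>2))" for x
        by (rule lim_imp_Liminf[symmetric]) (auto intro!: tendsto_ennrealI tendsto_power ptw)
      then have "(\<integral>\<^sup>+x. ennreal ((g x)\<^sup>2) \<partial>lebesgue) = (\<integral>\<^sup>+x. liminf (\<lambda>N. ennreal ((F N x)\<^sup>2)) \<partial>lebesgue)" by simp
      also have "\<dots> \<le> liminf (\<lambda>N. \<integral>\<^sup>+x. ennreal ((F N x)\<^sup>2) \<partial>lebesgue)"
        by (rule nn_integral_liminf) simp
      finally show ?thesis .
    qed
    also have "\<dots> \<le> ennreal (c\<^sup>2)"
    proof (rule Liminf_le[OF sequentially_bot always_eventually], rule allI)
      fix N
      have "(\<integral>\<^sup>+x. ennreal ((F N x)\<^sup>2) \<partial>lebesgue) = ennreal (LINT x|lebesgue. (F N x)\<^sup>2)"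
        using FL2[of N] by (intro nn_integral_eq_integral) (auto simp: L2_space_def)
      also have "(LINT x|lebesgue. (F N x)\<^sup>2) = (\<Sum>n\<in>order_less N. (a n)\<^sup>2)"
        using L2_inner_hermite_sum_self[OF finite_order_less, of a N] by (simp add: F_def L2_inner_def power2_eq_square)
      also have "\<dots> \<le> s N"
        unfolding s_def
      proof (rule sum_mono)
        fix n :: "'n \<Rightarrow> nat"
        have "1 \<le> hermite_weight n powr p" using hermite_weight_ge1[of n] p0 by (intro ge_one_powr_ge_zero) auto
        then have "\<bar>a n\<bar> \<le> \<bar>v n\<bar>" by (simp add: v_def abs_mult mult_le_cancel_right1)
        then show "(a n)\<^sup>2 \<le> (v n)\<^sup>2" by (simp only: abs_le_square_iff)
      qed
      also have "s N \<le> c\<^sup>2" by (rule s_le)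
      finally show "(\<integral>\<^sup>+x. ennreal ((F N x)\<^sup>2) \<partial>lebesgue) \<le> ennreal (c\<^sup>2)" by (simp add: ennreal_leI)
    qed
    finally have "integrable lebesgue (\<lambda>x. (g x)\<^sup>2)"
      by (intro integrableI_bounded) (auto simp: less_top[symmetric] top_unique)
    then have gL2: "g \<in> L2_space" by (simp add: L2_space_def)
    have "hermite_coeff g n = a n" for n
    proof -
      have [measurable]: "hermite_fun n \<in> borel_measurable lebesgue"
        by (intro measurable_lebesgue_of_borel) simp
      \<comment> \<open>The common supremum bound \<open>C * c\<close> of all \<open>F N\<close>,
        times the integrable \<open>hermite_fun n\<close>, dominates the integrands.\<close>
      have "(\<lambda>N. hermite_coeff (F N) n) \<longlonglongrightarrow> hermite_coeff g n"
        unfolding hermite_coeff_def L2_inner_def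
      proof (rule integral_dominated_convergence)
        show "integrable lebesgue (\<lambda>x. C * c * \<bar>hermite_fun n x\<bar>)"
          by (intro integrable_mult_right integrable_abs hermite_fun_integrable)
        show "AE x in lebesgue. (\<lambda>N. F N x * hermite_fun n x) \<longlonglongrightarrow> g x * hermite_fun n x"
          by (intro AE_I2 tendsto_intros ptw)
        show "AE x in lebesgue. norm (F N x * hermite_fun n x) \<le> C * c * \<bar>hermite_fun n x\<bar>" for N
          using order_trans[OF abs_le_C0k_norm[OF F] Fnorm]
          by (intro AE_I2) (auto simp: abs_mult intro: mult_right_mono)
      qed simp_all
      moreover have "(\<lambda>N. hermite_coeff (F N) n) \<longlonglongrightarrow> a n"
      proof (rule tendsto_eventually)
        show "\<forall>\<^sub>F N in sequentially. hermite_coeff (F N) n = a n"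
          using eventually_gt_at_top[of "order_of n"]
          by eventually_elim (simp add: F_def hermite_coeff_sum finite_order_less, simp add: order_less_def)
      qed
      ultimately show ?thesis by (rule LIMSEQ_unique)
    qed
    then show ?thesis using g gL2 gnorm by blast
  qed
  then show ?thesis using C by blast
qed

text \<open>Coefficients converge one by one, and \<open>hermite_synthesis\<close> turns the limits
  into a function. Estimates are made on finite blocks, where \<open>l\<close> may go to infinity,
  and then lifted by \<open>hermite_sobolevI\<close>.\<close>

lemma hermite_sobolev_complete:
  fixes F :: "nat \<Rightarrow> real^'n::finite \<Rightarrow> real"
  assumes p: "p > real CARD('n) / 4"
    and F: "\<And>m. F m \<in> hermite_sobolev p"
    and Cauchy: "\<And>e. e > 0 \<Longrightarrow> \<exists>M. \<forall>m\<ge>M. \<forall>n\<ge>M. hs_norm p (\<lambda>x. F m x - F n x) < e"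
  shows "\<exists>f\<in>hermite_sobolev p. (\<lambda>n. hs_norm p (\<lambda>x. F n x - f x)) \<longlonglongrightarrow> 0"
proof -
  have L2: "F m \<in> L2_space" for m using F by (rule hermite_sobolev_L2)
  define w where "w n = hermite_weight n powr p" for n :: "'n \<Rightarrow> nat"
  have w: "w n > 0" for n using hermite_weight_pos[of n] by (simp add: w_def)
  have diff: "hermite_coeff (\<lambda>x. f x - g x) n = hermite_coeff f n - hermite_coeff g n"
    if "f \<in> L2_space" "g \<in> L2_space" for f g :: "real^'n \<Rightarrow> real" and n
    using hermite_coeff_lincomb[OF that, of 1 "-1" n] by simp
  have le: "L2_set (\<lambda>n. w n * (hermite_coeff (F m) n - hermite_coeff (F l) n)) (order_less N) \<le> hs_norm p (\<lambda>x. F m x - F l x)" for m l N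
    using coeff_le_hs_norm[OF hermite_sobolev_diff[OF F F], of m l N] by (simp add: w_def diff[OF L2 L2])
  have coeff_le: "w n * \<bar>hermite_coeff (F m) n - hermite_coeff (F l) n\<bar> \<le> hs_norm p (\<lambda>x. F m x - F l x)" for m l n
  proof -
    have "n \<in> order_less (Suc (order_of n))" by (simp add: order_less_def)
    then have "w n * (hermite_coeff (F m) n - hermite_coeff (F l) n)
        \<le> L2_set (\<lambda>n. w n * (hermite_coeff (F m) n - hermite_coeff (F l) n)) (order_less (Suc (order_of n)))" for m l
      by (intro member_le_L2_set finite_order_less)
    from order_trans[OF this le] have *: "w n * (hermite_coeff (F m) n - hermite_coeff (F l) n) \<le> hs_norm p (\<lambda>x. F m x - F l x)" for m l .
    have "hs_norm p (\<lambda>x. F l x - F m x) = hs_norm p (\<lambda>x. F m x - F l x)"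
      using hermite_sobolev_scale(2)[OF hermite_sobolev_diff[OF F F], of "-1" m l] by simp
    then show ?thesis using *[of m l] *[of l m] by (auto simp: abs_if)
  qed
  have "convergent (\<lambda>m. hermite_coeff (F m) n)" for n
  proof (rule Cauchy_convergent, rule metric_CauchyI)
    fix e :: real assume "e > 0"
    then have "w n * e > 0" using w[of n] by simp
    then obtain M where M: "\<And>m l. m \<ge> M \<Longrightarrow> l \<ge> M \<Longrightarrow> hs_norm p (\<lambda>x. F m x - F l x) < w n * e"
      using Cauchy[of "w n * e"] by blast
    have "dist (hermite_coeff (F m) n) (hermite_coeff (F l) n) < e" if "m \<ge> M" "l \<ge> M" for m l
    proof -
      have "w n * \<bar>hermite_coeff (F m) n - hermite_coeff (F l) n\<bar> < w n * e"
        using coeff_le[of n m l] M[OF that] by linarith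
      then show ?thesis using w[of n] by (simp add: dist_real_def)
    qed
    then show "\<exists>M. \<forall>m\<ge>M. \<forall>l\<ge>M. dist (hermite_coeff (F m) n) (hermite_coeff (F l) n) < e" by blast
  qed
  then obtain a where a: "\<And>n. (\<lambda>m. hermite_coeff (F m) n) \<longlonglongrightarrow> a n"
    unfolding convergent_def by metis
  have lim_le: "L2_set (\<lambda>n. w n * (hermite_coeff (F m) n - a n)) (order_less N) \<le> e"
    if "\<And>l. l \<ge> M \<Longrightarrow> hs_norm p (\<lambda>x. F m x - F l x) \<le> e" for m M N e
  proof (rule LIMSEQ_le_const2)
    show "(\<lambda>l. L2_set (\<lambda>n. w n * (hermite_coeff (F m) n - hermite_coeff (F l) n)) (order_less N))
        \<longlonglongrightarrow> L2_set (\<lambda>n. w n * (hermite_coeff (F m) n - a n)) (order_less N)"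
      unfolding L2_set_def by (intro tendsto_intros a)
    show "\<exists>M. \<forall>l\<ge>M. L2_set (\<lambda>n. w n * (hermite_coeff (F m) n - hermite_coeff (F l) n)) (order_less N) \<le> e"
      using order_trans[OF le that] by blast
  qed
  \<comment> \<open>A fixed member within distance 1 of all later ones bounds the limit
    coefficients.\<close>
  obtain M1 where M1: "\<And>l. l \<ge> M1 \<Longrightarrow> hs_norm p (\<lambda>x. F M1 x - F l x) \<le> 1"
    using Cauchy[of 1] by (metis less_imp_le order_refl zero_less_one)
  have "L2_set (\<lambda>n. hermite_weight n powr p * a n) (order_less N) \<le> hs_norm p (F M1) + 1" for N
  proof -
    have "L2_set (\<lambda>n. w n * a n) (order_less N)
        = L2_set (\<lambda>n. w n * hermite_coeff (F M1) n + - (w n * (hermite_coeff (F M1) n - a n))) (order_less N)"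
      by (simp add: algebra_simps)
    also have "\<dots> \<le> L2_set (\<lambda>n. w n * hermite_coeff (F M1) n) (order_less N)
        + L2_set (\<lambda>n. - (w n * (hermite_coeff (F M1) n - a n))) (order_less N)"
      by (rule L2_set_triangle_ineq)
    also have "L2_set (\<lambda>n. - (w n * (hermite_coeff (F M1) n - a n))) (order_less N) \<le> 1"
      using lim_le[OF M1] by (simp add: L2_set_def)
    also have "L2_set (\<lambda>n. w n * hermite_coeff (F M1) n) (order_less N) \<le> hs_norm p (F M1)"
      unfolding w_def by (rule coeff_le_hs_norm[OF F])
    finally show ?thesis by (simp add: w_def)
  qed
  \<comment> \<open>Order 0 is enough: only square integrability and the coefficients of the
    synthesised function are used here.\<close>
  moreover have "p > real CARD('n) / 4 + real 0 / 2" using p by simp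
  note hermite_synthesis[OF this]
  ultimately obtain f where f: "f \<in> L2_space" "\<And>n. hermite_coeff f n = a n"
    by blast
  have key: "(\<lambda>x. F m x - f x) \<in> hermite_sobolev p" "hs_norm p (\<lambda>x. F m x - f x) \<le> e"
    if "\<And>l. l \<ge> M \<Longrightarrow> hs_norm p (\<lambda>x. F m x - F l x) \<le> e" for m M e
  proof -
    have d: "(\<lambda>x. F m x - f x) \<in> L2_space" using L2_space_lincomb[OF L2[of m] f(1), of 1 "-1"] by simp
    have "L2_set (\<lambda>n. hermite_weight n powr p * hermite_coeff (\<lambda>x. F m x - f x) n) (order_less N) \<le> e" for N
      using lim_le[OF that] by (simp add: diff[OF L2 f(1)] f(2) w_def)
    from hermite_sobolevI[OF d this] show "(\<lambda>x. F m x - f x) \<in> hermite_sobolev p" "hs_norm p (\<lambda>x. F m x - f x) \<le> e" .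
  qed
  \<comment> \<open>\<open>f\<close> is \<open>F M1\<close> minus the difference
    \<open>F M1 - f\<close>, which \<open>key\<close> places in the space.\<close>
  have fS: "f \<in> hermite_sobolev p"
    using hermite_sobolev_diff[OF F[of M1] key(1)[OF M1]] by simp
  have "(\<lambda>n. hs_norm p (\<lambda>x. F n x - f x)) \<longlonglongrightarrow> 0"
  proof (rule tendstoI)
    fix e :: real assume "e > 0"
    then obtain M where M: "\<And>m l. m \<ge> M \<Longrightarrow> l \<ge> M \<Longrightarrow> hs_norm p (\<lambda>x. F m x - F l x) < e / 2"
      using Cauchy[of "e / 2"] by auto
    have "dist (hs_norm p (\<lambda>x. F m x - f x)) 0 < e" if "m \<ge> M" for m
    proof -
      have "hs_norm p (\<lambda>x. F m x - f x) \<le> e / 2" using M[OF that] by (intro key(2)[of M]) (auto intro: less_imp_le)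
      then show ?thesis
        using hs_norm_nonneg[OF hermite_sobolev_diff[OF F[of m] fS]] \<open>e > 0\<close> by (simp add: dist_real_def)
    qed
    then show "\<forall>\<^sub>F m in sequentially. dist (hs_norm p (\<lambda>x. F m x - f x)) 0 < e"
      using eventually_sequentially by blast
  qed
  with fS show ?thesis by blast
qed

lemma hermite_sobolev_banach:
  assumes p: "p > real CARD('n::finite) / 4"
  shows "banach_function_space ae_eq (hermite_sobolev p :: (real^'n \<Rightarrow> real) set) (hs_norm p)"
  unfolding banach_function_space_def
proof (intro conjI ballI allI impI)
  show "(\<lambda>_. 0) \<in> hermite_sobolev p"
    by (simp add: hermite_sobolev_def L2_space_zero hs_term_def[abs_def] L2_inner_def)
next
  fix F :: "nat \<Rightarrow> real^'n \<Rightarrow> real"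
  assume "(\<forall>m. F m \<in> hermite_sobolev p) \<and> (\<forall>e>0. \<exists>M. \<forall>m\<ge>M. \<forall>n\<ge>M. hs_norm p (\<lambda>x. F m x - F n x) < e)"
  then show "\<exists>f\<in>hermite_sobolev p. (\<lambda>n. hs_norm p (\<lambda>x. F n x - f x)) \<longlonglongrightarrow> 0"
    by (intro hermite_sobolev_complete[OF p]) auto
qed (auto intro: hermite_sobolev_add hermite_sobolev_scale hs_norm_nonneg simp: hs_norm_eq_0_iff)

theorem theoremB19:
  fixes k :: nat and p :: real
  assumes "p > real CARD('n::finite) / 4 + real k / 2"
  shows "banach_function_space ae_eq (hermite_sobolev p :: (real^'n \<Rightarrow> real) set) (hs_norm p) \<and>
    banach_function_space (=) (C0k_space k :: (real^'n \<Rightarrow> real) set) (C0k_norm k) \<and>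
    (\<exists>C>0. \<forall>f \<in> (hermite_sobolev p :: (real^'n \<Rightarrow> real) set).
       \<exists>g \<in> C0k_space k. ae_eq f g \<and> C0k_norm k g \<le> C * hs_norm p f)"
proof (intro conjI)
  have "real CARD('n) / 4 \<le> real CARD('n) / 4 + real k / 2" by simp
  then have "p > real CARD('n) / 4" using assms by linarith
  then show "banach_function_space ae_eq (hermite_sobolev p :: (real^'n \<Rightarrow> real) set) (hs_norm p)"
    by (rule hermite_sobolev_banach)
  show "banach_function_space (=) (C0k_space k :: (real^'n \<Rightarrow> real) set) (C0k_norm k)"
    by (rule C0k_banach)
  obtain C where C: "C > 0" and synth: "\<And>(a :: ('n \<Rightarrow> nat) \<Rightarrow> real) c.
    (\<And>N. L2_set (\<lambda>n. hermite_weight n powr p * a n) (order_less N) \<le> c) \<Longrightarrow>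
    \<exists>g \<in> C0k_space k. g \<in> L2_space \<and> (\<forall>n. hermite_coeff g n = a n) \<and> C0k_norm k g \<le> C * c"
    using hermite_synthesis[OF assms] by blast
  have "\<exists>g \<in> C0k_space k. ae_eq f g \<and> C0k_norm k g \<le> C * hs_norm p f"
    if f: "f \<in> hermite_sobolev p" for f :: "real^'n \<Rightarrow> real"
  proof -
    \<comment> \<open>\<open>g\<close> is rebuilt from the coefficients of \<open>f\<close>, with
      the norm of \<open>f\<close> as the bound on blocks. The difference of \<open>f\<close> and
      \<open>g\<close> is then in L^2 with all coefficients 0.\<close>
    obtain g where g: "g \<in> C0k_space k" "g \<in> L2_space" "\<And>n. hermite_coeff g n = hermite_coeff f n"
      "C0k_norm k g \<le> C * hs_norm p f"
      using synth[OF coeff_le_hs_norm[OF f]] by blast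
    have fL2: "f \<in> L2_space" using f by (rule hermite_sobolev_L2)
    have "ae_eq (\<lambda>x. 1 * f x + (-1) * g x) (\<lambda>_. 0)"
    proof (rule hermite_complete)
      show "L2_inner (\<lambda>x. 1 * f x + (-1) * g x) (hermite_fun n) = 0" for n
        using hermite_coeff_lincomb[OF fL2 g(2), of 1 "-1" n] g(3)[of n] by (simp add: hermite_coeff_def)
    qed (rule L2_space_lincomb[OF fL2 g(2)])
    then have "ae_eq f g" by (simp add: ae_eq_def)
    then show ?thesis using g by blast
  qed
  then show "\<exists>C>0. \<forall>f \<in> (hermite_sobolev p :: (real^'n \<Rightarrow> real) set).
       \<exists>g \<in> C0k_space k. ae_eq f g \<and> C0k_norm k g \<le> C * hs_norm p f"
    using C by blast
qed

end
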